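(* Suppose that the temporal polynomial degree $p_t$ is constant, that no local refinement with respect to time is present in the discretization (on every slab $I_k$ the temporal test space $T_K(I_k)$ does not depend on the spatial element $K$), and that $\varepsilon\ge\varepsilon_{\min}>0$ and $\mu\ge\mu_{\min}>0$ are element-wise constant. Let $(E_h,H_h)$ be a discrete solution on the slabs $I_1,\dots,I_N$, $N\ge1$: on each slab $I_k$ its restriction lies in $V_h\times V_h$ and satisfies $C_h((E_h,H_h),(v,w))=\ell_E^k(v)+\ell_H^k(w)$ for all $(v,w)\in W_h\times W_h$ (spaces and forms of the slab $I_k$), and its initial value on $I_{k+1}$ equals its final value on $I_k$. Then $$\mathcal E(t_N)\le 2\,\mathcal E(t_1)+2\sum_{k=1}^{N}\left(\Big(\frac{2t_N}{\varepsilon_{\min}}+\frac{\Delta t^2}{2t_N\varepsilon_{\min}}\Big)\|\ell_E^k\|_{W_h'}^2+\Big(\frac{2t_N}{\mu_{\min}}+\frac{\Delta t^2}{2t_N\mu_{\min}}\Big)\|\ell_H^k\|_{W_h'}^2\right).$$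
   Context: Setting: the discretization of Maxwell's equations $\varepsilon E_t-\operatorname{curl}H=J$, $\mu H_t+\operatorname{curl}E=0$ in $\Omega\subset\mathbb R^3$, with boundary condition $n\times E=n\times g$ on $\partial\Omega$. Here $\varepsilon(x),\mu(x):\Omega\to\mathbb R$ are the (time-independent) permittivity and permeability, and $J,g$ are given data regular enough for the integrals below to exist. The time axis is divided into equal slabs $I_k=(t_{k-1},t_k]$, $t_k=k\Delta t$, $k=1,\dots,N$. Mesh on a slab $I_k$: $\Omega$ is partitioned into finitely many non-overlapping hexahedral elements $K=F_K(\hat K)$, $\hat K=[0,1]^3$, where $F_K$ is a smooth invertible map with Jacobian matrix $DF_K$. For each $K$, $I_k$ is partitioned into subintervals $I_{k,1}^K,\dots,I_{k,N_K}^K$. The space-time elements carry a temporal degree $p_t\ge1$ and spatial degrees $p_x,p_y,p_z$, where the spatial degrees may depend on $K$ but not on the subinterval. Spaces on $I_k$: $P_p(I)$ denotes polynomials of degree at most $p$ on $I$, and $Q_{p_x,p_y,p_z}(\hat K)$ tensor product polynomials of degrees $p_x,p_y,p_z$ in the three coordinates. $S_K(I_k)$ is the set of $u\in H^1(I_k)$ whose restriction to each subinterval $I_{k,j}^K$ is in $P_{p_t}(I_{k,j}^K)$; $T_K(I_k)$ is the set of $u\in L_2(I_k)$ whose restriction to each $I_{k,j}^K$ is in $P_{p_t-1}(I_{k,j}^K)$. $V_h$ is the space of $v\in H^1(I_k;L_2(\Omega)^3)$ such that for each $K$, $DF_K^T\,(v|_K\circ F_K)\in S_K(I_k)\otimes[Q_{p_x,p_y,p_z}(\hat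 K)]^3$ (composition in the spatial variable). $W_h$ is the space of $v\in L_2(I_k;L_2(\Omega)^3)$ such that for each $K$, $DF_K^T\,(v|_K\circ F_K)\in T_K(I_k)\otimes[Q_{p_x,p_y,p_z}(\hat K)]^3$. Functions in both spaces may be discontinuous across spatial element interfaces. Faces and traces: $\mathcal F_0$ is the set of interior faces $f=\partial K^1\cap\partial K^2$, $\mathcal F_b$ the set of boundary faces $f=\partial K\cap\partial\Omega$. On an interior face, $\{v\}=(v^1+v^2)/2$ and $[v]_T=n^1\times v^1+n^2\times v^2$, where $v^i$ is the trace from $K^i$ and $n^i$ the outward unit normal of $K^i$. On a boundary face, $\{v\}=v$ and $[v]_T=n\times v$. Forms on $I_k$: $(a,b)=\int_{I_k}\int_\Omega a\cdot b\,dx\,dt$; $\langle a,b\rangle_{\mathcal G}=\int_{I_k}\sum_{f\in\mathcal G}\int_f a\cdot b\,dS\,dt$ for a set $\mathcal G$ of faces; $\operatorname{curl}_h$ is the element-wise curl in space. Then $$C_h((E_h,H_h),(v,w))=(\varepsilon\partial_tE_h,v)+(\mu\partial_tH_h,w)-(H_h,\operatorname{curl}_hv)+(\operatorname{curl}_hE_h,w)+\langle\{H_h\},[v]_T\rangle_{\mathcal F_0\cup\mathcal F_b}-\langle[E_h]_T,\{w\}\rangle_{\mathcal F_0\cup\mathcal F_b},$$ $$\ell_E^k(v)=(J,v),\qquad \ell_H^k(w)=-\langle n\times g,w\rangle_{\mathcal F_b}.$$ The dual norm on the test space of the slab $I_k$ is $\|\ell\|_{W_h'}=\sup_{0\ne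 v\in W_h}|\ell(v)|/\|v\|_{L_2(I_k;L_2(\Omega)^3)}$. Energy: $\mathcal E(t)=\frac12\int_\Omega(\varepsilon E_h\cdot E_h+\mu H_h\cdot H_h)\,dx$ at time $t$. *)

theory Defs
  imports
    "HOL-Analysis.Analysis"
    "HOL-Computational_Algebra.Polynomial"
begin

section \<open>Smooth functions and one-dimensional Sobolev regularity\<close>

primrec Ck_on :: "nat \<Rightarrow> 'a::euclidean_space set \<Rightarrow> ('a \<Rightarrow> 'b::real_normed_vector) \<Rightarrow> bool" where
  "Ck_on 0 U f \<longleftrightarrow> continuous_on U f"
| "Ck_on (Suc n) U f \<longleftrightarrow>
     (\<forall>x\<in>U. f differentiable (at x)) \<and>
     (\<forall>b\<in>Basis. Ck_on n U (\<lambda>x. frechet_derivative f (at x) b))"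

definition smooth_on :: "'a::euclidean_space set \<Rightarrow> ('a \<Rightarrow> 'b::real_normed_vector) \<Rightarrow> bool" where
  "smooth_on U f \<longleftrightarrow> open U \<and> (\<forall>n. Ck_on n U f)"

definition test_functions :: "real set \<Rightarrow> (real \<Rightarrow> real) set" where
  "test_functions I =
     {\<phi>. smooth_on UNIV \<phi> \<and> (\<exists>C. compact C \<and> C \<subseteq> interior I \<and> (\<forall>t. t \<notin> C \<longrightarrow> \<phi> t = 0))}"

definition L2_on :: "'a::euclidean_space set \<Rightarrow> ('a \<Rightarrow> 'b::euclidean_space) \<Rightarrow> bool" where
  "L2_on S u \<longleftrightarrow> set_borel_measurable lebesgue S u \<and>
     set_integrable lebesgue S (\<lambda>x. (norm (u x))\<^sup>2)"

text \<open>Elements of \<open>H\<^sup>1(I)\<close> are represented by their continuous representatives.\<close>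

definition H1_on :: "real set \<Rightarrow> (real \<Rightarrow> real) \<Rightarrow> bool" where
  "H1_on I u \<longleftrightarrow> L2_on I u \<and> continuous_on I u \<and>
     (\<exists>u'. L2_on I u' \<and>
        (\<forall>\<phi>\<in>test_functions I.
           (LINT t:I|lebesgue. u t * deriv \<phi> t) = - (LINT t:I|lebesgue. u' t * \<phi> t)))"

type_synonym field3 = "real \<Rightarrow> real^3 \<Rightarrow> real^3"

text \<open>\<open>L\<^sub>2(I; L\<^sub>2(\<Omega>)\<^sup>3)\<close>, identified with \<open>L\<^sub>2(I \<times> \<Omega>)\<^sup>3\<close>.\<close>

definition L2_L2 :: "real set \<Rightarrow> (real^3) set \<Rightarrow> field3 \<Rightarrow> bool" where
  "L2_L2 I \<Omega> v \<longleftrightarrow> L2_on (I \<times> \<Omega>) (\<lambda>(t, x). v t x)"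

text \<open>The identity defining the weak time derivative is one between elements of
  \<open>L\<^sub>2(\<Omega>)\<^sup>3\<close>, hence holds for almost every \<open>x\<close>.\<close>

definition H1_L2 :: "real set \<Rightarrow> (real^3) set \<Rightarrow> field3 \<Rightarrow> bool" where
  "H1_L2 I \<Omega> v \<longleftrightarrow> L2_L2 I \<Omega> v \<and>
     (\<exists>v'. L2_L2 I \<Omega> v' \<and>
        (\<forall>\<phi>\<in>test_functions I. AE x in lebesgue. x \<in> \<Omega> \<longrightarrow>
           (LINT t:I|lebesgue. deriv \<phi> t *\<^sub>R v t x) = - (LINT t:I|lebesgue. \<phi> t *\<^sub>R v' t x)))"

definition L2_norm :: "real set \<Rightarrow> (real^3) set \<Rightarrow> field3 \<Rightarrow> real" where
  "L2_norm I \<Omega> v = sqrt (LINT t:I|lebesgue. LINT x:\<Omega>|lebesgue. (norm (v t x))\<^sup>2)"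


section \<open>Surface measure\<close>

definition hausdorff2_pre :: "real \<Rightarrow> (real^3) set \<Rightarrow> ennreal" where
  "hausdorff2_pre \<delta> A =
     (INF C \<in> {C :: nat \<Rightarrow> (real^3) set.
                 A \<subseteq> (\<Union>i. C i) \<and> (\<forall>i. bounded (C i) \<and> diameter (C i) \<le> \<delta>)}.
        \<Sum>i. ennreal (pi / 4 * (diameter (C i))\<^sup>2))"

definition hausdorff2 :: "(real^3) set \<Rightarrow> ennreal" where
  "hausdorff2 A = (SUP \<delta>\<in>{0<..}. hausdorff2_pre \<delta> A)"

text \<open>The two-dimensional Hausdorff measure, which is the surface area on smooth surfaces.
  Covers consist of bounded sets because \<open>diameter\<close> has no meaning on unbounded ones.\<close>

definition surface_measure :: "(real^3) measure" where
  "surface_measure = measure_of UNIV (sets borel) hausdorff2"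


section \<open>Space-time mesh of one slab\<close>

abbreviation ref_cube :: "(real^3) set" where
  "ref_cube \<equiv> cbox 0 1"

text \<open>\<open>elems\<close> is a set of labels; the hexahedron labelled \<open>K\<close> is the image of the reference
  cube under \<open>emap K\<close>. The \<open>j\<close>-th subinterval for \<open>K\<close> is
  \<open>(tpart K j, tpart K (j + 1)]\<close>, \<open>j < nsub K\<close>, with temporal degree \<open>tdeg K j\<close>.\<close>

record 'e mesh =
  elems :: "'e set"
  emap :: "'e \<Rightarrow> real^3 \<Rightarrow> real^3"
  nsub :: "'e \<Rightarrow> nat"
  tpart :: "'e \<Rightarrow> nat \<Rightarrow> real"
  tdeg :: "'e \<Rightarrow> nat \<Rightarrow> nat"
  xdeg :: "'e \<Rightarrow> nat"
  ydeg :: "'e \<Rightarrow> nat"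
  zdeg :: "'e \<Rightarrow> nat"

definition cell :: "'e mesh \<Rightarrow> 'e \<Rightarrow> (real^3) set" where
  "cell M K = emap M K ` ref_cube"

definition DF :: "'e mesh \<Rightarrow> 'e \<Rightarrow> real^3 \<Rightarrow> real^3^3" where
  "DF M K \<xi> = jacobian (emap M K) (at \<xi>)"

definition subint :: "'e mesh \<Rightarrow> 'e \<Rightarrow> nat \<Rightarrow> real set" where
  "subint M K j = {tpart M K j <.. tpart M K (Suc j)}"

definition slab_mesh :: "(real^3) set \<Rightarrow> real \<Rightarrow> real \<Rightarrow> 'e mesh \<Rightarrow> bool" where
  "slab_mesh \<Omega> a b M \<longleftrightarrow>
     finite (elems M) \<and>
     (\<forall>K\<in>elems M.
        (\<exists>U. ref_cube \<subseteq> U \<and> smooth_on U (emap M K)) \<and>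
        inj_on (emap M K) ref_cube \<and>
        (\<forall>\<xi>\<in>ref_cube. invertible (DF M K \<xi>))) \<and>
     (\<forall>K\<in>elems M. \<forall>K'\<in>elems M. K \<noteq> K' \<longrightarrow>
        interior (cell M K) \<inter> interior (cell M K') = {}) \<and>
     (\<Union>K\<in>elems M. interior (cell M K)) \<subseteq> \<Omega> \<and> \<Omega> \<subseteq> (\<Union>K\<in>elems M. cell M K) \<and>
     (\<forall>K\<in>elems M.
        tpart M K 0 = a \<and> tpart M K (nsub M K) = b \<and>
        (\<forall>j<nsub M K. tpart M K j < tpart M K (Suc j) \<and> 1 \<le> tdeg M K j))"


section \<open>Discrete spaces\<close>

definition P_on :: "nat \<Rightarrow> real set \<Rightarrow> (real \<Rightarrow> real) set" where
  "P_on p I = {u. \<exists>q :: real poly. degree q \<le> p \<and> (\<forall>t\<in>I. u t = poly q t)}"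

definition Q_space :: "nat \<Rightarrow> nat \<Rightarrow> nat \<Rightarrow> (real^3 \<Rightarrow> real) set" where
  "Q_space px py pz =
     {q. \<exists>c :: nat \<Rightarrow> nat \<Rightarrow> nat \<Rightarrow> real. \<forall>\<xi>.
        q \<xi> = (\<Sum>i\<le>px. \<Sum>j\<le>py. \<Sum>l\<le>pz. c i j l * (\<xi>$1)^i * (\<xi>$2)^j * (\<xi>$3)^l)}"

definition Q3_space :: "nat \<Rightarrow> nat \<Rightarrow> nat \<Rightarrow> (real^3 \<Rightarrow> real^3) set" where
  "Q3_space px py pz = {q. \<forall>i. (\<lambda>\<xi>. q \<xi> $ i) \<in> Q_space px py pz}"

definition S_space :: "real set \<Rightarrow> 'e mesh \<Rightarrow> 'e \<Rightarrow> (real \<Rightarrow> real) set" where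
  "S_space I M K =
     {u. H1_on I u \<and> (\<forall>j<nsub M K. u \<in> P_on (tdeg M K j) (subint M K j))}"

definition T_space :: "real set \<Rightarrow> 'e mesh \<Rightarrow> 'e \<Rightarrow> (real \<Rightarrow> real) set" where
  "T_space I M K =
     {u. L2_on I u \<and> (\<forall>j<nsub M K. u \<in> P_on (tdeg M K j - 1) (subint M K j))}"

definition tensor :: "(real \<Rightarrow> real) set \<Rightarrow> (real^3 \<Rightarrow> real^3) set \<Rightarrow> field3 set" where
  "tensor A B = {u. \<exists>(n::nat) s q. (\<forall>i<n. s i \<in> A \<and> q i \<in> B) \<and>
                      u = (\<lambda>t \<xi>. \<Sum>i<n. s i t *\<^sub>R q i \<xi>)}"

text \<open>\<open>DF\<^sub>K\<^sup>T (v|\<^sub>K \<circ> F\<^sub>K)\<close> agrees on \<open>I\<close> and the open reference cube with a member of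
  \<open>A \<otimes> Q\<^sup>3\<close>. The values of \<open>v\<close> on the element boundaries, a null set, are left unconstrained:
  traces are limits from the interior.\<close>

definition pullback_in :: "real set \<Rightarrow> 'e mesh \<Rightarrow> 'e \<Rightarrow> (real \<Rightarrow> real) set \<Rightarrow> field3 \<Rightarrow> bool" where
  "pullback_in I M K A v \<longleftrightarrow>
     (\<exists>u\<in>tensor A (Q3_space (xdeg M K) (ydeg M K) (zdeg M K)).
        \<forall>t\<in>I. \<forall>\<xi>\<in>interior ref_cube.
          transpose (DF M K \<xi>) *v v t (emap M K \<xi>) = u t \<xi>)"

definition V_h :: "real set \<Rightarrow> (real^3) set \<Rightarrow> 'e mesh \<Rightarrow> field3 set" where
  "V_h I \<Omega> M = {v. H1_L2 I \<Omega> v \<and> (\<forall>K\<in>elems M. pullback_in I M K (S_space I M K) v)}"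

definition W_h :: "real set \<Rightarrow> (real^3) set \<Rightarrow> 'e mesh \<Rightarrow> field3 set" where
  "W_h I \<Omega> M = {v. L2_L2 I \<Omega> v \<and> (\<forall>K\<in>elems M. pullback_in I M K (T_space I M K) v)}"


section \<open>Faces and traces\<close>

text \<open>A face is stored as a pair of the set of adjacent elements and the point set \<open>f\<close>.
  Pairs of elements that meet only in an edge, in a vertex or not at all give point sets of
  surface measure zero.\<close>

type_synonym 'e face = "'e set \<times> (real^3) set"

definition interior_faces :: "'e mesh \<Rightarrow> 'e face set" where
  "interior_faces M = {({K1, K2}, frontier (cell M K1) \<inter> frontier (cell M K2)) | K1 K2.
     K1 \<in> elems M \<and> K2 \<in> elems M \<and> K1 \<noteq> K2}"

definition boundary_faces :: "(real^3) set \<Rightarrow> 'e mesh \<Rightarrow> 'e face set" where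
  "boundary_faces \<Omega> M = {({K}, frontier (cell M K) \<inter> frontier \<Omega>) | K. K \<in> elems M}"

definition trace_on :: "'e mesh \<Rightarrow> 'e \<Rightarrow> (real^3 \<Rightarrow> real^3) \<Rightarrow> real^3 \<Rightarrow> real^3" where
  "trace_on M K v x = Lim (at x within interior (cell M K)) v"

text \<open>Outward normal of the cube on its six open sides; the edges are irrelevant.\<close>

definition ref_normal :: "real^3 \<Rightarrow> real^3" where
  "ref_normal \<xi> = (\<chi> i. if \<xi> $ i = 0 then - 1 else if \<xi> $ i = 1 then 1 else 0)"

text \<open>Normals transform with \<open>DF\<^sup>-\<^sup>T\<close>: this is the direction of the gradient of
  \<open>\<plusminus> (F\<^sup>-\<^sup>1)\<^sub>i\<close>, which is outward for either sign of \<open>det DF\<close>.\<close>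

definition outward_normal :: "'e mesh \<Rightarrow> 'e \<Rightarrow> real^3 \<Rightarrow> real^3" where
  "outward_normal M K x =
     (let \<xi> = inv_into ref_cube (emap M K) x
      in sgn (matrix_inv (transpose (DF M K \<xi>)) *v ref_normal \<xi>))"

text \<open>Average and tangential jump: two adjacent elements on an interior face, one on a boundary
  face.\<close>

definition average :: "'e mesh \<Rightarrow> 'e set \<Rightarrow> (real^3 \<Rightarrow> real^3) \<Rightarrow> real^3 \<Rightarrow> real^3" where
  "average M S v x = (1 / real (card S)) *\<^sub>R (\<Sum>K\<in>S. trace_on M K v x)"

definition jump :: "'e mesh \<Rightarrow> 'e set \<Rightarrow> (real^3 \<Rightarrow> real^3) \<Rightarrow> real^3 \<Rightarrow> real^3" where
  "jump M S v x = (\<Sum>K\<in>S. cross3 (outward_normal M K x) (trace_on M K v x))"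


section \<open>Forms\<close>

definition curl :: "(real^3 \<Rightarrow> real^3) \<Rightarrow> real^3 \<Rightarrow> real^3" where
  "curl v x =
     (let D = jacobian v (at x)
      in vector [D$3$2 - D$2$3, D$1$3 - D$3$1, D$2$1 - D$1$2])"

text \<open>Off the element boundaries, which form a null set, the pointwise curl is the element-wise
  curl.\<close>

definition curl_h :: "field3 \<Rightarrow> field3" where
  "curl_h v t x = curl (v t) x"

text \<open>For members of \<open>V\<^sub>h\<close> this exists for all but finitely many \<open>t\<close> in the slab and equals the
  weak time derivative.\<close>

definition dt_h :: "field3 \<Rightarrow> field3" where
  "dt_h v t x = vector_derivative (\<lambda>s. v s x) (at t)"

definition vol_form :: "real set \<Rightarrow> (real^3) set \<Rightarrow> field3 \<Rightarrow> field3 \<Rightarrow> real" where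
  "vol_form I \<Omega> a b = (LINT t:I|lebesgue. LINT x:\<Omega>|lebesgue. a t x \<bullet> b t x)"

text \<open>The two integrands may depend on the face through its adjacent elements.\<close>

definition face_form ::
  "real set \<Rightarrow> 'e face set \<Rightarrow> ('e set \<Rightarrow> field3) \<Rightarrow> ('e set \<Rightarrow> field3) \<Rightarrow> real" where
  "face_form I G a b =
     (LINT t:I|lebesgue. \<Sum>(S, f)\<in>G. LINT x:f|surface_measure. a S t x \<bullet> b S t x)"

definition C_h ::
  "real set \<Rightarrow> (real^3) set \<Rightarrow> 'e mesh \<Rightarrow> (real^3 \<Rightarrow> real) \<Rightarrow> (real^3 \<Rightarrow> real) \<Rightarrow>
     field3 \<times> field3 \<Rightarrow> field3 \<times> field3 \<Rightarrow> real" where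
  "C_h I \<Omega> M \<epsilon> \<mu> = (\<lambda>(E, H) (v, w).
     vol_form I \<Omega> (\<lambda>t x. \<epsilon> x *\<^sub>R dt_h E t x) v
     + vol_form I \<Omega> (\<lambda>t x. \<mu> x *\<^sub>R dt_h H t x) w
     - vol_form I \<Omega> H (curl_h v)
     + vol_form I \<Omega> (curl_h E) w
     + face_form I (interior_faces M \<union> boundary_faces \<Omega> M)
         (\<lambda>S t. average M S (H t)) (\<lambda>S t. jump M S (v t))
     - face_form I (interior_faces M \<union> boundary_faces \<Omega> M)
         (\<lambda>S t. jump M S (E t)) (\<lambda>S t. average M S (w t)))"

definition ell_E :: "real set \<Rightarrow> (real^3) set \<Rightarrow> field3 \<Rightarrow> field3 \<Rightarrow> real" where
  "ell_E I \<Omega> J v = vol_form I \<Omega> J v"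

text \<open>On a boundary face \<open>S\<close> is the singleton of the adjacent element, so the sum is
  \<open>n \<times> g\<close> and the average is the trace.\<close>

definition ell_H :: "real set \<Rightarrow> (real^3) set \<Rightarrow> 'e mesh \<Rightarrow> field3 \<Rightarrow> field3 \<Rightarrow> real" where
  "ell_H I \<Omega> M g w = - face_form I (boundary_faces \<Omega> M)
     (\<lambda>S t x. \<Sum>K\<in>S. cross3 (outward_normal M K x) (g t x)) (\<lambda>S t. average M S (w t))"

text \<open>Existence of the integrals in \<open>ell_E\<close> and \<open>ell_H\<close>.\<close>

definition admissible_data ::
  "real set \<Rightarrow> (real^3) set \<Rightarrow> 'e mesh \<Rightarrow> field3 \<Rightarrow> field3 \<Rightarrow> bool" where
  "admissible_data I \<Omega> M J g \<longleftrightarrow>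
     (\<forall>v\<in>W_h I \<Omega> M.
        (AE t in lebesgue. t \<in> I \<longrightarrow> set_integrable lebesgue \<Omega> (\<lambda>x. J t x \<bullet> v t x)) \<and>
        set_integrable lebesgue I (\<lambda>t. LINT x:\<Omega>|lebesgue. J t x \<bullet> v t x)) \<and>
     (\<forall>w\<in>W_h I \<Omega> M. \<forall>K\<in>elems M.
        let f = frontier (cell M K) \<inter> frontier \<Omega>;
            h = (\<lambda>t x. cross3 (outward_normal M K x) (g t x) \<bullet> trace_on M K (w t) x)
        in (AE t in lebesgue. t \<in> I \<longrightarrow> set_integrable surface_measure f (h t)) \<and>
           set_integrable lebesgue I (\<lambda>t. LINT x:f|surface_measure. h t x))"

text \<open>Nonzero as an element of \<open>L\<^sub>2\<close> means nonzero norm.\<close>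

definition dual_norm :: "real set \<Rightarrow> (real^3) set \<Rightarrow> 'e mesh \<Rightarrow> (field3 \<Rightarrow> real) \<Rightarrow> ennreal" where
  "dual_norm I \<Omega> M l =
     (SUP v \<in> {v \<in> W_h I \<Omega> M. L2_norm I \<Omega> v \<noteq> 0}. ennreal (\<bar>l v\<bar> / L2_norm I \<Omega> v))"


section \<open>Time stepping\<close>

definition tk :: "real \<Rightarrow> nat \<Rightarrow> real" where
  "tk \<Delta> k = real k * \<Delta>"

definition slab :: "real \<Rightarrow> nat \<Rightarrow> real set" where
  "slab \<Delta> k = {tk \<Delta> (k - 1) <.. tk \<Delta> k}"

text \<open>The initial value on the slab after \<open>s\<close> is the limit in \<open>L\<^sub>2(\<Omega>)\<^sup>3\<close> as \<open>t \<down> s\<close>.\<close>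

definition continues_at :: "(real^3) set \<Rightarrow> field3 \<Rightarrow> real \<Rightarrow> bool" where
  "continues_at \<Omega> v s \<longleftrightarrow>
     ((\<lambda>t. LINT x:\<Omega>|lebesgue. (norm (v t x - v s x))\<^sup>2) \<longlongrightarrow> 0) (at_right s)"

definition discrete_solution ::
  "real \<Rightarrow> nat \<Rightarrow> (real^3) set \<Rightarrow> (nat \<Rightarrow> 'e mesh) \<Rightarrow> (real^3 \<Rightarrow> real) \<Rightarrow> (real^3 \<Rightarrow> real) \<Rightarrow>
     field3 \<Rightarrow> field3 \<Rightarrow> field3 \<Rightarrow> field3 \<Rightarrow> bool" where
  "discrete_solution \<Delta> N \<Omega> M \<epsilon> \<mu> J g E H \<longleftrightarrow>
     (\<forall>k\<in>{1..N}. let I = slab \<Delta> k in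
        E \<in> V_h I \<Omega> (M k) \<and> H \<in> V_h I \<Omega> (M k) \<and>
        (\<forall>v\<in>W_h I \<Omega> (M k). \<forall>w\<in>W_h I \<Omega> (M k).
           C_h I \<Omega> (M k) \<epsilon> \<mu> (E, H) (v, w) = ell_E I \<Omega> J v + ell_H I \<Omega> (M k) g w)) \<and>
     (\<forall>k\<in>{1..<N}. continues_at \<Omega> E (tk \<Delta> k) \<and> continues_at \<Omega> H (tk \<Delta> k))"

definition energy ::
  "(real^3) set \<Rightarrow> (real^3 \<Rightarrow> real) \<Rightarrow> (real^3 \<Rightarrow> real) \<Rightarrow> field3 \<Rightarrow> field3 \<Rightarrow> real \<Rightarrow> real" where
  "energy \<Omega> \<epsilon> \<mu> E H t =
     1 / 2 * (LINT x:\<Omega>|lebesgue. \<epsilon> x * (E t x \<bullet> E t x) + \<mu> x * (H t x \<bullet> H t x))"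

definition elementwise_constant :: "'e mesh \<Rightarrow> (real^3 \<Rightarrow> real) \<Rightarrow> bool" where
  "elementwise_constant M \<kappa> \<longleftrightarrow>
     (\<forall>K\<in>elems M. \<exists>c. \<forall>x\<in>interior (cell M K). \<kappa> x = c)"

end

(*
  Let pi be the L2 projection in time onto the broken polynomials of degree p_t - 1, common to
  all elements. On one slab, testing with (pi E, pi H) turns the time derivatives into the
  difference of the energies at the two ends; the curl terms and the face terms cancel in pairs
  because pi is symmetric and acts on time only, so no integration by parts in space is needed.
  What remains is at most D X, where D collects the dual norms and X is the weighted norm of
  (pi E, pi H). Testing with pi ((t_k - t) pi E) and its counterpart for H
  bounds X: the leading coefficients contribute with a favourable sign, and
  X^2 <= 2 dt e_{k-1} + 2 dt D X for the energy e_{k-1} at the start of the slab. Hence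
  D X <= (2 T + dt^2 / (2 T)) D^2 + m / (2 N) with T = t_N = N dt and m the largest energy;
  summing over the slabs absorbs m / 2.
*)
theory Submission
  imports Defs
begin

section \<open>Polynomials orthogonal on an interval\<close>

text \<open>The factor \<open>t_k - t\<close> cannot simply multiply pi E: the product has degree
  p_t, one too many for a test function, so it is projected once more. The resulting operator, pi
  after the weight after pi, is again symmetric, so the spatial terms cancel as they do without
  weight. Removing its projections in front of a time derivative costs one term per subinterval, a
  product of leading coefficients whose sign is opposite to the slope of the weight; a decreasing
  weight is therefore favourable, and its zero at t_k removes the unknown end energy. To exploit
  symmetry in time alone, both fields are expanded over one finite index set into products of a time
  factor and a spatial factor, with a time partition common to all elements. Every form becomes a
  double sum of a spatial matrix against time integrals of polynomials. The larger part of the work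
  makes this splitting legitimate: integrals add up only for integrable functions, so discrete
  fields, their curls, traces and normals must be controlled up to the element boundaries, and these
  must have finite area.\<close>

definition pint :: "real \<Rightarrow> real \<Rightarrow> real poly \<Rightarrow> real" where
  "pint c d q = (LINT t:{c<..d}|lebesgue. poly q t)"

lemma poly_absolutely_integrable: "poly q absolutely_integrable_on {c<..d::real}"
proof -
  have "poly q absolutely_integrable_on {c..d}"
    by (intro absolutely_integrable_continuous_real continuous_intros)
  then show ?thesis
    by (rule set_integrable_subset) auto
qed

lemma pint_add: "pint c d (q + r) = pint c d q + pint c d r"
  unfolding pint_def poly_add
  by (intro set_integral_add poly_absolutely_integrable)

lemma pint_smult: "pint c d (smult k q) = k * pint c d q"
  unfolding pint_def poly_smult by simp

lemma pint_0 [simp]: "pint c d 0 = 0"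
  unfolding pint_def poly_0 by simp

lemma pint_diff: "pint c d (q - r) = pint c d q - pint c d r"
  using pint_add[of c d "q - r" r] by simp

lemma pint_sum: "pint c d (\<Sum>i\<in>A. f i) = (\<Sum>i\<in>A. pint c d (f i))"
  by (induction A rule: infinite_finite_induct) (auto simp: pint_add)

lemma pint_eq_integral: "pint c d q = integral {c..d} (poly q)"
proof -
  have "pint c d q = integral {c<..d} (poly q)"
    unfolding pint_def by (intro set_lebesgue_integral_eq_integral poly_absolutely_integrable)
  also have "\<dots> = integral {c..d} (poly q)"
    by (rule integral_subset_negligible) (auto intro: negligible_subset[of "{c}"])
  finally show ?thesis .
qed

lemma pint_pderiv:
  assumes "c \<le> d"
  shows "pint c d (pderiv q) = poly q d - poly q c"
proof -
  have "(poly (pderiv q) has_integral (poly q d - poly q c)) {c..d}"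
    using assms
    by (intro fundamental_theorem_of_calculus)
      (auto intro!: DERIV_subset[OF poly_DERIV] simp: has_real_derivative_iff_has_vector_derivative[symmetric])
  then show ?thesis
    by (simp add: pint_eq_integral integral_unique)
qed

lemma pint_nonneg: "(\<And>t. t \<in> {c..d} \<Longrightarrow> 0 \<le> poly q t) \<Longrightarrow> 0 \<le> pint c d q"
  unfolding pint_eq_integral
  by (intro integral_nonneg) (auto intro!: integrable_continuous_real continuous_intros)

lemma pint_mono: "(\<And>t. t \<in> {c..d} \<Longrightarrow> poly q t \<le> poly r t) \<Longrightarrow> pint c d q \<le> pint c d r"
  using pint_nonneg[of c d "r - q"] by (simp add: pint_diff)

lemma pint_square_pos:
  assumes "c < d" "q \<noteq> 0"
  shows "0 < pint c d (q * q)"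
proof (rule ccontr)
  assume "\<not> ?thesis"
  moreover have "0 \<le> pint c d (q * q)"
    by (rule pint_nonneg) simp
  ultimately have "integral {c..d} (poly (q * q)) = 0"
    by (simp add: pint_eq_integral)
  then have "\<forall>t\<in>{c..d}. poly (q * q) t = 0"
    by (subst (asm) integral_eq_0_iff) (auto intro!: continuous_intros simp: \<open>c < d\<close>)
  then have "{c..d} \<subseteq> {t. poly q t = 0}"
    by auto
  then have "finite {c..d}"
    using poly_roots_finite[OF \<open>q \<noteq> 0\<close>] finite_subset by blast
  then show False
    using \<open>c < d\<close> infinite_Icc by blast
qed

text \<open>The monic Legendre polynomial of degree \<open>p\<close> on the interval. The condition
  on \<open>r\<close> is stated by coefficients because \<open>degree 0 = 0\<close>: at
  \<open>p = 0\<close> it singles out \<open>r = 0\<close>, as the Gram-Schmidt induction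
  requires.\<close>

definition ortho_monic :: "real \<Rightarrow> real \<Rightarrow> nat \<Rightarrow> real poly \<Rightarrow> bool" where
  "ortho_monic c d p L \<longleftrightarrow>
     degree L \<le> p \<and> coeff L p = 1 \<and> (\<forall>r. (\<forall>m\<ge>p. coeff r m = 0) \<longrightarrow> pint c d (L * r) = 0)"

text \<open>Gram-Schmidt started from \<open>monom 1 p\<close>: the inner induction gains
  orthogonality to one more degree at a time by subtracting the component along the monic orthogonal
  polynomial of degree \<open>k < p\<close> that the outer induction provides.\<close>

lemma ortho_monic_exists:
  assumes "c < d"
  shows "\<exists>L. ortho_monic c d p L"
proof (induction p rule: less_induct)
  case (less p)
  have "\<exists>L. degree L \<le> p \<and> coeff L p = 1 \<and> (\<forall>r. (\<forall>m\<ge>k. coeff r m = 0) \<longrightarrow> pint c d (L * r) = 0)"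
    if "k \<le> p" for k
    using that
  proof (induction k)
    case 0
    show ?case
    proof (intro exI[of _ "monom 1 p"] conjI allI impI)
      fix r :: "real poly" assume "\<forall>m\<ge>0. coeff r m = 0"
      then have "r = 0" by (auto intro: poly_eqI)
      then show "pint c d (monom 1 p * r) = 0" by simp
    qed (simp_all add: degree_monom_eq)
  next
    case (Suc k)
    then obtain L where L: "degree L \<le> p" "coeff L p = 1"
      "\<And>r. (\<And>m. m \<ge> k \<Longrightarrow> coeff r m = 0) \<Longrightarrow> pint c d (L * r) = 0"
      by auto
    obtain G where G: "degree G \<le> k" "coeff G k = 1"
      "\<And>r. (\<And>m. m \<ge> k \<Longrightarrow> coeff r m = 0) \<Longrightarrow> pint c d (G * r) = 0"
      using less.IH[of k] Suc.prems unfolding ortho_monic_def by auto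
    define \<gamma> where "\<gamma> = pint c d (G * G)"
    have "G \<noteq> 0" using G(2) by auto
    then have \<gamma>: "\<gamma> > 0"
      unfolding \<gamma>_def using pint_square_pos[OF assms] by blast
    define Q where "Q = L - smult (pint c d (L * G) / \<gamma>) G"
    have cG: "coeff G m = 0" if "m > k" for m
      using G(1) that by (intro coeff_eq_0) auto
    show ?case
    proof (intro exI[of _ Q] conjI allI impI)
      show "degree Q \<le> p"
        unfolding Q_def using L(1) G(1) Suc.prems
        by (intro degree_diff_le order.trans[OF degree_smult_le]) auto
      \<comment> \<open>\<open>G\<close> has degree at most \<open>k < p\<close>, so the correction
        leaves the leading coefficient alone.\<close>
      show "coeff Q p = 1"
        unfolding Q_def using L(2) cG[of p] Suc.prems by simp
    next
      fix r :: "real poly" assume r: "\<forall>m\<ge>Suc k. coeff r m = 0"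
      \<comment> \<open>Splitting off the top coefficient of \<open>r\<close> along \<open>G\<close>
        leaves a remainder without coefficients from \<open>k\<close> on, to which the orthogonality
        of both \<open>L\<close> and \<open>G\<close> applies.\<close>
      define r' where "r' = r - smult (coeff r k) G"
      have r': "coeff r' m = 0" if "m \<ge> k" for m
        using that r G(2) cG[of m] unfolding r'_def by (cases "m = k") auto
      have "r = r' + smult (coeff r k) G" unfolding r'_def by simp
      then have "pint c d (Q * r) = pint c d (Q * r') + coeff r k * pint c d (Q * G)"
        by (metis (no_types, lifting) distrib_left mult_smult_right pint_add pint_smult)
      moreover have "pint c d (Q * r') = 0"
        unfolding Q_def using L(3)[of r'] G(3)[of r'] r'
        by (simp add: left_diff_distrib pint_diff pint_smult)
      moreover have "pint c d (Q * G) = 0"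
        unfolding Q_def using \<gamma>
        by (simp add: left_diff_distrib pint_diff pint_smult \<gamma>_def[symmetric])
      ultimately show "pint c d (Q * r) = 0" by simp
    qed
  qed
  from this[of p] show ?case
    unfolding ortho_monic_def by auto
qed

section \<open>Projection onto polynomials of one degree less, plain and weighted\<close>

definition legendre :: "real \<Rightarrow> real \<Rightarrow> nat \<Rightarrow> real poly" where
  "legendre c d p = (SOME L. ortho_monic c d p L)"

text \<open>For \<open>degree q \<le> p\<close> this is the L2 projection onto degree below
  \<open>p\<close>: the monic Legendre polynomial spans the orthogonal complement, and its
  coefficient can be read off \<open>q\<close>.\<close>

definition low_proj :: "real \<Rightarrow> real \<Rightarrow> nat \<Rightarrow> real poly \<Rightarrow> real poly" where
  "low_proj c d p q = q - smult (coeff q p) (legendre c d p)"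

text \<open>The compression of multiplication by \<open>\<theta>\<close> to degree below
  \<open>p\<close>. For \<open>degree \<theta> \<le> 1\<close> the product has degree at most
  \<open>p\<close>, so the outer \<open>low_proj\<close> is still an L2 projection.\<close>

definition weighted_proj :: "real \<Rightarrow> real \<Rightarrow> nat \<Rightarrow> real poly \<Rightarrow> real poly \<Rightarrow> real poly" where
  "weighted_proj c d p \<theta> q = low_proj c d p (\<theta> * low_proj c d p q)"

context
  fixes c d :: real and p :: nat
  assumes cd: "c < d" and p: "1 \<le> p"
begin

lemma legendre: "ortho_monic c d p (legendre c d p)"
  unfolding legendre_def using someI_ex[OF ortho_monic_exists[OF cd]] .

lemma legendre_orth: "degree r < p \<Longrightarrow> pint c d (legendre c d p * r) = 0"
  using legendre unfolding ortho_monic_def by (simp add: coeff_eq_0)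

lemma degree_low_proj:
  assumes "degree q \<le> p"
  shows "degree (low_proj c d p q) < p"
proof -
  have "coeff (low_proj c d p q) m = 0" if "m \<ge> p" for m
    using legendre assms that unfolding low_proj_def ortho_monic_def
    by (cases "m = p") (auto simp: coeff_eq_0)
  then have "degree (low_proj c d p q) \<le> p - 1"
    using p by (intro degree_le) auto
  then show ?thesis using p by simp
qed

lemma pint_low_proj:
  assumes "degree r < p"
  shows "pint c d (low_proj c d p q * r) = pint c d (q * r)"
  unfolding low_proj_def using legendre_orth[OF assms]
  by (simp add: left_diff_distrib pint_diff pint_smult)

text \<open>Only the Legendre component of \<open>q\<close> survives, because its projection has
  degree below \<open>p\<close>.\<close>

lemma pint_legendre_top:
  assumes "degree q \<le> p"
  shows "pint c d (legendre c d p * q) = coeff q p * pint c d (legendre c d p * legendre c d p)"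
proof -
  have "q = low_proj c d p q + smult (coeff q p) (legendre c d p)"
    unfolding low_proj_def by simp
  then have "pint c d (legendre c d p * q) = pint c d (legendre c d p * low_proj c d p q)
      + coeff q p * pint c d (legendre c d p * legendre c d p)"
    by (metis distrib_left mult_smult_right pint_add pint_smult)
  then show ?thesis
    using legendre_orth[OF degree_low_proj[OF assms]] by simp
qed

text \<open>Pythagoras in polarised form: projections and Legendre components are orthogonal to each
  other.\<close>

lemma pint_low_proj_both:
  assumes "degree q \<le> p" "degree r \<le> p"
  shows "pint c d (q * r) = pint c d (low_proj c d p q * low_proj c d p r)
    + coeff q p * coeff r p * pint c d (legendre c d p * legendre c d p)"
proof -
  have "pint c d (q * r) = pint c d (low_proj c d p r * q) + coeff r p * pint c d (legendre c d p * q)"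
    unfolding low_proj_def by (simp add: algebra_simps pint_diff pint_smult)
  also have "pint c d (low_proj c d p r * q) = pint c d (low_proj c d p q * low_proj c d p r)"
    using pint_low_proj[OF degree_low_proj[OF assms(2)], of q] by (simp add: mult.commute)
  finally show ?thesis
    using pint_legendre_top[OF assms(1)] by simp
qed

context
  fixes \<theta> :: "real poly"
  assumes \<theta>: "degree \<theta> \<le> 1"
begin

lemma degree_weight_low_proj: "degree q \<le> p \<Longrightarrow> degree (\<theta> * low_proj c d p q) \<le> p"
  using degree_mult_le[of \<theta> "low_proj c d p q"] degree_low_proj[of q] \<theta> by linarith

lemma degree_weighted_proj: "degree q \<le> p \<Longrightarrow> degree (weighted_proj c d p \<theta> q) < p"
  unfolding weighted_proj_def by (intro degree_low_proj degree_weight_low_proj)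

text \<open>The projection is symmetric, so the outer one can be moved onto \<open>q\<close>; what
  remains is symmetric in \<open>q\<close> and \<open>r\<close>.\<close>

lemma pint_mult_weighted_proj:
  assumes "degree q \<le> p" "degree r \<le> p"
  shows "pint c d (q * weighted_proj c d p \<theta> r) =
    pint c d (\<theta> * low_proj c d p q * low_proj c d p r)"
proof -
  have "pint c d (q * weighted_proj c d p \<theta> r) = pint c d (low_proj c d p q * weighted_proj c d p \<theta> r)"
    using pint_low_proj[OF degree_weighted_proj[OF assms(2)]] by simp
  also have "\<dots> = pint c d (\<theta> * low_proj c d p r * low_proj c d p q)"
    unfolding weighted_proj_def
    using pint_low_proj[OF degree_low_proj[OF assms(1)], of "\<theta> * low_proj c d p r"]
    by (simp only: mult.commute)
  finally show ?thesis by (simp add: mult_ac)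
qed

lemma weighted_proj_sym:
  assumes "degree q \<le> p" "degree r \<le> p"
  shows "pint c d (q * weighted_proj c d p \<theta> r) = pint c d (weighted_proj c d p \<theta> q * r)"
  using pint_mult_weighted_proj[of q r] pint_mult_weighted_proj[of r q] assms
  by (simp add: mult_ac)

text \<open>\<open>pderiv q\<close> has degree below \<open>p\<close>, so the outer projection
  disappears. Replacing the inner one by the identity costs a multiple of the Legendre polynomial
  tested with \<open>\<theta> * pderiv q\<close>, which sees only the leading coefficient of that
  product.\<close>

lemma pint_pderiv_weighted_proj:
  assumes "degree q \<le> p" "degree r \<le> p"
  shows "pint c d (pderiv q * weighted_proj c d p \<theta> r) = pint c d (\<theta> * pderiv q * r)
    - coeff \<theta> 1 * real p * coeff q p * coeff r p * pint c d (legendre c d p * legendre c d p)"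
proof -
  have dq: "degree (pderiv q) < p"
    using assms(1) p by (simp add: degree_pderiv)
  have dm: "degree (\<theta> * pderiv q) \<le> p"
    using degree_mult_le[of \<theta> "pderiv q"] dq \<theta> by linarith
  \<comment> \<open>Only the slope of \<open>\<theta>\<close> reaches degree \<open>p\<close>; the
    factor \<open>p\<close> comes from differentiating the top monomial.\<close>
  have "coeff (\<theta> * pderiv q) p = coeff \<theta> 1 * (real p * coeff q p)"
  proof -
    have "\<theta> = [:coeff \<theta> 0, coeff \<theta> 1:]"
      using \<theta> by (intro poly_eqI) (auto simp: coeff_pCons coeff_eq_0 split: nat.split)
    moreover obtain p' where "p = Suc p'"
      using p by (cases p) auto
    ultimately have "coeff (\<theta> * pderiv q) p = coeff \<theta> 0 * coeff (pderiv q) p + coeff \<theta> 1 * coeff (pderiv q) p'"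
      by (smt (verit) add_0 coeff_add coeff_pCons_Suc coeff_smult mult_pCons_left mult_zero_left pCons_0_0 add.right_neutral)
    then show ?thesis
      using dq \<open>p = Suc p'\<close> assms(1)
      by (simp add: coeff_pderiv coeff_eq_0[of q "Suc (Suc p')"])
  qed
  moreover have "pint c d (pderiv q * weighted_proj c d p \<theta> r) = pint c d (\<theta> * low_proj c d p r * pderiv q)"
    unfolding weighted_proj_def using pint_low_proj[OF dq] by (simp add: mult.commute)
  moreover have "\<theta> * low_proj c d p r * pderiv q
      = \<theta> * pderiv q * r - smult (coeff r p) (legendre c d p * (\<theta> * pderiv q))"
    unfolding low_proj_def by (simp add: algebra_simps)
  ultimately show ?thesis
    using pint_legendre_top[OF dm] by (simp add: pint_diff pint_smult)
qed

text \<open>Pythagoras for \<open>\<theta> * low_proj c d p q\<close>. For \<open>q = r\<close> the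
  subtracted term is nonnegative, so the second projection can only shrink the norm.\<close>

lemma pint_weighted_proj_both:
  assumes "degree q \<le> p" "degree r \<le> p"
  shows "pint c d (weighted_proj c d p \<theta> q * weighted_proj c d p \<theta> r)
    = pint c d (\<theta> * \<theta> * low_proj c d p q * low_proj c d p r)
      - coeff (\<theta> * low_proj c d p q) p * coeff (\<theta> * low_proj c d p r) p
        * pint c d (legendre c d p * legendre c d p)"
  unfolding weighted_proj_def
  using pint_low_proj_both[of "\<theta> * low_proj c d p q" "\<theta> * low_proj c d p r"]
    degree_weight_low_proj[OF assms(1)] degree_weight_low_proj[OF assms(2)]
  by (simp add: mult_ac)

end
end

section \<open>Energy identities for broken polynomials in time\<close>

definition qform :: "'i set \<Rightarrow> ('i \<Rightarrow> 'i \<Rightarrow> real) \<Rightarrow> ('i \<Rightarrow> real) \<Rightarrow> real" where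
  "qform A C x = (\<Sum>i\<in>A. \<Sum>l\<in>A. C i l * (x i * x l))"

definition psd :: "'i set \<Rightarrow> ('i \<Rightarrow> 'i \<Rightarrow> real) \<Rightarrow> bool" where
  "psd A C \<longleftrightarrow> (\<forall>x. 0 \<le> qform A C x)"

definition tint :: "(nat \<Rightarrow> real) \<Rightarrow> nat \<Rightarrow> (nat \<Rightarrow> real poly) \<Rightarrow> real" where
  "tint \<tau> m q = (\<Sum>j<m. pint (\<tau> j) (\<tau> (Suc j)) (q j))"

text \<open>The space-time integral of two separated fields with time factors \<open>P i\<close> and
  \<open>R l\<close>, when \<open>C i l\<close> is the space integral of the spatial factors with
  these indices.\<close>

definition gram :: "(nat \<Rightarrow> real) \<Rightarrow> nat \<Rightarrow> 'i set \<Rightarrow> ('i \<Rightarrow> 'i \<Rightarrow> real) \<Rightarrow>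
    ('i \<Rightarrow> nat \<Rightarrow> real poly) \<Rightarrow> ('i \<Rightarrow> nat \<Rightarrow> real poly) \<Rightarrow> real" where
  "gram \<tau> m A C P R = (\<Sum>i\<in>A. \<Sum>l\<in>A. C i l * tint \<tau> m (\<lambda>j. P i j * R l j))"

lemma gram_eq_sum_pint:
  "gram \<tau> m A C P R = (\<Sum>j<m. \<Sum>i\<in>A. \<Sum>l\<in>A. C i l * pint (\<tau> j) (\<tau> (Suc j)) (P i j * R l j))"
  unfolding gram_def tint_def sum_distrib_left
  by (subst sum.swap, subst (2) sum.swap) simp

lemma pint_double_sum:
  "(\<Sum>i\<in>A. \<Sum>l\<in>B. C i l * pint c d (f i l)) = pint c d (\<Sum>i\<in>A. \<Sum>l\<in>B. smult (C i l) (f i l))"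
  by (simp add: pint_sum pint_smult)

text \<open>At each time the double sum is the weight times a value of \<open>qform A C\<close>,
  which is nonnegative, so the comparison is pointwise in \<open>t\<close>.\<close>

lemma pint_psd_mono:
  assumes "psd A C" "\<And>t. t \<in> {c..d} \<Longrightarrow> poly v t \<le> poly w t"
  shows "(\<Sum>i\<in>A. \<Sum>l\<in>A. C i l * pint c d (v * f i * f l))
    \<le> (\<Sum>i\<in>A. \<Sum>l\<in>A. C i l * pint c d (w * f i * f l))"
  unfolding pint_double_sum
proof (rule pint_mono)
  fix t assume "t \<in> {c..d}"
  then have "poly v t * qform A C (\<lambda>i. poly (f i) t) \<le> poly w t * qform A C (\<lambda>i. poly (f i) t)"
    using assms by (intro mult_right_mono) (auto simp: psd_def)
  then show "poly (\<Sum>i\<in>A. \<Sum>l\<in>A. smult (C i l) (v * f i * f l)) t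
      \<le> poly (\<Sum>i\<in>A. \<Sum>l\<in>A. smult (C i l) (w * f i * f l)) t"
    unfolding qform_def sum_distrib_left by (simp add: poly_sum mult_ac)
qed

text \<open>Produces the product rule: after symmetrisation the derivative falls on each of the two
  factors in turn.\<close>

lemma symmetrise:
  fixes C :: "'i \<Rightarrow> 'i \<Rightarrow> real"
  assumes "\<And>i l. C i l = C l i"
  shows "(\<Sum>i\<in>A. \<Sum>l\<in>A. C i l * f i l) = 1 / 2 * (\<Sum>i\<in>A. \<Sum>l\<in>A. C i l * (f i l + f l i))"
proof -
  have "(\<Sum>i\<in>A. \<Sum>l\<in>A. C i l * f i l) = (\<Sum>i\<in>A. \<Sum>l\<in>A. C i l * f l i)"
    by (subst sum.swap) (simp add: assms)
  then show ?thesis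
    by (simp add: distrib_left sum.distrib)
qed

lemma increasing_le:
  fixes \<tau> :: "nat \<Rightarrow> real"
  assumes "\<And>j. j < m \<Longrightarrow> \<tau> j < \<tau> (Suc j)"
  shows "i \<le> j \<Longrightarrow> j \<le> m \<Longrightarrow> \<tau> i \<le> \<tau> j"
proof (induction j)
  case (Suc j)
  then show ?case using assms[of j] by (cases "i = Suc j") (auto simp: le_Suc_eq)
qed simp

lemma sum_telescope_matching:
  fixes u v :: "nat \<Rightarrow> real"
  assumes "\<And>j. Suc j < m \<Longrightarrow> v j = u (Suc j)" "1 \<le> m"
  shows "(\<Sum>j<m. v j - u j) = v (m - 1) - u 0"
  using assms
proof (induction m)
  case (Suc m)
  show ?case
  proof (cases "m = 0")
    case False
    then have "(\<Sum>j<m. v j - u j) = v (m - 1) - u 0"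
      using Suc by auto
    moreover have "v (m - 1) = u m"
      using Suc.prems(1)[of "m - 1"] False by simp
    ultimately show ?thesis by simp
  qed simp
qed simp

text \<open>The time factors of a discrete solution on one slab: continuous piecewise polynomials on
  a partition shared by all indices.\<close>

locale broken_family =
  fixes \<tau> :: "nat \<Rightarrow> real" and m p :: nat and A :: "'i set" and P :: "'i \<Rightarrow> nat \<Rightarrow> real poly"
  assumes finite_A: "finite A" and m: "1 \<le> m" and p: "1 \<le> p"
    and nodes: "\<And>j. j < m \<Longrightarrow> \<tau> j < \<tau> (Suc j)"
    and deg: "\<And>i j. i \<in> A \<Longrightarrow> j < m \<Longrightarrow> degree (P i j) \<le> p"
    and cont: "\<And>i j. i \<in> A \<Longrightarrow> Suc j < m \<Longrightarrow> poly (P i j) (\<tau> (Suc j)) = poly (P i (Suc j)) (\<tau> (Suc j))"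
begin

text \<open>Weight 1 gives the L2 projection of the time factor, see \<open>test_1\<close>; weight
  \<open>\<rho>\<close> gives the second test function of the estimate. Both stay below degree
  \<open>p\<close> on every piece.\<close>

definition test :: "real poly \<Rightarrow> 'i \<Rightarrow> nat \<Rightarrow> real poly" where
  "test \<theta> i j = weighted_proj (\<tau> j) (\<tau> (Suc j)) p \<theta> (P i j)"

text \<open>\<open>\<tau> 0\<close> lies outside the half-open slab, so this is the limit from the
  right, read off the first polynomial piece.\<close>

definition left :: "'i \<Rightarrow> real" where "left i = poly (P i 0) (\<tau> 0)"
definition right :: "'i \<Rightarrow> real" where "right i = poly (P i (m - 1)) (\<tau> m)"

lemma nodes_mono: "i \<le> j \<Longrightarrow> j \<le> m \<Longrightarrow> \<tau> i \<le> \<tau> j"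
  by (rule increasing_le) (rule nodes)

lemma degree_test: "degree \<theta> \<le> 1 \<Longrightarrow> i \<in> A \<Longrightarrow> j < m \<Longrightarrow> degree (test \<theta> i j) < p"
  unfolding test_def by (intro degree_weighted_proj nodes p deg)

text \<open>The second projection acts as the identity, since its argument already has degree below
  \<open>p\<close>.\<close>

lemma test_1: "i \<in> A \<Longrightarrow> j < m \<Longrightarrow> test 1 i j = low_proj (\<tau> j) (\<tau> (Suc j)) p (P i j)"
  unfolding test_def weighted_proj_def low_proj_def[of _ _ _ "1 * _"]
  using degree_low_proj[OF nodes p deg] by (simp add: coeff_eq_0)

lemma tint_test_sym:
  assumes "degree \<theta> \<le> 1" "i \<in> A" "l \<in> A"
  shows "tint \<tau> m (\<lambda>j. P i j * test \<theta> l j) = tint \<tau> m (\<lambda>j. test \<theta> i j * P l j)"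
  unfolding tint_def test_def using assms
  by (intro sum.cong) (auto intro!: weighted_proj_sym nodes p deg)

abbreviation leg_sq :: "nat \<Rightarrow> real" where
  "leg_sq j \<equiv> pint (\<tau> j) (\<tau> (Suc j)) (legendre (\<tau> j) (\<tau> (Suc j)) p * legendre (\<tau> j) (\<tau> (Suc j)) p)"

lemma pint_pderiv_test:
  assumes "degree \<theta> \<le> 1" "i \<in> A" "l \<in> A" "j < m"
  shows "pint (\<tau> j) (\<tau> (Suc j)) (pderiv (P i j) * test \<theta> l j)
    = pint (\<tau> j) (\<tau> (Suc j)) (\<theta> * pderiv (P i j) * P l j)
      - coeff \<theta> 1 * real p * leg_sq j * (coeff (P i j) p * coeff (P l j) p)"
  unfolding test_def
  using pint_pderiv_weighted_proj[OF nodes[OF assms(4)] p assms(1) deg[OF assms(2,4)] deg[OF assms(3,4)]]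
  by (simp only: mult_ac)

lemma pint_test_both:
  assumes "degree \<theta> \<le> 1" "i \<in> A" "l \<in> A" "j < m"
  shows "pint (\<tau> j) (\<tau> (Suc j)) (test \<theta> i j * test \<theta> l j)
    = pint (\<tau> j) (\<tau> (Suc j)) (\<theta> * \<theta> * test 1 i j * test 1 l j)
      - coeff (\<theta> * test 1 i j) p * coeff (\<theta> * test 1 l j) p * leg_sq j"
  unfolding test_1[OF assms(2,4)] test_1[OF assms(3,4)] test_def[of \<theta>]
  by (rule pint_weighted_proj_both[OF nodes[OF assms(4)] p assms(1) deg[OF assms(2,4)] deg[OF assms(3,4)]])

lemma gram_pderiv_test_1:
  assumes "\<And>i l. C i l = C l i"
  shows "gram \<tau> m A C (\<lambda>i j. pderiv (P i j)) (test 1) = 1 / 2 * (qform A C right - qform A C left)"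
proof -
  have "gram \<tau> m A C (\<lambda>i j. pderiv (P i j)) (test 1)
      = (\<Sum>i\<in>A. \<Sum>l\<in>A. C i l * tint \<tau> m (\<lambda>j. pderiv (P i j) * P l j))"
    unfolding gram_def tint_def
    by (intro sum.cong arg_cong2[of _ _ _ _ "(*)"] refl) (simp add: pint_pderiv_test)
  also have "\<dots> = 1 / 2 * (\<Sum>i\<in>A. \<Sum>l\<in>A. C i l * (right i * right l - left i * left l))"
  proof (subst symmetrise[OF assms], intro arg_cong2[of _ _ _ _ "(*)"] sum.cong refl)
    fix i l assume il: "i \<in> A" "l \<in> A"
    have "tint \<tau> m (\<lambda>j. pderiv (P i j) * P l j) + tint \<tau> m (\<lambda>j. pderiv (P l j) * P i j)
        = (\<Sum>j<m. pint (\<tau> j) (\<tau> (Suc j)) (pderiv (P i j * P l j)))"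
      unfolding tint_def sum.distrib[symmetric] pint_add[symmetric]
      by (simp add: pderiv_mult algebra_simps)
    also have "\<dots> = (\<Sum>j<m. poly (P i j * P l j) (\<tau> (Suc j)) - poly (P i j * P l j) (\<tau> j))"
      by (intro sum.cong refl pint_pderiv less_imp_le nodes) auto
    also have "\<dots> = right i * right l - left i * left l"
      using m cont il by (subst sum_telescope_matching) (auto simp: right_def left_def)
    finally show "tint \<tau> m (\<lambda>j. pderiv (P i j) * P l j) + tint \<tau> m (\<lambda>j. pderiv (P l j) * P i j)
        = right i * right l - left i * left l" .
  qed
  finally show ?thesis
    by (simp add: qform_def right_diff_distrib sum_subtractf)
qed

text \<open>The weight \<open>\<tau> m - t\<close>: zero at the end of the slab, with slope
  -1.\<close>

abbreviation \<rho> :: "real poly" where "\<rho> \<equiv> [:\<tau> m, -1:]"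

text \<open>Integration by parts against \<open>\<rho>\<close> leaves half the squared norm of the
  unprojected solution minus the initial term. By Pythagoras this norm exceeds that of
  \<open>test 1\<close> by leading coefficient terms, and the projection inside
  \<open>test \<rho>\<close> contributes further ones; all are nonnegative for a \<open>psd\<close>
  matrix and are discarded.\<close>

lemma gram_pderiv_test_weight:
  assumes sym: "\<And>i l. C i l = C l i" and psd: "psd A C"
  shows "1 / 2 * gram \<tau> m A C (test 1) (test 1) - 1 / 2 * (\<tau> m - \<tau> 0) * qform A C left
    \<le> gram \<tau> m A C (\<lambda>i j. pderiv (P i j)) (test \<rho>)"
proof -
  define \<gamma> where "\<gamma> j = pint (\<tau> j) (\<tau> (Suc j)) (legendre (\<tau> j) (\<tau> (Suc j)) p * legendre (\<tau> j) (\<tau> (Suc j)) p)" for j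
  have \<gamma>: "\<gamma> j \<ge> 0" for j unfolding \<gamma>_def by (rule pint_nonneg) simp
  define c where "c i j = coeff (P i j) p" for i j
  \<comment> \<open>The plus sign is minus the slope of \<open>\<rho>\<close>. The deleted
    simplification rules would expand \<open>\<rho>\<close>, which has to stay a factor.\<close>
  have "gram \<tau> m A C (\<lambda>i j. pderiv (P i j)) (test \<rho>)
      = (\<Sum>i\<in>A. \<Sum>l\<in>A. C i l * (tint \<tau> m (\<lambda>j. \<rho> * pderiv (P i j) * P l j)
          + (\<Sum>j<m. real p * \<gamma> j * (c i j * c l j))))"
    unfolding gram_def tint_def sum.distrib[symmetric]
    by (intro sum.cong arg_cong2[of _ _ _ _ "(*)"] refl)
      (simp add: pint_pderiv_test[of \<rho>] \<gamma>_def c_def del: mult_pCons_left mult_pCons_right)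
  also have "\<dots> = (\<Sum>i\<in>A. \<Sum>l\<in>A. C i l * tint \<tau> m (\<lambda>j. \<rho> * pderiv (P i j) * P l j))
      + (\<Sum>j<m. real p * \<gamma> j * qform A C (\<lambda>i. c i j))"
    unfolding distrib_left sum.distrib qform_def sum_distrib_left
    by (subst (2) sum.swap, subst (3) sum.swap) (simp add: mult_ac)
  also have "(\<Sum>i\<in>A. \<Sum>l\<in>A. C i l * tint \<tau> m (\<lambda>j. \<rho> * pderiv (P i j) * P l j))
      = 1 / 2 * (\<Sum>i\<in>A. \<Sum>l\<in>A. C i l * (tint \<tau> m (\<lambda>j. P i j * P l j) - (\<tau> m - \<tau> 0) * (left i * left l)))"
  proof (subst symmetrise[OF sym], intro arg_cong2[of _ _ _ _ "(*)"] sum.cong refl)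
    fix i l assume il: "i \<in> A" "l \<in> A"
    \<comment> \<open>Since \<open>pderiv \<rho> = -1\<close>, the derivative of the triple product
      lacks one \<open>P i j * P l j\<close>; adding it back creates the norm term.\<close>
    have "tint \<tau> m (\<lambda>j. \<rho> * pderiv (P i j) * P l j) + tint \<tau> m (\<lambda>j. \<rho> * pderiv (P l j) * P i j)
        = (\<Sum>j<m. pint (\<tau> j) (\<tau> (Suc j)) (pderiv (\<rho> * (P i j * P l j)) + P i j * P l j))"
      unfolding tint_def sum.distrib[symmetric] pint_add[symmetric]
    proof (intro sum.cong refl arg_cong[of _ _ "pint _ _"])
      fix j
      have "pderiv \<rho> = -1" by (simp add: pderiv_pCons one_pCons)
      then show "\<rho> * pderiv (P i j) * P l j + \<rho> * pderiv (P l j) * P i j = pderiv (\<rho> * (P i j * P l j)) + P i j * P l j"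
        unfolding pderiv_mult by (simp add: algebra_simps del: mult_pCons_left mult_pCons_right)
    qed
    also have "\<dots> = (\<Sum>j<m. poly (\<rho> * (P i j * P l j)) (\<tau> (Suc j)) - poly (\<rho> * (P i j * P l j)) (\<tau> j))
        + tint \<tau> m (\<lambda>j. P i j * P l j)"
      unfolding pint_add sum.distrib tint_def
      by (intro arg_cong2[of _ _ _ _ "(+)"] refl sum.cong pint_pderiv less_imp_le nodes) auto
    \<comment> \<open>Inner nodes cancel by continuity and \<open>\<rho>\<close> vanishes at
      \<open>\<tau> m\<close>; only the start remains, where \<open>\<rho>\<close> equals the slab
      length.\<close>
    also have "(\<Sum>j<m. poly (\<rho> * (P i j * P l j)) (\<tau> (Suc j)) - poly (\<rho> * (P i j * P l j)) (\<tau> j))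
        = - (\<tau> m - \<tau> 0) * (left i * left l)"
      using m cont il by (subst sum_telescope_matching) (auto simp: left_def left_diff_distrib)
    finally show "tint \<tau> m (\<lambda>j. \<rho> * pderiv (P i j) * P l j) + tint \<tau> m (\<lambda>j. \<rho> * pderiv (P l j) * P i j)
        = tint \<tau> m (\<lambda>j. P i j * P l j) - (\<tau> m - \<tau> 0) * (left i * left l)"
      by (simp add: left_diff_distrib del: mult_pCons_left mult_pCons_right)
  qed
  also have "\<dots> = 1 / 2 * (\<Sum>i\<in>A. \<Sum>l\<in>A. C i l * tint \<tau> m (\<lambda>j. P i j * P l j))
      - 1 / 2 * (\<tau> m - \<tau> 0) * qform A C left"
    unfolding qform_def right_diff_distrib sum_subtractf sum_distrib_left by (simp add: mult_ac diff_divide_distrib)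
  also have "(\<Sum>i\<in>A. \<Sum>l\<in>A. C i l * tint \<tau> m (\<lambda>j. P i j * P l j))
      = (\<Sum>i\<in>A. \<Sum>l\<in>A. C i l * (tint \<tau> m (\<lambda>j. test 1 i j * test 1 l j) + (\<Sum>j<m. \<gamma> j * (c i j * c l j))))"
    unfolding tint_def sum.distrib[symmetric]
    by (intro sum.cong arg_cong2[of _ _ _ _ "(*)"] refl)
      (auto simp: test_1 pint_low_proj_both[OF nodes p deg deg] \<gamma>_def c_def)
  also have "\<dots> = gram \<tau> m A C (test 1) (test 1) + (\<Sum>j<m. \<gamma> j * qform A C (\<lambda>i. c i j))"
    unfolding distrib_left sum.distrib qform_def sum_distrib_left gram_def
    by (subst (2) sum.swap, subst (3) sum.swap) (simp add: mult_ac)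
  finally have eq: "gram \<tau> m A C (\<lambda>i j. pderiv (P i j)) (test \<rho>)
      = 1 / 2 * (gram \<tau> m A C (test 1) (test 1) + (\<Sum>j<m. \<gamma> j * qform A C (\<lambda>i. c i j)))
        - 1 / 2 * (\<tau> m - \<tau> 0) * qform A C left + (\<Sum>j<m. real p * \<gamma> j * qform A C (\<lambda>i. c i j))" .
  have "0 \<le> (\<Sum>j<m. \<gamma> j * qform A C (\<lambda>i. c i j))" "0 \<le> (\<Sum>j<m. real p * \<gamma> j * qform A C (\<lambda>i. c i j))"
    using psd \<gamma> by (auto intro!: sum_nonneg simp: psd_def)
  moreover define q where "q = 1 / 2 * (\<tau> m - \<tau> 0) * qform A C left"
  ultimately show ?thesis unfolding eq q_def[symmetric] distrib_left by linarith
qed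

text \<open>The second projection shrinks the norm of the weighted field, and on the slab
  \<open>\<rho>\<close> is at most the slab length.\<close>

lemma gram_test_weight_le:
  assumes psd: "psd A C"
  shows "gram \<tau> m A C (test \<rho>) (test \<rho>) \<le> (\<tau> m - \<tau> 0)\<^sup>2 * gram \<tau> m A C (test 1) (test 1)"
  unfolding gram_eq_sum_pint sum_distrib_left[of _ _ "{..<m}"]
proof (rule sum_mono)
  fix j assume j: "j \<in> {..<m}"
  let ?I = "pint (\<tau> j) (\<tau> (Suc j))"
  let ?L = "legendre (\<tau> j) (\<tau> (Suc j)) p"
  define T where "T i = test 1 i j" for i
  have "(\<Sum>i\<in>A. \<Sum>l\<in>A. C i l * ?I (test \<rho> i j * test \<rho> l j))
      = (\<Sum>i\<in>A. \<Sum>l\<in>A. C i l * ?I (\<rho> * \<rho> * T i * T l))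
        - qform A C (\<lambda>i. coeff (\<rho> * T i) p) * ?I (?L * ?L)"
    unfolding qform_def sum_distrib_right sum_subtractf[symmetric] T_def
    using j by (intro sum.cong refl)
      (simp add: pint_test_both[of \<rho>] right_diff_distrib mult_ac del: mult_pCons_left mult_pCons_right)
  also have "\<dots> \<le> (\<Sum>i\<in>A. \<Sum>l\<in>A. C i l * ?I (\<rho> * \<rho> * T i * T l))"
    using psd pint_nonneg[of "\<tau> j" "\<tau> (Suc j)" "?L * ?L"] by (simp add: psd_def)
  also have "\<dots> \<le> (\<Sum>i\<in>A. \<Sum>l\<in>A. C i l * ?I ([:(\<tau> m - \<tau> 0)\<^sup>2:] * T i * T l))"
  proof (rule pint_psd_mono[OF psd])
    fix t assume "t \<in> {\<tau> j..\<tau> (Suc j)}"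
    moreover have "\<tau> 0 \<le> \<tau> j" "\<tau> (Suc j) \<le> \<tau> m" using j by (auto intro!: nodes_mono)
    ultimately have "\<bar>\<tau> m - t\<bar> \<le> \<bar>\<tau> m - \<tau> 0\<bar>" by auto
    then have "(\<tau> m - t)\<^sup>2 \<le> (\<tau> m - \<tau> 0)\<^sup>2" by (simp only: abs_le_square_iff)
    then show "poly (\<rho> * \<rho>) t \<le> poly [:(\<tau> m - \<tau> 0)\<^sup>2:] t"
      by (simp add: power2_eq_square algebra_simps)
  qed
  also have "\<dots> = (\<tau> m - \<tau> 0)\<^sup>2 * (\<Sum>i\<in>A. \<Sum>l\<in>A. C i l * ?I (test 1 i j * test 1 l j))"
    unfolding T_def sum_distrib_left by (simp add: pint_smult mult_ac)
  finally show "(\<Sum>i\<in>A. \<Sum>l\<in>A. C i l * ?I (test \<rho> i j * test \<rho> l j))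
    \<le> (\<tau> m - \<tau> 0)\<^sup>2 * (\<Sum>i\<in>A. \<Sum>l\<in>A. C i l * ?I (test 1 i j * test 1 l j))" .
qed

end

section \<open>Iterated integrals of separated functions\<close>

text \<open>Agreement is demanded on open pieces only, because a discrete field need not have a time
  derivative at the break points; finitely many points do not change the integral.\<close>

lemma absolutely_integrable_on_pieces:
  fixes f :: "real \<Rightarrow> real"
  assumes nodes: "\<And>j. j < m \<Longrightarrow> \<tau> j < \<tau> (Suc j)"
    and f: "\<And>j t. j < m \<Longrightarrow> \<tau> j < t \<Longrightarrow> t < \<tau> (Suc j) \<Longrightarrow> f t = poly (q j) t"
  shows "f absolutely_integrable_on {\<tau> 0<..\<tau> m} \<and> (LINT t:{\<tau> 0<..\<tau> m}|lebesgue. f t) = tint \<tau> m q"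
  using assms
proof (induction m)
  case 0
  then show ?case by (simp add: tint_def set_lebesgue_integral_def set_integrable_def)
next
  case (Suc m)
  have mono: "\<tau> 0 \<le> \<tau> m"
    by (rule increasing_le[of m]) (use Suc.prems(1) in auto)
  let ?J = "{\<tau> m<..\<tau> (Suc m)}"
  have IH: "f absolutely_integrable_on {\<tau> 0<..\<tau> m}" "(LINT t:{\<tau> 0<..\<tau> m}|lebesgue. f t) = tint \<tau> m q"
    using Suc by auto
  have J: "f absolutely_integrable_on ?J"
    by (rule absolutely_integrable_spike[OF poly_absolutely_integrable, of "{\<tau> (Suc m)}"])
      (auto intro: Suc.prems(2))
  have "(LINT t:?J|lebesgue. f t) = integral ?J f"
    using J by (rule set_lebesgue_integral_eq_integral)
  also have "\<dots> = integral ?J (poly (q m))"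
    by (rule integral_spike[of "{\<tau> (Suc m)}"]) (auto intro: Suc.prems(2)[symmetric])
  also have "\<dots> = pint (\<tau> m) (\<tau> (Suc m)) (q m)"
    unfolding pint_def by (intro set_lebesgue_integral_eq_integral(2)[symmetric] poly_absolutely_integrable)
  finally have J': "(LINT t:?J|lebesgue. f t) = pint (\<tau> m) (\<tau> (Suc m)) (q m)" .
  have split: "{\<tau> 0<..\<tau> (Suc m)} = {\<tau> 0<..\<tau> m} \<union> ?J"
    using mono Suc.prems(1)[of m] by auto
  show ?case
    unfolding split
    using set_integrable_Un[OF IH(1) J] set_integral_Un[OF _ IH(1) J] IH(2) J'
    by (auto simp: tint_def)
qed

text \<open>For increasing nodes the half-open pieces let at most one summand be nonzero. The value
  0 outside the partition makes the function Borel and bounded on the whole line.\<close>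

definition pw :: "(nat \<Rightarrow> real) \<Rightarrow> nat \<Rightarrow> (nat \<Rightarrow> real poly) \<Rightarrow> real \<Rightarrow> real" where
  "pw \<tau> m q t = (\<Sum>j<m. indicator {\<tau> j<..\<tau> (Suc j)} t * poly (q j) t)"

lemma pw_eq:
  assumes nodes: "\<And>j. j < m \<Longrightarrow> \<tau> j < \<tau> (Suc j)" and "j < m" "t \<in> {\<tau> j<..\<tau> (Suc j)}"
  shows "pw \<tau> m q t = poly (q j) t"
proof -
  note mono = increasing_le[of m \<tau>, OF nodes]
  have "indicator {\<tau> i<..\<tau> (Suc i)} t * poly (q i) t = (if i = j then poly (q j) t else 0)" if "i < m" for i
    using mono[of "Suc i" j] mono[of "Suc j" i] that assms(2,3)
    by (cases i j rule: linorder_cases) auto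
  then show ?thesis
    unfolding pw_def using \<open>j < m\<close> by (simp add: sum.delta)
qed

lemma pw_borel [measurable]: "pw \<tau> m q \<in> borel_measurable borel"
  unfolding pw_def
  by (intro borel_measurable_sum borel_measurable_times borel_measurable_indicator
      borel_measurable_continuous_onI continuous_intros) auto

lemma pw_bounded: "\<exists>B. \<forall>t. \<bar>pw \<tau> m q t\<bar> \<le> B"
proof -
  have "\<exists>B. \<forall>t. \<bar>indicator {\<tau> j<..\<tau> (Suc j)} t * poly (q j) t\<bar> \<le> B" for j
  proof -
    have "compact (poly (q j) ` {\<tau> j..\<tau> (Suc j)})"
      by (intro compact_continuous_image continuous_intros) auto
    then obtain B where "\<forall>y\<in>poly (q j) ` {\<tau> j..\<tau> (Suc j)}. norm y \<le> B"
      using bounded_iff compact_imp_bounded by blast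
    then show ?thesis
      by (intro exI[of _ "max B 0"]) (auto simp: indicator_def le_max_iff_disj)
  qed
  then obtain B where "\<And>j t. \<bar>indicator {\<tau> j<..\<tau> (Suc j)} t * poly (q j) t\<bar> \<le> B j"
    by metis
  then have "\<bar>pw \<tau> m q t\<bar> \<le> (\<Sum>j<m. B j)" for t
    unfolding pw_def by (intro order.trans[OF sum_abs] sum_mono)
  then show ?thesis by blast
qed

text \<open>Expanding the integral of the sums needs every single product to be integrable; the
  regularity results for spatial factors serve to meet this hypothesis.\<close>

lemma set_integral_separated:
  fixes f g :: "'i \<Rightarrow> 'x \<Rightarrow> 'b::euclidean_space"
  assumes "\<And>i l. i \<in> A \<Longrightarrow> l \<in> A \<Longrightarrow> set_integrable N D (\<lambda>x. f i x \<bullet> g l x)"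
  shows "(LINT x:D|N. (\<Sum>i\<in>A. s i *\<^sub>R f i x) \<bullet> (\<Sum>l\<in>A. r l *\<^sub>R g l x))
    = (\<Sum>i\<in>A. \<Sum>l\<in>A. (LINT x:D|N. f i x \<bullet> g l x) * (s i * r l))"
proof -
  have "(LINT x:D|N. (\<Sum>i\<in>A. s i *\<^sub>R f i x) \<bullet> (\<Sum>l\<in>A. r l *\<^sub>R g l x))
      = (LINT x|N. (\<Sum>i\<in>A. \<Sum>l\<in>A. (s i * r l) *\<^sub>R (indicator D x *\<^sub>R (f i x \<bullet> g l x))))"
    unfolding set_lebesgue_integral_def
    by (intro Bochner_Integration.integral_cong refl, subst inner_sum_left, subst inner_sum_right)
      (simp add: sum_distrib_left mult_ac)
  also have "\<dots> = (\<Sum>i\<in>A. \<Sum>l\<in>A. (LINT x|N. (s i * r l) *\<^sub>R (indicator D x *\<^sub>R (f i x \<bullet> g l x))))"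
    using assms unfolding set_integrable_def
    by (intro trans[OF Bochner_Integration.integral_sum] sum.cong refl Bochner_Integration.integral_sum
        Bochner_Integration.integrable_sum integrable_scaleR_right) auto
  finally show ?thesis
    unfolding set_lebesgue_integral_def by (simp add: mult_ac)
qed

section \<open>Bounded functions that are continuous off a null set\<close>

text \<open>The class meant for material coefficients, discrete fields and their curls. It is closed
  under pointwise operations, ignores null sets such as the element boundaries, and implies
  integrability on bounded open sets.\<close>

definition pcb :: "'a::euclidean_space set \<Rightarrow> ('a \<Rightarrow> 'b::euclidean_space) \<Rightarrow> bool" where
  "pcb D f \<longleftrightarrow> (\<exists>G. open G \<and> G \<subseteq> D \<and> negligible (D - G) \<and> continuous_on G f \<and> bounded (f ` G))"

lemma pcb_combine:
  assumes "pcb D f" "pcb D g"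
    and "\<And>G. continuous_on G f \<Longrightarrow> continuous_on G g \<Longrightarrow> continuous_on G (\<lambda>x. h (f x) (g x))"
    and "\<And>B C. \<exists>K. \<forall>y z. norm y \<le> B \<longrightarrow> norm z \<le> C \<longrightarrow> norm (h y z) \<le> K"
  shows "pcb D (\<lambda>x. h (f x) (g x))"
proof -
  obtain G where G: "open G" "G \<subseteq> D" "negligible (D - G)" "continuous_on G f" "bounded (f ` G)"
    using assms(1) unfolding pcb_def by auto
  obtain G' where G': "open G'" "G' \<subseteq> D" "negligible (D - G')" "continuous_on G' g" "bounded (g ` G')"
    using assms(2) unfolding pcb_def by auto
  obtain B C where "\<And>x. x \<in> G \<Longrightarrow> norm (f x) \<le> B" "\<And>x. x \<in> G' \<Longrightarrow> norm (g x) \<le> C"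
    using G(5) G'(5) unfolding bounded_iff by fast
  moreover obtain K where "\<And>y z. norm y \<le> B \<Longrightarrow> norm z \<le> C \<Longrightarrow> norm (h y z) \<le> K"
    using assms(4) by blast
  ultimately have "bounded ((\<lambda>x. h (f x) (g x)) ` (G \<inter> G'))"
    unfolding bounded_iff by (intro exI[of _ K]) auto
  moreover have "negligible (D - G \<inter> G')"
    using negligible_Un[OF G(3) G'(3)] by (simp add: Diff_Int)
  ultimately show ?thesis
    unfolding pcb_def using G G' assms(3)[of "G \<inter> G'"]
    by (intro exI[of _ "G \<inter> G'"]) (auto intro: continuous_on_subset)
qed

lemma pcb_const: "open D \<Longrightarrow> pcb D (\<lambda>x. c)"
  unfolding pcb_def by (intro exI[of _ D]) (auto intro: bounded_subset[of "{c}"])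

lemma pcb_add: "pcb D f \<Longrightarrow> pcb D g \<Longrightarrow> pcb D (\<lambda>x. f x + g x)"
  by (rule pcb_combine) (auto intro!: continuous_intros intro: norm_triangle_mono)

lemma pcb_inner: "pcb D f \<Longrightarrow> pcb D g \<Longrightarrow> pcb D (\<lambda>x. f x \<bullet> g x)"
proof (rule pcb_combine[where h = "(\<bullet>)"])
  show "\<exists>K. \<forall>y z. norm y \<le> B \<longrightarrow> norm z \<le> C \<longrightarrow> norm (y \<bullet> z) \<le> K" for B C
    by (intro exI[of _ "B * C"])
      (auto intro!: order.trans[OF Cauchy_Schwarz_ineq2] mult_mono intro: order.trans[OF norm_ge_zero])
qed (auto intro!: continuous_intros)

lemma pcb_scaleR: "pcb D f \<Longrightarrow> pcb D g \<Longrightarrow> pcb D (\<lambda>x. f x *\<^sub>R g x)"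
proof (rule pcb_combine[where h = "(*\<^sub>R)"])
  show "\<exists>K. \<forall>y z. norm y \<le> B \<longrightarrow> norm z \<le> C \<longrightarrow> norm (y *\<^sub>R z) \<le> K" for B C
    by (intro exI[of _ "B * C"]) (auto intro!: mult_mono intro: order.trans[OF abs_ge_zero])
qed (auto intro!: continuous_intros)

lemma pcb_cmult: "open D \<Longrightarrow> pcb D f \<Longrightarrow> pcb D (\<lambda>x. c * f x)" for f :: "'a::euclidean_space \<Rightarrow> real"
  using pcb_scaleR[OF pcb_const[of D c], of f] by simp

lemma pcb_sum: "open D \<Longrightarrow> (\<And>i. i \<in> A \<Longrightarrow> pcb D (f i)) \<Longrightarrow> pcb D (\<lambda>x. \<Sum>i\<in>A. f i x)"
  by (induction A rule: infinite_finite_induct) (auto intro: pcb_const pcb_add)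

lemma pcb_diff: "pcb D f \<Longrightarrow> pcb D g \<Longrightarrow> pcb D (\<lambda>x. f x - g x)"
  by (rule pcb_combine) (auto intro!: continuous_intros order.trans[OF norm_triangle_ineq4] add_mono)

lemma pcb_cong:
  assumes "pcb D g" "open G" "negligible (D - G)" "\<And>x. x \<in> G \<Longrightarrow> x \<in> D \<Longrightarrow> f x = g x"
  shows "pcb D f"
proof -
  obtain G' where G': "open G'" "G' \<subseteq> D" "negligible (D - G')" "continuous_on G' g" "bounded (g ` G')"
    using assms(1) unfolding pcb_def by auto
  have "f ` (G' \<inter> G) \<subseteq> g ` G'" using assms(4) G'(2) by auto
  moreover have "continuous_on (G' \<inter> G) f"
    using G'(2,4) assms(4)
    by (intro continuous_on_eq[where f = g and g = f]) (auto intro: continuous_on_subset)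
  moreover have "negligible (D - G' \<inter> G)"
    using negligible_Un[OF G'(3) assms(3)] by (simp add: Diff_Int)
  ultimately show ?thesis
    unfolding pcb_def using G' assms(2)
    by (intro exI[of _ "G' \<inter> G"]) (auto intro: bounded_subset)
qed

lemma pcb_absolutely_integrable:
  assumes "pcb D f" "open D" "bounded D"
  shows "f absolutely_integrable_on D"
proof -
  obtain G where G: "open G" "G \<subseteq> D" "negligible (D - G)" "continuous_on G f" "bounded (f ` G)"
    using assms(1) unfolding pcb_def by auto
  obtain B where B: "\<And>x. x \<in> G \<Longrightarrow> norm (f x) \<le> B"
    using G(5) unfolding bounded_iff by fast
  have fin: "emeasure lebesgue G < \<infinity>"
    using emeasure_bounded_finite[of G] bounded_subset[OF assms(3) G(2)] G(1)
    by (simp add: borel_open)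
  have "integrable lebesgue (\<lambda>x. indicator G x *\<^sub>R (indicator G x *\<^sub>R f x))"
  proof (rule integrableI_bounded_set_indicator)
    show "(\<lambda>x. indicator G x *\<^sub>R f x) \<in> borel_measurable lebesgue"
      using borel_measurable_continuous_on_indicator[OF _ G(4)] G(1)
      by (intro measurable_completion) auto
  qed (use G B fin in \<open>auto intro!: AE_I2\<close>)
  moreover have "(\<lambda>x. indicator G x *\<^sub>R (indicator G x *\<^sub>R f x)) = (\<lambda>x. indicator G x *\<^sub>R f x)"
    by (auto simp: indicator_def fun_eq_iff)
  ultimately have "f absolutely_integrable_on G"
    unfolding set_integrable_def by simp
  moreover have "negligible {x \<in> G - D. f x \<noteq> 0}" "negligible {x \<in> D - G. f x \<noteq> 0}"
    using G(2) by (auto intro: negligible_subset[OF G(3)])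
  ultimately show ?thesis
    using absolutely_integrable_spike_set_eq by blast
qed

lemma pcb_LINT_cong:
  assumes "pcb D g" "open D" "bounded D" "negligible (D - G)" "\<And>x. x \<in> G \<Longrightarrow> x \<in> D \<Longrightarrow> f x = g x"
  shows "(LINT x:D|lebesgue. f x) = (LINT x:D|lebesgue. g x)"
proof -
  have g: "g absolutely_integrable_on D" using assms by (intro pcb_absolutely_integrable)
  have f: "f absolutely_integrable_on D"
    by (rule absolutely_integrable_spike[OF g assms(4)]) (use assms(5) in auto)
  have "integral D f = integral D g"
    by (rule integral_spike[OF assms(4)]) (use assms(5) in auto)
  then show ?thesis using f g by (simp add: set_lebesgue_integral_eq_integral)
qed

section \<open>Geometry of one hexahedron\<close>

text \<open>The derivative is an existential witness, and its continuity is tested in fixed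
  directions only. In this form the class is visibly closed under the operations occurring in
  Cramer's rule.\<close>

definition C1_on :: "'a::euclidean_space set \<Rightarrow> ('a \<Rightarrow> 'b::real_normed_vector) \<Rightarrow> bool" where
  "C1_on U f \<longleftrightarrow> (\<exists>f'. (\<forall>x\<in>U. (f has_derivative f' x) (at x)) \<and> (\<forall>h. continuous_on U (\<lambda>x. f' x h)))"

lemma C1_onI:
  "(\<And>x. x \<in> U \<Longrightarrow> (f has_derivative f' x) (at x)) \<Longrightarrow> (\<And>h. continuous_on U (\<lambda>x. f' x h)) \<Longrightarrow> C1_on U f"
  unfolding C1_on_def by blast

lemma C1_on_continuous: "C1_on U f \<Longrightarrow> continuous_on U f"
  unfolding C1_on_def
  by (meson continuous_at_imp_continuous_on has_derivative_continuous)

lemma C1_on_subset: "C1_on U f \<Longrightarrow> V \<subseteq> U \<Longrightarrow> C1_on V f"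
  unfolding C1_on_def by (meson continuous_on_subset subsetD)

lemma C1_on_const: "C1_on U (\<lambda>x. c)"
  by (rule C1_onI[where f' = "\<lambda>x h. 0"]) auto

lemma C1_on_nth: "C1_on U (\<lambda>x::real^'n. x $ i)"
  by (rule C1_onI[where f' = "\<lambda>x h. h $ i"])
    (auto intro: bounded_linear_imp_has_derivative bounded_linear_vec_nth continuous_on_const)

lemma C1_on_add: "C1_on U f \<Longrightarrow> C1_on U g \<Longrightarrow> C1_on U (\<lambda>x. f x + g x)"
proof -
  assume "C1_on U f" "C1_on U g"
  then obtain f' g' where "\<And>x. x \<in> U \<Longrightarrow> (f has_derivative f' x) (at x)" "\<And>h. continuous_on U (\<lambda>x. f' x h)"
    "\<And>x. x \<in> U \<Longrightarrow> (g has_derivative g' x) (at x)" "\<And>h. continuous_on U (\<lambda>x. g' x h)"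
    unfolding C1_on_def by blast
  then show ?thesis
    by (intro C1_onI[where f' = "\<lambda>x h. f' x h + g' x h"]) (auto intro!: has_derivative_add continuous_intros)
qed

lemma C1_on_mult:
  fixes f g :: "'a::euclidean_space \<Rightarrow> real"
  assumes "C1_on U f" "C1_on U g"
  shows "C1_on U (\<lambda>x. f x * g x)"
proof -
  obtain f' g' where "\<And>x. x \<in> U \<Longrightarrow> (f has_derivative f' x) (at x)" "\<And>h. continuous_on U (\<lambda>x. f' x h)"
    "\<And>x. x \<in> U \<Longrightarrow> (g has_derivative g' x) (at x)" "\<And>h. continuous_on U (\<lambda>x. g' x h)"
    using assms unfolding C1_on_def by blast
  then show ?thesis
    using assms[THEN C1_on_continuous]
    by (intro C1_onI[where f' = "\<lambda>x h. f x * g' x h + f' x h * g x"])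
      (auto intro!: has_derivative_mult continuous_intros)
qed

lemma C1_on_inverse:
  fixes f :: "'a::euclidean_space \<Rightarrow> real"
  assumes "C1_on U f" and nz: "\<And>x. x \<in> U \<Longrightarrow> f x \<noteq> 0"
  shows "C1_on U (\<lambda>x. inverse (f x))"
proof -
  obtain f' where "\<And>x. x \<in> U \<Longrightarrow> (f has_derivative f' x) (at x)" "\<And>h. continuous_on U (\<lambda>x. f' x h)"
    using assms unfolding C1_on_def by blast
  then show ?thesis
    using assms(1)[THEN C1_on_continuous] nz
    by (intro C1_onI[where f' = "\<lambda>x h. - (inverse (f x) * f' x h * inverse (f x))"])
      (auto intro!: Deriv.has_derivative_inverse continuous_intros)
qed

lemma C1_on_diff: "C1_on U f \<Longrightarrow> C1_on U g \<Longrightarrow> C1_on U (\<lambda>x. f x - g x)"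
  for f g :: "'a::euclidean_space \<Rightarrow> real"
  using C1_on_add[of U f "\<lambda>x. - 1 * g x"] C1_on_mult[OF C1_on_const, of U g "- 1"] by simp

lemma C1_on_divide:
  fixes f g :: "'a::euclidean_space \<Rightarrow> real"
  shows "C1_on U f \<Longrightarrow> C1_on U g \<Longrightarrow> (\<And>x. x \<in> U \<Longrightarrow> g x \<noteq> 0) \<Longrightarrow> C1_on U (\<lambda>x. f x / g x)"
  unfolding divide_inverse by (intro C1_on_mult C1_on_inverse)

lemma C1_on_sum: "(\<And>i. i \<in> A \<Longrightarrow> C1_on U (f i)) \<Longrightarrow> C1_on U (\<lambda>x. \<Sum>i\<in>A. f i x)"
  by (induction A rule: infinite_finite_induct) (auto intro: C1_on_const C1_on_add)

lemma C1_on_power: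
  fixes f :: "'a::euclidean_space \<Rightarrow> real"
  shows "C1_on U f \<Longrightarrow> C1_on U (\<lambda>x. f x ^ n)"
  by (induction n) (auto intro: C1_on_const C1_on_mult)

lemma C1_on_vec_lambda:
  fixes f :: "'n::finite \<Rightarrow> 'a::euclidean_space \<Rightarrow> real"
  assumes "\<And>i. C1_on U (f i)"
  shows "C1_on U (\<lambda>x. \<chi> i. f i x)"
proof -
  have "\<forall>i. \<exists>f'. (\<forall>x\<in>U. (f i has_derivative f' x) (at x)) \<and> (\<forall>h. continuous_on U (\<lambda>x. f' x h))"
    using assms unfolding C1_on_def by blast
  from choice[OF this] obtain f' where
    f': "\<And>i x. x \<in> U \<Longrightarrow> (f i has_derivative f' i x) (at x)" "\<And>i h. continuous_on U (\<lambda>x. f' i x h)"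
    by blast
  show ?thesis
  proof (rule C1_onI[where f' = "\<lambda>x h. \<chi> i. f' i x h"])
    show "((\<lambda>x. \<chi> i. f i x) has_derivative (\<lambda>h. \<chi> i. f' i x h)) (at x)" if "x \<in> U" for x
      using f'(1)[OF that] unfolding has_derivative_componentwise_within[of "\<lambda>x. \<chi> i. f i x"]
      by (auto simp only: Basis_vec_def inner_axis vec_lambda_beta Basis_real_def inner_real_def mult_1_right)
  qed (intro continuous_on_vec_lambda f'(2))
qed

lemma C1_on_component: "C1_on U f \<Longrightarrow> C1_on U (\<lambda>x. f x $ i)" for f :: "'a::euclidean_space \<Rightarrow> real^'n"
proof -
  assume "C1_on U f"
  then obtain f' where "\<And>x. x \<in> U \<Longrightarrow> (f has_derivative f' x) (at x)" "\<And>h. continuous_on U (\<lambda>x. f' x h)"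
    unfolding C1_on_def by blast
  then show ?thesis
    by (intro C1_onI[where f' = "\<lambda>x h. f' x h $ i"] continuous_on_component
        bounded_linear.has_derivative[OF bounded_linear_vec_nth])
qed

lemma frechet_derivative_has_derivative:
  "f differentiable (at x) \<Longrightarrow> (f has_derivative frechet_derivative f (at x)) (at x)"
  by (rule frechet_derivative_works[THEN iffD1])

text \<open>Linearity reduces a direction that varies with \<open>x\<close> to the finitely many
  basis directions.\<close>

lemma continuous_on_bounded_linear_family:
  fixes f' :: "'a::topological_space \<Rightarrow> 'b::euclidean_space \<Rightarrow> 'c::real_normed_vector"
  assumes "\<And>x. x \<in> U \<Longrightarrow> bounded_linear (f' x)"
    and "\<And>b. b \<in> Basis \<Longrightarrow> continuous_on U (\<lambda>x. f' x b)" and "continuous_on U h"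
  shows "continuous_on U (\<lambda>x. f' x (h x))"
proof -
  have eq: "f' x (h x) = (\<Sum>b\<in>Basis. (h x \<bullet> b) *\<^sub>R f' x b)" if "x \<in> U" for x
  proof -
    interpret bounded_linear "f' x" using assms(1)[OF that] .
    have "f' x (h x) = f' x (\<Sum>b\<in>Basis. (h x \<bullet> b) *\<^sub>R b)"
      by (simp only: euclidean_representation)
    also have "\<dots> = (\<Sum>b\<in>Basis. (h x \<bullet> b) *\<^sub>R f' x b)"
      by (simp only: sum scaleR)
    finally show ?thesis .
  qed
  have cont: "continuous_on U (\<lambda>x. \<Sum>b\<in>Basis. (h x \<bullet> b) *\<^sub>R f' x b)"
    by (intro continuous_on_sum continuous_on_scaleR continuous_on_inner continuous_on_const assms(2,3))
  show ?thesis
    by (rule continuous_on_eq[OF cont]) (rule eq[symmetric])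
qed

lemma Ck_on_continuous: "Ck_on n U f \<Longrightarrow> continuous_on U f"
proof (cases n)
  case (Suc m)
  moreover assume "Ck_on n U f"
  ultimately show ?thesis
    by (intro continuous_at_imp_continuous_on ballI differentiable_imp_continuous_within) simp
qed simp

lemma Ck_on_C1:
  assumes "Ck_on (Suc n) U f"
  shows "C1_on U f"
proof (rule C1_onI)
  fix x assume "x \<in> U"
  then show "(f has_derivative frechet_derivative f (at x)) (at x)"
    using assms by (intro frechet_derivative_has_derivative) simp
next
  fix h
  show "continuous_on U (\<lambda>x. frechet_derivative f (at x) h)"
  proof (rule continuous_on_bounded_linear_family[where h = "\<lambda>x. h"])
    show "bounded_linear (frechet_derivative f (at x))" if "x \<in> U" for x
      using assms that by (intro has_derivative_bounded_linear[OF frechet_derivative_has_derivative]) simp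
    show "continuous_on U (\<lambda>x. frechet_derivative f (at x) b)" if "b \<in> Basis" for b
      using assms that by (intro Ck_on_continuous[of n]) simp
  qed (rule continuous_on_const)
qed

text \<open>The operator norm of the derivative is at most the sum of its norms in the basis
  directions, which is bounded on a compact set; convexity gives the mean value estimate. Taking the
  maximum with 1 keeps the constant positive.\<close>

lemma C1_on_lipschitz:
  fixes f :: "'a::euclidean_space \<Rightarrow> 'b::euclidean_space"
  assumes "C1_on U f" "S \<subseteq> U" "compact S" "convex S"
  shows "\<exists>L>0. \<forall>x\<in>S. \<forall>y\<in>S. norm (f x - f y) \<le> L * norm (x - y)"
proof -
  obtain f' where f': "\<And>x. x \<in> U \<Longrightarrow> (f has_derivative f' x) (at x)" "\<And>h. continuous_on U (\<lambda>x. f' x h)"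
    using assms unfolding C1_on_def by blast
  have "continuous_on S (\<lambda>x. \<Sum>b\<in>Basis. norm (f' x b))"
    by (intro continuous_on_sum continuous_on_norm continuous_on_subset[OF f'(2) assms(2)])
  then have "bounded ((\<lambda>x. \<Sum>b\<in>Basis. norm (f' x b)) ` S)"
    using assms(3) compact_continuous_image compact_imp_bounded by blast
  then obtain B where "\<And>x. x \<in> S \<Longrightarrow> norm (\<Sum>b\<in>Basis. norm (f' x b)) \<le> B"
    unfolding bounded_iff by fast
  then have B: "(\<Sum>b\<in>Basis. norm (f' x b)) \<le> B" if "x \<in> S" for x
    using that by fastforce
  have "norm (f x - f y) \<le> max B 1 * norm (x - y)" if "x \<in> S" "y \<in> S" for x y
  proof (rule differentiable_bound[OF assms(4)])
    show "(f has_derivative f' x) (at x within S)" if "x \<in> S" for x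
      using f'(1)[of x] that assms(2) by (auto intro: has_derivative_at_withinI)
    show "onorm (f' x) \<le> max B 1" if "x \<in> S" for x
    proof -
      have "onorm (f' x) \<le> (\<Sum>b\<in>Basis. norm (f' x b))"
        using f'(1)[of x] that assms(2) by (intro onorm_componentwise) (auto intro: has_derivative_bounded_linear)
      then show ?thesis using B[OF that] by linarith
    qed
  qed (use that in auto)
  then show ?thesis
    by (intro exI[of _ "max B 1"]) auto
qed

lemma matrix_inv:
  fixes A :: "real^'n^'n"
  assumes "invertible A"
  shows "A ** matrix_inv A = mat 1" "matrix_inv A ** A = mat 1"
  using someI_ex[OF assms[unfolded invertible_def]] unfolding matrix_inv_def by auto

section \<open>The image of the reference cube: interior, frontier and inverse map\<close>

locale hexahedron =
  fixes F :: "real^3 \<Rightarrow> real^3" and U :: "(real^3) set"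
  assumes cube: "ref_cube \<subseteq> U" and smooth: "smooth_on U F" and inj: "inj_on F ref_cube"
    and inv: "\<And>\<xi>. \<xi> \<in> ref_cube \<Longrightarrow> invertible (jacobian F (at \<xi>))"
begin

abbreviation Jac :: "real^3 \<Rightarrow> real^3^3" where "Jac \<xi> \<equiv> jacobian F (at \<xi>)"
abbreviation hex :: "(real^3) set" where "hex \<equiv> F ` ref_cube"
definition Finv :: "real^3 \<Rightarrow> real^3" where "Finv = inv_into ref_cube F"

lemma C1_F: "C1_on U F"
  using smooth Ck_on_C1 unfolding smooth_on_def by blast

lemma F_derivative: "\<xi> \<in> U \<Longrightarrow> (F has_derivative (\<lambda>h. Jac \<xi> *v h)) (at \<xi>)"
proof -
  assume "\<xi> \<in> U"
  then have "F differentiable (at \<xi>)"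
    using C1_F unfolding C1_on_def differentiable_def by blast
  then show ?thesis
    by (rule jacobian_works[THEN iffD1])
qed

lemma C1_Jac: "C1_on U (\<lambda>\<xi>. Jac \<xi> $ i $ j)"
proof -
  have "Ck_on (Suc (Suc 0)) U F"
    using smooth unfolding smooth_on_def by blast
  then have "\<forall>b\<in>Basis. Ck_on (Suc 0) U (\<lambda>\<xi>. frechet_derivative F (at \<xi>) b)"
    unfolding Ck_on.simps(2)[of "Suc 0"] by (rule conjunct2)
  moreover have "axis j 1 \<in> (Basis :: (real^3) set)"
    by (simp add: axis_in_Basis_iff)
  ultimately have "C1_on U (\<lambda>\<xi>. frechet_derivative F (at \<xi>) (axis j 1))"
    using Ck_on_C1 by blast
  from C1_on_component[OF this, of i] show ?thesis
    by (simp add: jacobian_def matrix_def)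
qed

lemma Finv_F [simp]: "\<xi> \<in> ref_cube \<Longrightarrow> Finv (F \<xi>) = \<xi>"
  unfolding Finv_def using inj by simp

lemma F_Finv [simp]: "x \<in> hex \<Longrightarrow> F (Finv x) = x"
  by auto

lemma Finv_in: "x \<in> hex \<Longrightarrow> Finv x \<in> ref_cube"
  by auto

lemma continuous_F: "continuous_on ref_cube F"
  using C1_on_continuous[OF C1_F] cube continuous_on_subset by blast

lemma continuous_Finv: "continuous_on hex Finv"
  by (rule continuous_on_inv[OF continuous_F]) auto

lemma compact_hex: "compact hex"
  by (intro compact_continuous_image continuous_F) auto

lemma open_image_box: "open (F ` box 0 1)"
proof (rule invariance_of_domain)
  show "continuous_on (box 0 1) F"
    by (rule continuous_on_subset[OF continuous_F box_subset_cbox])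
  show "inj_on F (box 0 1)"
    by (rule inj_on_subset[OF inj box_subset_cbox])
qed auto

text \<open>Invariance of domain in both directions: the image of the open cube is open, and the
  preimage of the interior is an open subset of the cube, hence contained in the open cube.\<close>

lemma interior_hex: "interior hex = F ` box 0 1"
proof
  show "F ` box 0 1 \<subseteq> interior hex"
    using open_image_box box_subset_cbox by (intro interior_maximal) auto
  have "open (Finv ` interior hex)"
  proof (rule invariance_of_domain)
    show "continuous_on (interior hex) Finv"
      by (rule continuous_on_subset[OF continuous_Finv interior_subset])
    show "inj_on Finv (interior hex)"
      using interior_subset[of hex] by (intro inj_on_inverseI[of _ F]) (auto simp del: image_iff)
  qed auto
  moreover have "Finv ` interior hex \<subseteq> ref_cube"
    using interior_subset Finv_in by blast
  ultimately have "Finv ` interior hex \<subseteq> box 0 1"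
    by (metis interior_cbox interior_maximal)
  moreover have "F ` Finv ` interior hex = interior hex"
    using interior_subset[of hex] F_Finv by (auto simp: image_image subset_eq simp del: image_iff cong: image_cong)
  ultimately show "interior hex \<subseteq> F ` box 0 1"
    by (metis image_mono)
qed

lemma frontier_hex: "frontier hex = F ` (ref_cube - box 0 1)"
proof -
  have "frontier hex = hex - F ` box 0 1"
    using compact_hex by (simp add: frontier_def interior_hex compact_imp_closed)
  also have "\<dots> = F ` (ref_cube - box 0 1)"
    by (rule inj_on_image_set_diff[symmetric, OF inj]) (use box_subset_cbox in auto)
  finally show ?thesis .
qed

lemma frontier_subset_hex: "frontier hex \<subseteq> hex"
  unfolding frontier_hex by auto

text \<open>Makes every frontier point a limit of interior points, so that the limits defining
  traces are unique.\<close>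

lemma closure_interior_hex: "closure (interior hex) = hex"
proof
  show "closure (interior hex) \<subseteq> hex"
    using compact_hex by (intro closure_minimal interior_subset compact_imp_closed)
  have ne: "box 0 (1::real^3) \<noteq> {}"
    by (auto simp: box_ne_empty Basis_vec_def inner_axis)
  have "F ` closure (box 0 1) \<subseteq> closure (F ` box 0 1)"
    using continuous_F ne by (intro image_closure_subset) (auto simp: closure_subset)
  then show "hex \<subseteq> closure (interior hex)"
    using ne by (simp add: interior_hex)
qed

text \<open>A differentiable map sends the faces of the cube, a null set, to a null set.\<close>

lemma negligible_frontier_hex: "negligible (frontier hex)"
  unfolding frontier_hex
proof (rule negligible_differentiable_image_negligible)
  show "F differentiable_on ref_cube - box 0 1"
    unfolding differentiable_on_def using F_derivative cube
    by (meson DiffD1 differentiable_at_withinI differentiable_def subsetD)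
qed (auto intro: negligible_frontier_interval)

lemma Finv_derivative:
  assumes "\<xi> \<in> box 0 1"
  shows "(Finv has_derivative (\<lambda>h. matrix_inv (Jac \<xi>) *v h)) (at (F \<xi>))"
proof (rule has_derivative_inverse_basic)
  have \<xi>: "\<xi> \<in> ref_cube" using assms box_subset_cbox by blast
  then show "(F has_derivative (\<lambda>h. Jac \<xi> *v h)) (at (Finv (F \<xi>)))"
    using F_derivative[of \<xi>] cube by auto
  show "(\<lambda>h. matrix_inv (Jac \<xi>) *v h) \<circ> (\<lambda>h. Jac \<xi> *v h) = id"
    using matrix_inv[OF inv[OF \<xi>]] by (auto simp: matrix_vector_mul_assoc)
  show "continuous (at (F \<xi>)) Finv"
    using assms continuous_on_subset[OF continuous_Finv interior_subset] open_image_box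
    by (auto simp: interior_hex continuous_on_eq_continuous_at)
  show "F (Finv z) = z" if "z \<in> F ` box 0 1" for z
    using that interior_subset[of hex] by (intro F_Finv) (auto simp: interior_hex)
qed (use assms open_image_box in auto)

end

subsection \<open>Surface measure of the boundary\<close>

text \<open>The finite cover is continued to a sequence by empty sets, whose diameter is 0 and so
  contributes nothing.\<close>

lemma hausdorff2_pre_le_finite_cover:
  assumes "finite X" "A \<subseteq> (\<Union>x\<in>X. C x)" "\<And>x. x \<in> X \<Longrightarrow> bounded (C x)" "\<And>x. x \<in> X \<Longrightarrow> diameter (C x) \<le> d"
    and "d \<le> \<delta>" "0 \<le> d"
  shows "hausdorff2_pre \<delta> A \<le> ennreal (real (card X) * (pi / 4 * d\<^sup>2))"
proof -
  obtain f where f: "bij_betw f {0..<card X} X"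
    using ex_bij_betw_nat_finite[OF assms(1)] by blast
  define D where "D i = (if i < card X then C (f i) else {})" for i
  have fX: "f i \<in> X" if "i < card X" for i
    using f that by (auto simp: bij_betw_def)
  have D: "D \<in> {C. A \<subseteq> (\<Union>i. C i) \<and> (\<forall>i. bounded (C i) \<and> diameter (C i) \<le> \<delta>)}"
  proof (intro CollectI conjI allI)
    show "A \<subseteq> (\<Union>i. D i)"
    proof
      fix a assume "a \<in> A"
      then obtain x where "x \<in> X" "a \<in> C x" using assms(2) by auto
      moreover from \<open>x \<in> X\<close> obtain i where "i < card X" "f i = x"
        using f unfolding bij_betw_def by (metis atLeastLessThan_iff imageE)
      ultimately show "a \<in> (\<Union>i. D i)" by (auto simp: D_def)
    qed
    show "bounded (D i)" for i using assms(3) fX by (auto simp: D_def)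
    show "diameter (D i) \<le> \<delta>" for i
      using assms(4)[OF fX[of i]] assms(5,6) by (auto simp: D_def)
  qed
  have "hausdorff2_pre \<delta> A \<le> (\<Sum>i. ennreal (pi / 4 * (diameter (D i))\<^sup>2))"
    unfolding hausdorff2_pre_def by (rule INF_lower[OF D])
  also have "\<dots> = (\<Sum>i<card X. ennreal (pi / 4 * (diameter (D i))\<^sup>2))"
    by (rule suminf_finite) (auto simp: D_def)
  also have "\<dots> \<le> (\<Sum>i<card X. ennreal (pi / 4 * d\<^sup>2))"
    using assms(3,4) fX
    by (intro sum_mono ennreal_leI mult_left_mono power_mono diameter_ge_0) (auto simp: D_def)
  also have "\<dots> = ennreal (real (card X) * (pi / 4 * d\<^sup>2))"
    by (simp add: ennreal_of_nat_eq_real_of_nat flip: ennreal_mult')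
  finally show ?thesis .
qed

lemma grid_point:
  assumes "0 \<le> s" "s \<le> 1" "n > 0"
  shows "\<exists>a<n. real a / real n \<le> s \<and> s \<le> (real a + 1) / real n"
proof (cases "s = 1")
  \<comment> \<open>Here the floor of \<open>s * real n\<close> would be \<open>n\<close>, one past
    the last cell.\<close>
  case True
  then show ?thesis using assms by (intro exI[of _ "n - 1"]) (auto simp: of_nat_diff field_simps)
next
  case False
  define a where "a = nat \<lfloor>s * real n\<rfloor>"
  have *: "real a \<le> s * real n" "s * real n \<le> real a + 1"
    unfolding a_def using assms by (auto simp: of_nat_nat intro: floor_le_iff[THEN iffD1])
  moreover have "s * real n < 1 * real n" using False assms by (intro mult_strict_right_mono) auto
  ultimately have "real a < real n" by linarith
  then show ?thesis using * assms(3) by (intro exI[of _ a]) (auto simp: field_simps)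
qed

text \<open>Addition in the type \<open>3\<close> is cyclic, so a face normal to axis
  \<open>k\<close> has the tangential axes \<open>k + 1\<close> and \<open>k + 2\<close>.\<close>

lemma exhaust_3_shift: "i = k \<or> i = k + 1 \<or> i = k + 2" for i k :: 3
proof -
  have "(1::3) + 1 = 2" "(1::3) + 2 = 3" "(2::3) + 1 = 3" "(2::3) + 2 = 1" "(3::3) + 1 = 1" "(3::3) + 2 = 2"
    by simp_all
  then show ?thesis
    using exhaust_3[of i] exhaust_3[of k] by metis
qed

text \<open>The faces of the cube are cut into squares of side 1/n. The Lipschitz map keeps the
  diameters of the images of order 1/n, so the sum of their squares is bounded independently of n,
  hence of \<open>\<delta>\<close>.\<close>

lemma (in hexahedron) hausdorff2_frontier_hex: "hausdorff2 (frontier hex) < \<infinity>"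
proof -
  obtain L where L: "L > 0" "\<And>x y. x \<in> ref_cube \<Longrightarrow> y \<in> ref_cube \<Longrightarrow> norm (F x - F y) \<le> L * norm (x - y)"
    using C1_on_lipschitz[OF C1_F cube compact_cbox convex_box(1)] by blast
  have bound: "hausdorff2_pre \<delta> (frontier hex) \<le> ennreal (54 * (pi / 4 * L\<^sup>2))" if "\<delta> > 0" for \<delta>
  proof -
    obtain n where n: "n > 0" "3 * L / real n \<le> \<delta>"
    proof -
      obtain n where "real n > 3 * L / \<delta>" using reals_Archimedean2 by blast
      moreover then have "n > 0" using L(1) that \<open>\<delta> > 0\<close> by (intro gr0I) (auto simp: divide_less_0_iff)
      ultimately show ?thesis using \<open>\<delta> > 0\<close> by (intro that[of n]) (auto simp: field_simps)
    qed
    \<comment> \<open>Six faces, given by axis \<open>k\<close> and side \<open>e\<close>, with n^2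
      squares each. Adding the three coordinate differences bounds distances in a square by 3/n, and
      6 * 9 = 54 is the constant of \<open>bound\<close>.\<close>
    define X where "X = (UNIV :: 3 set) \<times> {0, 1::real} \<times> {..<n} \<times> {..<n}"
    define Q where "Q = (\<lambda>(k::3, e, a, b). {\<xi>\<in>ref_cube. \<xi> $ k = e \<and>
      \<xi> $ (k + 1) \<in> {real a / real n .. (real a + 1) / real n} \<and> \<xi> $ (k + 2) \<in> {real b / real n .. (real b + 1) / real n}})"
    have X: "finite X" "card X = 6 * n\<^sup>2"
      unfolding X_def by (auto simp: card_cartesian_product power2_eq_square)
    have Q_cube: "Q x \<subseteq> ref_cube" for x unfolding Q_def by (cases x) auto
    have Q_norm: "norm (\<xi> - \<eta>) \<le> 3 / real n" if "\<xi> \<in> Q x" "\<eta> \<in> Q x" for \<xi> \<eta> x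
    proof -
      obtain k e a b where x: "x = (k, e, a, b)" by (metis prod.exhaust)
      have "\<bar>(\<xi> - \<eta>) $ i\<bar> \<le> 1 / real n" for i
        using exhaust_3_shift[of i k] that n(1) unfolding x Q_def
        by (auto simp: add_divide_distrib abs_le_iff)
      then have "(\<Sum>i\<in>UNIV. \<bar>(\<xi> - \<eta>) $ i\<bar>) \<le> (\<Sum>i\<in>(UNIV::3 set). 1 / real n)"
        by (intro sum_mono) auto
      then show ?thesis using norm_le_l1_cart[of "\<xi> - \<eta>"] by simp
    qed
    have "hausdorff2_pre \<delta> (frontier hex) \<le> ennreal (real (card X) * (pi / 4 * (3 * L / real n)\<^sup>2))"
    proof (rule hausdorff2_pre_le_finite_cover[where C = "\<lambda>x. F ` Q x"])
      show "frontier hex \<subseteq> (\<Union>x\<in>X. F ` Q x)"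
        unfolding frontier_hex
      proof (intro image_subsetI)
        fix \<xi> :: "real^3" assume \<xi>: "\<xi> \<in> ref_cube - box 0 1"
        then have c: "0 \<le> \<xi> $ i" "\<xi> $ i \<le> 1" for i by (auto simp: mem_box_cart)
        obtain k where "\<not> (0 < \<xi> $ k \<and> \<xi> $ k < 1)"
          using \<xi> by (auto simp: mem_box_cart)
        then have "\<xi> $ k = 0 \<or> \<xi> $ k = 1"
          using c[of k] by linarith
        then obtain e where e: "e \<in> {0, 1}" "\<xi> $ k = e" by auto
        obtain a b where "a < n" "\<xi> $ (k + 1) \<in> {real a / real n .. (real a + 1) / real n}"
          "b < n" "\<xi> $ (k + 2) \<in> {real b / real n .. (real b + 1) / real n}"
          using grid_point[OF c n(1), of "k + 1"] grid_point[OF c n(1), of "k + 2"] by auto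
        then have "(k, e, a, b) \<in> X" "\<xi> \<in> Q (k, e, a, b)"
          using e \<xi> unfolding X_def Q_def by auto
        then show "F \<xi> \<in> (\<Union>x\<in>X. F ` Q x)" by blast
      qed
      show "bounded (F ` Q x)" for x
        using bounded_subset[OF compact_imp_bounded[OF compact_hex]] Q_cube by (meson image_mono)
      show "diameter (F ` Q x) \<le> 3 * L / real n" for x
      proof (rule diameter_le)
        fix y z assume "y \<in> F ` Q x" "z \<in> F ` Q x"
        then obtain \<xi> \<eta> where *: "\<xi> \<in> Q x" "\<eta> \<in> Q x" "y = F \<xi>" "z = F \<eta>" by auto
        then have "norm (y - z) \<le> L * norm (\<xi> - \<eta>)" using L(2) Q_cube by blast
        also have "\<dots> \<le> L * (3 / real n)" using L(1) Q_norm[OF *(1,2)] by (intro mult_left_mono) auto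
        finally show "norm (y - z) \<le> 3 * L / real n" by (simp add: mult.commute)
      qed (use L n in auto)
    qed (use X n L in auto)
    also have "real (card X) * (pi / 4 * (3 * L / real n)\<^sup>2) = 54 * (pi / 4 * L\<^sup>2)"
      using n(1) unfolding X by (simp add: field_simps power2_eq_square)
    finally show ?thesis .
  qed
  have "hausdorff2 (frontier hex) \<le> ennreal (54 * (pi / 4 * L\<^sup>2))"
    unfolding hausdorff2_def by (rule SUP_least) (use bound in auto)
  then show ?thesis
    using ennreal_less_top le_less_trans by (metis infinity_ennreal_def)
qed

lemma sets_surface_measure [measurable_cong, simp]: "sets surface_measure = sets borel"
  unfolding surface_measure_def by (metis sets.sigma_sets_eq sets_measure_of space_borel subset_UNIV Pow_UNIV)

text \<open>\<open>measure_of\<close> yields either \<open>hausdorff2 A\<close> or its default value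
  0, and both satisfy the bound.\<close>

lemma emeasure_surface_measure_le: "emeasure surface_measure A \<le> hausdorff2 A"
  unfolding surface_measure_def by (simp add: emeasure_measure_of_conv)

subsection \<open>Covariant fields\<close>

text \<open>The solution as a quotient of determinants, so that its regularity in the entries is
  visible; \<open>matrix_inv\<close> is defined by choice and does not show it.\<close>

definition cramer_sol :: "real^3^3 \<Rightarrow> real^3 \<Rightarrow> real^3" where
  "cramer_sol A b = (\<chi> k. det (\<chi> i j. if j = k then b $ i else A $ i $ j) / det A)"

lemma cramer_sol: "det A \<noteq> 0 \<Longrightarrow> A *v x = b \<longleftrightarrow> x = cramer_sol A b"
  unfolding cramer_sol_def by (rule cramer)

lemma matrix_inv_eq_cramer_sol: "invertible A \<Longrightarrow> matrix_inv A *v b = cramer_sol A b"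
  by (subst cramer_sol[symmetric])
    (auto simp: invertible_det_nz matrix_vector_mul_assoc matrix_inv)

lemma C1_on_det:
  fixes A :: "'a::euclidean_space \<Rightarrow> real^3^3"
  assumes "\<And>i j. C1_on U (\<lambda>x. A x $ i $ j)"
  shows "C1_on U (\<lambda>x. det (A x))"
  unfolding det_3 by (intro C1_on_add C1_on_diff C1_on_mult assms)

lemma C1_on_cramer_sol:
  fixes A :: "'a::euclidean_space \<Rightarrow> real^3^3"
  assumes "\<And>i j. C1_on U (\<lambda>x. A x $ i $ j)" "\<And>i. C1_on U (\<lambda>x. b x $ i)" "\<And>x. x \<in> U \<Longrightarrow> det (A x) \<noteq> 0"
  shows "C1_on U (\<lambda>x. cramer_sol (A x) (b x))"
  unfolding cramer_sol_def
proof (intro C1_on_vec_lambda C1_on_divide C1_on_det)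
  show "C1_on U (\<lambda>x. (\<chi> i j. if j = k then b x $ i else A x $ i $ j) $ i $ j)" for k i j
    using assms(1,2) by (cases "j = k") simp_all
qed (use assms in auto)

lemma C1_on_Q_space: "q \<in> Q_space px py pz \<Longrightarrow> C1_on U q"
proof -
  assume "q \<in> Q_space px py pz"
  then obtain c where "q = (\<lambda>\<xi>. \<Sum>i\<le>px. \<Sum>j\<le>py. \<Sum>l\<le>pz. c i j l * (\<xi>$1)^i * (\<xi>$2)^j * (\<xi>$3)^l)"
    unfolding Q_space_def by auto
  then show ?thesis
    by (simp only:) (intro C1_on_sum C1_on_mult C1_on_power C1_on_const C1_on_nth)
qed

context hexahedron
begin

lemma det_Jac_nz: "\<xi> \<in> ref_cube \<Longrightarrow> det (Jac \<xi>) \<noteq> 0"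
  using inv invertible_det_nz by blast

lemma continuous_matrix_inv_Jac: "continuous_on ref_cube (\<lambda>\<xi>. matrix_inv (Jac \<xi>) *v h)"
proof -
  have "C1_on ref_cube (\<lambda>\<xi>. cramer_sol (Jac \<xi>) h)"
    by (intro C1_on_cramer_sol C1_on_subset[OF C1_Jac cube] C1_on_const det_Jac_nz)
  from C1_on_continuous[OF this] show ?thesis
    by (rule continuous_on_eq) (simp add: matrix_inv_eq_cramer_sol inv)
qed

lemma continuous_matrix_inv_transpose_Jac:
  "continuous_on ref_cube (\<lambda>\<xi>. matrix_inv (transpose (Jac \<xi>)) *v h)"
proof -
  have "C1_on ref_cube (\<lambda>\<xi>. cramer_sol (transpose (Jac \<xi>)) h)"
    by (intro C1_on_cramer_sol C1_on_const)
      (auto simp: transpose_def det_Jac_nz det_transpose[unfolded transpose_def] intro: C1_on_subset[OF C1_Jac cube])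
  from C1_on_continuous[OF this] show ?thesis
    by (rule continuous_on_eq) (simp add: matrix_inv_eq_cramer_sol inv invertible_det_nz det_transpose det_Jac_nz)
qed

text \<open>\<open>\<Phi>\<close> is the field with covariant pullback \<open>q\<close>. Cramer's
  rule extends \<open>\<Phi> \<circ> F\<close> to a continuously differentiable function on the
  closed cube, so \<open>\<Phi>\<close> and, by the chain rule, its derivative have continuous
  extensions up to the boundary. Traces and the integrability of the curl rest on this.\<close>

lemma covariant_field:
  assumes q: "\<And>i. C1_on U (\<lambda>\<xi>. q \<xi> $ i)"
    and \<Phi>: "\<And>\<xi>. \<xi> \<in> box 0 1 \<Longrightarrow> transpose (Jac \<xi>) *v \<Phi> (F \<xi>) = q \<xi>"
  obtains \<Psi> W where "continuous_on ref_cube \<Psi>" "\<And>\<xi>. \<xi> \<in> box 0 1 \<Longrightarrow> \<Phi> (F \<xi>) = \<Psi> \<xi>"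
    "\<And>h. continuous_on ref_cube (\<lambda>\<xi>. W \<xi> h)"
    "\<And>\<xi>. \<xi> \<in> box 0 1 \<Longrightarrow> (\<Phi> has_derivative W \<xi>) (at (F \<xi>))"
proof -
  define \<Psi> where "\<Psi> \<xi> = cramer_sol (transpose (Jac \<xi>)) (q \<xi>)" for \<xi>
  have "C1_on ref_cube \<Psi>"
    unfolding \<Psi>_def
    by (intro C1_on_cramer_sol C1_on_subset[OF q cube])
      (auto simp: transpose_def det_Jac_nz det_transpose[unfolded transpose_def] intro: C1_on_subset[OF C1_Jac cube])
  then obtain \<Psi>' where \<Psi>': "\<And>\<xi>. \<xi> \<in> ref_cube \<Longrightarrow> (\<Psi> has_derivative \<Psi>' \<xi>) (at \<xi>)"
      "\<And>h. continuous_on ref_cube (\<lambda>\<xi>. \<Psi>' \<xi> h)"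
    and cont: "continuous_on ref_cube \<Psi>"
    using C1_on_continuous unfolding C1_on_def by blast
  have eq: "\<Phi> (F \<xi>) = \<Psi> \<xi>" if "\<xi> \<in> box 0 1" for \<xi>
  proof -
    have "\<xi> \<in> ref_cube" using that box_subset_cbox by blast
    then have "det (transpose (Jac \<xi>)) \<noteq> 0" using det_Jac_nz by (simp add: det_transpose)
    from cramer_sol[OF this] show ?thesis using \<Phi>[OF that] unfolding \<Psi>_def by blast
  qed
  show thesis
  proof (rule that[OF cont eq])
    show "continuous_on ref_cube (\<lambda>\<xi>. \<Psi>' \<xi> (matrix_inv (Jac \<xi>) *v h))" for h
      by (rule continuous_on_bounded_linear_family[OF has_derivative_bounded_linear[OF \<Psi>'(1)] \<Psi>'(2) continuous_matrix_inv_Jac])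
    fix \<xi> :: "real^3" assume \<xi>: "\<xi> \<in> box 0 1"
    then have c: "\<xi> \<in> ref_cube" using box_subset_cbox by blast
    have "(\<Psi> \<circ> Finv has_derivative (\<lambda>h. \<Psi>' \<xi> (matrix_inv (Jac \<xi>) *v h))) (at (F \<xi>))"
      using diff_chain_at[OF Finv_derivative[OF \<xi>], of \<Psi> "\<Psi>' \<xi>"] \<Psi>'(1)[OF c] c by (simp add: o_def)
    then show "(\<Phi> has_derivative (\<lambda>h. \<Psi>' \<xi> (matrix_inv (Jac \<xi>) *v h))) (at (F \<xi>))"
    proof (rule has_derivative_transform_within_open)
      show "(\<Psi> \<circ> Finv) y = \<Phi> y" if "y \<in> F ` box 0 1" for y
        using that eq box_subset_cbox[of 0 "1::real^3"] by (auto simp: subset_eq)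
    qed (use open_image_box \<xi> in auto)
  qed
qed

end

section \<open>Spatial discrete fields on a mesh\<close>

definition mesh_interior :: "'e mesh \<Rightarrow> (real^3) set" where
  "mesh_interior M = (\<Union>K\<in>elems M. interior (cell M K))"

text \<open>The spatial factors of discrete fields. The value 0 off the open elements makes them
  Borel and bounded on the whole space.\<close>

definition Xh :: "'e mesh \<Rightarrow> (real^3 \<Rightarrow> real^3) set" where
  "Xh M = {\<Phi>. (\<forall>x. x \<notin> mesh_interior M \<longrightarrow> \<Phi> x = 0) \<and>
     (\<forall>K\<in>elems M. \<exists>q\<in>Q3_space (xdeg M K) (ydeg M K) (zdeg M K).
        \<forall>\<xi>\<in>interior ref_cube. transpose (DF M K \<xi>) *v \<Phi> (emap M K \<xi>) = q \<xi>)}"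

lemma vector_3_eq: "vector [a, b, c] = a *\<^sub>R axis 1 1 + b *\<^sub>R axis 2 1 + c *\<^sub>R (axis 3 1 :: real^3)"
  by (simp add: vec_eq_iff forall_3 axis_def)

locale slab_grid =
  fixes \<Omega> :: "(real^3) set" and a b :: real and M :: "'e mesh"
  assumes open_\<Omega>: "open \<Omega>" and slab_mesh: "slab_mesh \<Omega> a b M"
begin

lemma finite_elems: "finite (elems M)"
  using slab_mesh by (simp add: slab_mesh_def)

definition chart :: "'e \<Rightarrow> (real^3) set" where
  "chart K = (SOME U. ref_cube \<subseteq> U \<and> smooth_on U (emap M K))"

lemma hexahedron: "K \<in> elems M \<Longrightarrow> hexahedron (emap M K) (chart K)"
proof -
  assume K: "K \<in> elems M"
  then have "\<exists>U. ref_cube \<subseteq> U \<and> smooth_on U (emap M K)"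
    using slab_mesh unfolding slab_mesh_def by meson
  from someI_ex[OF this] have "ref_cube \<subseteq> chart K" "smooth_on (chart K) (emap M K)"
    unfolding chart_def by auto
  moreover have "inj_on (emap M K) ref_cube" "\<forall>\<xi>\<in>ref_cube. invertible (DF M K \<xi>)"
    using slab_mesh K unfolding slab_mesh_def by auto
  ultimately show ?thesis
    by (intro hexahedron.intro) (auto simp: DF_def)
qed

lemma interior_cell: "K \<in> elems M \<Longrightarrow> interior (cell M K) = emap M K ` box 0 1"
  unfolding cell_def by (rule hexahedron.interior_hex[OF hexahedron])

lemma compact_cell: "K \<in> elems M \<Longrightarrow> compact (cell M K)"
  unfolding cell_def by (rule hexahedron.compact_hex[OF hexahedron])

lemma open_mesh_interior: "open (mesh_interior M)"
  unfolding mesh_interior_def by auto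

lemma mesh_interior_subset: "mesh_interior M \<subseteq> \<Omega>"
  using slab_mesh by (simp add: slab_mesh_def mesh_interior_def)

lemma \<Omega>_subset: "\<Omega> \<subseteq> (\<Union>K\<in>elems M. cell M K)"
  using slab_mesh by (simp add: slab_mesh_def)

lemma bounded_\<Omega>: "bounded \<Omega>"
  using \<Omega>_subset finite_elems compact_cell
  by (intro bounded_subset[OF bounded_UN]) (auto intro: compact_imp_bounded)

lemma negligible_skeleton: "negligible (\<Omega> - mesh_interior M)"
proof (rule negligible_subset)
  have "negligible (frontier (cell M K))" if "K \<in> elems M" for K
    unfolding cell_def by (rule hexahedron.negligible_frontier_hex[OF hexahedron[OF that]])
  then show "negligible (\<Union>K\<in>elems M. frontier (cell M K))"
    using finite_elems by (intro negligible_Union) auto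
  show "\<Omega> - mesh_interior M \<subseteq> (\<Union>K\<in>elems M. frontier (cell M K))"
  proof
    fix x assume x: "x \<in> \<Omega> - mesh_interior M"
    then obtain K where K: "K \<in> elems M" "x \<in> cell M K"
      using \<Omega>_subset by blast
    then have "x \<in> frontier (cell M K)"
      using x closure_subset[of "cell M K"] unfolding mesh_interior_def frontier_def by blast
    with K(1) show "x \<in> (\<Union>K\<in>elems M. frontier (cell M K))" by blast
  qed
qed

text \<open>Pulled back, the function extends continuously to the compact cube; one bound serves all
  elements since there are finitely many.\<close>

lemma elementwise_continuous_bounded:
  assumes "\<And>K. K \<in> elems M \<Longrightarrow> \<exists>g. continuous_on ref_cube g \<and> (\<forall>\<xi>\<in>box 0 1. f (emap M K \<xi>) = g \<xi>)"
  shows "continuous_on (mesh_interior M) f \<and> bounded (f ` mesh_interior M)"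
proof -
  have "continuous_on (interior (cell M K)) f \<and> bounded (f ` interior (cell M K))" if K: "K \<in> elems M" for K
  proof -
    obtain g where g: "continuous_on ref_cube g" "\<And>\<xi>. \<xi> \<in> box 0 1 \<Longrightarrow> f (emap M K \<xi>) = g \<xi>"
      using assms[OF K] by blast
    interpret hexahedron "emap M K" "chart K" by (rule hexahedron[OF K])
    have "continuous_on (interior hex) (\<lambda>x. g (Finv x))"
    proof (rule continuous_on_compose2[OF g(1)])
      show "continuous_on (interior hex) Finv"
        by (rule continuous_on_subset[OF continuous_Finv interior_subset])
      show "Finv ` interior hex \<subseteq> ref_cube"
        using interior_subset[of hex] Finv_in by auto
    qed
    moreover have "g (Finv x) = f x" if x: "x \<in> interior hex" for x
    proof -
      obtain \<xi> where \<xi>: "\<xi> \<in> box 0 1" "x = emap M K \<xi>"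
        using x unfolding interior_hex by blast
      moreover have "\<xi> \<in> ref_cube" using \<xi>(1) box_subset_cbox by blast
      ultimately show ?thesis using g(2) by simp
    qed
    ultimately have "continuous_on (interior hex) f"
      by (rule continuous_on_eq)
    moreover have "bounded (g ` ref_cube)"
      by (intro compact_imp_bounded compact_continuous_image g(1)) simp
    then have "bounded (f ` interior hex)"
    proof (rule bounded_subset)
      show "f ` interior hex \<subseteq> g ` ref_cube"
        unfolding interior_hex using g(2) box_subset_cbox by fastforce
    qed
    ultimately show ?thesis by (simp add: cell_def)
  qed
  then show ?thesis
    unfolding mesh_interior_def image_UN
    using finite_elems by (intro conjI continuous_on_open_UN bounded_UN) auto
qed

lemma mesh_pcbI:
  "continuous_on (mesh_interior M) f \<and> bounded (f ` mesh_interior M) \<Longrightarrow> pcb \<Omega> f"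
  unfolding pcb_def using open_mesh_interior mesh_interior_subset negligible_skeleton by blast

lemma elementwise_constant_pcb: "elementwise_constant M \<kappa> \<Longrightarrow> pcb \<Omega> \<kappa>"
proof (intro mesh_pcbI elementwise_continuous_bounded)
  fix K assume "elementwise_constant M \<kappa>" and K: "K \<in> elems M"
  then obtain c where "\<And>x. x \<in> interior (cell M K) \<Longrightarrow> \<kappa> x = c"
    unfolding elementwise_constant_def by blast
  then show "\<exists>g. continuous_on ref_cube g \<and> (\<forall>\<xi>\<in>box 0 1. \<kappa> (emap M K \<xi>) = g \<xi>)"
    using interior_cell[OF K] by (intro exI[of _ "\<lambda>_. c"]) auto
qed

lemma Xh_field:
  assumes "\<Phi> \<in> Xh M" "K \<in> elems M"
  shows "\<exists>\<Psi>. continuous_on ref_cube \<Psi> \<and> (\<forall>\<xi>\<in>box 0 1. \<Phi> (emap M K \<xi>) = \<Psi> \<xi>)" (is ?value)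
    and "\<exists>W. (\<forall>h. continuous_on ref_cube (\<lambda>\<xi>. W \<xi> h)) \<and>
      (\<forall>\<xi>\<in>box 0 1. (\<Phi> has_derivative W \<xi>) (at (emap M K \<xi>)))" (is ?derivative)
proof -
  obtain q where q: "q \<in> Q3_space (xdeg M K) (ydeg M K) (zdeg M K)"
    "\<And>\<xi>. \<xi> \<in> box 0 1 \<Longrightarrow> transpose (jacobian (emap M K) (at \<xi>)) *v \<Phi> (emap M K \<xi>) = q \<xi>"
    using assms unfolding Xh_def DF_def interior_cbox by blast
  interpret hexahedron "emap M K" "chart K" by (rule hexahedron[OF assms(2)])
  have "?value \<and> ?derivative"
  proof (rule covariant_field[OF _ q(2)])
    show "C1_on (chart K) (\<lambda>\<xi>. q \<xi> $ i)" for i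
      using q(1) unfolding Q3_space_def by (intro C1_on_Q_space) auto
    fix \<Psi> W
    assume \<Psi>: "continuous_on ref_cube \<Psi>" "\<And>\<xi>. \<xi> \<in> box 0 1 \<Longrightarrow> \<Phi> (emap M K \<xi>) = \<Psi> \<xi>"
      and W: "\<And>h. continuous_on ref_cube (\<lambda>\<xi>. W \<xi> h)"
        "\<And>\<xi>. \<xi> \<in> box 0 1 \<Longrightarrow> (\<Phi> has_derivative W \<xi>) (at (emap M K \<xi>))"
    show "?value \<and> ?derivative"
      by (intro conjI exI[of _ \<Psi>] exI[of _ W] allI ballI \<Psi> W)
  qed
  then show ?value and ?derivative by simp_all
qed

lemma Xh_continuous_bounded:
  "\<Phi> \<in> Xh M \<Longrightarrow> continuous_on (mesh_interior M) \<Phi> \<and> bounded (\<Phi> ` mesh_interior M)"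
  by (rule elementwise_continuous_bounded) (rule Xh_field(1))

lemma Xh_pcb: "\<Phi> \<in> Xh M \<Longrightarrow> pcb \<Omega> \<Phi>"
  by (intro mesh_pcbI Xh_continuous_bounded)

lemma Xh_borel: "\<Phi> \<in> Xh M \<Longrightarrow> \<Phi> \<in> borel_measurable borel"
proof -
  assume \<Phi>: "\<Phi> \<in> Xh M"
  have "(\<lambda>x. indicator (mesh_interior M) x *\<^sub>R \<Phi> x) \<in> borel_measurable borel"
    using Xh_continuous_bounded[OF \<Phi>] open_mesh_interior
    by (intro borel_measurable_continuous_on_indicator) auto
  moreover have "(\<lambda>x. indicator (mesh_interior M) x *\<^sub>R \<Phi> x) = \<Phi>"
    using \<Phi> by (auto simp: Xh_def fun_eq_iff indicator_def)
  ultimately show ?thesis by simp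
qed

lemma Xh_bounded: "\<Phi> \<in> Xh M \<Longrightarrow> \<exists>B. \<forall>x. norm (\<Phi> x) \<le> B"
proof -
  assume \<Phi>: "\<Phi> \<in> Xh M"
  then obtain B where B: "\<And>x. x \<in> mesh_interior M \<Longrightarrow> norm (\<Phi> x) \<le> B"
    using Xh_continuous_bounded[OF \<Phi>] unfolding bounded_iff by blast
  have "norm (\<Phi> x) \<le> max B 0" for x
    using B[of x] \<Phi> by (cases "x \<in> mesh_interior M") (auto simp: Xh_def)
  then show ?thesis by blast
qed

lemma Xh_differentiable: "\<Phi> \<in> Xh M \<Longrightarrow> x \<in> mesh_interior M \<Longrightarrow> \<Phi> differentiable (at x)"
proof -
  assume \<Phi>: "\<Phi> \<in> Xh M" and "x \<in> mesh_interior M"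
  then obtain K \<xi> where K: "K \<in> elems M" "\<xi> \<in> box 0 1" "x = emap M K \<xi>"
    unfolding mesh_interior_def using interior_cell by blast
  obtain W where "\<And>\<xi>. \<xi> \<in> box 0 1 \<Longrightarrow> (\<Phi> has_derivative W \<xi>) (at (emap M K \<xi>))"
    using Xh_field(2)[OF \<Phi> K(1)] by blast
  with K show ?thesis unfolding differentiable_def by blast
qed

lemma Xh_curl_pcb: "\<Phi> \<in> Xh M \<Longrightarrow> pcb \<Omega> (curl \<Phi>)"
proof (intro mesh_pcbI elementwise_continuous_bounded)
  fix K assume \<Phi>: "\<Phi> \<in> Xh M" and K: "K \<in> elems M"
  obtain W where W: "\<And>h. continuous_on ref_cube (\<lambda>\<xi>. W \<xi> h)"
    "\<And>\<xi>. \<xi> \<in> box 0 1 \<Longrightarrow> (\<Phi> has_derivative W \<xi>) (at (emap M K \<xi>))"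
    using Xh_field(2)[OF \<Phi> K] by blast
  define D where "D \<xi> i j = W \<xi> (axis j 1) $ i" for \<xi> i j
  define g where "g \<xi> = (D \<xi> 3 2 - D \<xi> 2 3) *\<^sub>R axis 1 1 + (D \<xi> 1 3 - D \<xi> 3 1) *\<^sub>R axis 2 1
    + (D \<xi> 2 1 - D \<xi> 1 2) *\<^sub>R (axis 3 1 :: real^3)" for \<xi>
  have D: "continuous_on ref_cube (\<lambda>\<xi>. D \<xi> i j)" for i j
    unfolding D_def by (intro continuous_on_component W)
  have "continuous_on ref_cube g"
    unfolding g_def by (intro continuous_on_add continuous_on_scaleR continuous_on_diff D continuous_on_const)
  moreover have "curl \<Phi> (emap M K \<xi>) = g \<xi>" if "\<xi> \<in> box 0 1" for \<xi>
  proof -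
    have "jacobian \<Phi> (at (emap M K \<xi>)) $ i $ j = D \<xi> i j" for i j
      using frechet_derivative_at[OF W(2)[OF that], symmetric] by (simp add: jacobian_def matrix_def D_def)
    then show ?thesis by (simp add: curl_def Let_def g_def vector_3_eq)
  qed
  ultimately show "\<exists>g. continuous_on ref_cube g \<and> (\<forall>\<xi>\<in>box 0 1. curl \<Phi> (emap M K \<xi>) = g \<xi>)"
    by blast
qed

subsection \<open>Traces\<close>

lemma frontier_cell_filter:
  assumes "K \<in> elems M" "x \<in> frontier (cell M K)"
  shows "x \<in> cell M K" "at x within interior (cell M K) \<noteq> bot"
proof -
  interpret hexahedron "emap M K" "chart K" by (rule hexahedron[OF assms(1)])
  show "x \<in> cell M K" using assms(2) frontier_subset_hex by (auto simp: cell_def)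
  then have "x \<in> closure (interior (cell M K))" "x \<notin> interior (cell M K)"
    using assms(2) closure_interior_hex unfolding cell_def frontier_def by auto
  then show "at x within interior (cell M K) \<noteq> bot"
    by (simp add: trivial_limit_within closure_def)
qed

text \<open>The continuous extension to the closed cube, carried over by \<open>Finv\<close>, is the
  limit from the interior; \<open>Lim\<close> returns it because the filter is nontrivial.\<close>

lemma Xh_trace:
  assumes "\<Phi> \<in> Xh M" "K \<in> elems M"
  shows "continuous_on (frontier (cell M K)) (trace_on M K \<Phi>)"
    "x \<in> frontier (cell M K) \<Longrightarrow> (\<Phi> \<longlongrightarrow> trace_on M K \<Phi> x) (at x within interior (cell M K))"
proof -
  interpret hexahedron "emap M K" "chart K" by (rule hexahedron[OF assms(2)])
  obtain \<Psi> where \<Psi>: "continuous_on ref_cube \<Psi>" "\<And>\<xi>. \<xi> \<in> box 0 1 \<Longrightarrow> \<Phi> (emap M K \<xi>) = \<Psi> \<xi>"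
    using Xh_field(1)[OF assms] by blast
  have c: "continuous_on (cell M K) (\<lambda>x. \<Psi> (Finv x))"
    unfolding cell_def
    by (rule continuous_on_compose2[OF \<Psi>(1) continuous_Finv]) (use Finv_in in auto)
  have eq: "\<Phi> y = \<Psi> (Finv y)" if y: "y \<in> interior (cell M K)" for y
  proof -
    obtain \<xi> where \<xi>: "\<xi> \<in> box 0 1" "y = emap M K \<xi>"
      using y unfolding interior_cell[OF assms(2)] by blast
    moreover have "\<xi> \<in> ref_cube" using \<xi>(1) box_subset_cbox by blast
    ultimately show ?thesis using \<Psi>(2) by simp
  qed
  have lim: "(\<Phi> \<longlongrightarrow> \<Psi> (Finv x)) (at x within interior (cell M K))" if "x \<in> frontier (cell M K)" for x
  proof -
    have "((\<lambda>y. \<Psi> (Finv y)) \<longlongrightarrow> \<Psi> (Finv x)) (at x within cell M K)"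
      using c frontier_cell_filter(1)[OF assms(2) that] unfolding continuous_on_def by blast
    then have "((\<lambda>y. \<Psi> (Finv y)) \<longlongrightarrow> \<Psi> (Finv x)) (at x within interior (cell M K))"
      by (rule tendsto_within_subset) (rule interior_subset)
    then show ?thesis
      by (rule Lim_transform_within[where d = 1]) (simp_all add: eq)
  qed
  have tr: "trace_on M K \<Phi> x = \<Psi> (Finv x)" if "x \<in> frontier (cell M K)" for x
    unfolding trace_on_def by (rule tendsto_Lim[OF frontier_cell_filter(2)[OF assms(2) that] lim[OF that]])
  show "x \<in> frontier (cell M K) \<Longrightarrow> (\<Phi> \<longlongrightarrow> trace_on M K \<Phi> x) (at x within interior (cell M K))"
    using lim tr by simp
  have "continuous_on (frontier (cell M K)) (\<lambda>x. \<Psi> (Finv x))"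
    by (rule continuous_on_subset[OF c]) (use frontier_cell_filter(1)[OF assms(2)] in auto)
  then show "continuous_on (frontier (cell M K)) (trace_on M K \<Phi>)"
    by (rule continuous_on_eq) (simp add: tr)
qed

text \<open>\<open>Lim\<close> respects linear combinations where the limits exist, and
  \<open>Xh_trace\<close> guarantees that. Only values on the open elements enter the limit, so
  agreement there suffices.\<close>

lemma trace_expansion:
  assumes "K \<in> elems M" "x \<in> frontier (cell M K)" "\<And>i. i \<in> A \<Longrightarrow> \<Phi> i \<in> Xh M"
    and "\<And>y. y \<in> mesh_interior M \<Longrightarrow> u y = (\<Sum>i\<in>A. c i *\<^sub>R \<Phi> i y)"
  shows "trace_on M K u x = (\<Sum>i\<in>A. c i *\<^sub>R trace_on M K (\<Phi> i) x)"
proof -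
  have "((\<lambda>y. \<Sum>i\<in>A. c i *\<^sub>R \<Phi> i y) \<longlongrightarrow> (\<Sum>i\<in>A. c i *\<^sub>R trace_on M K (\<Phi> i) x)) (at x within interior (cell M K))"
    by (intro tendsto_sum tendsto_scaleR tendsto_const Xh_trace(2) assms)
  then have "(u \<longlongrightarrow> (\<Sum>i\<in>A. c i *\<^sub>R trace_on M K (\<Phi> i) x)) (at x within interior (cell M K))"
  proof (rule Lim_transform_within[where d = 1])
    fix y assume "y \<in> interior (cell M K)"
    then have "y \<in> mesh_interior M" using assms(1) unfolding mesh_interior_def by blast
    from assms(4)[OF this] show "(\<Sum>i\<in>A. c i *\<^sub>R \<Phi> i y) = u y" by (rule sym)
  qed simp
  then show ?thesis
    unfolding trace_on_def[of M K u] by (rule tendsto_Lim[OF frontier_cell_filter(2)[OF assms(1,2)]])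
qed

lemma outward_normal_borel:
  assumes "K \<in> elems M"
  shows "(\<lambda>x. indicator (cell M K) x *\<^sub>R outward_normal M K x) \<in> borel_measurable borel"
proof -
  interpret hexahedron "emap M K" "chart K" by (rule hexahedron[OF assms])
  let ?R = "restrict_space borel (cell M K)"
  have cell: "cell M K \<in> sets borel"
    using compact_cell[OF assms] by (simp add: borel_compact)
  have Finv: "Finv \<in> borel_measurable ?R"
    using continuous_Finv by (intro borel_measurable_continuous_on_restrict) (simp add: cell_def)
  have ref: "(\<lambda>x. ref_normal (Finv x) $ k) \<in> borel_measurable ?R" for k
  proof -
    have "(\<lambda>\<xi>::real^3. ref_normal \<xi> $ k) \<in> borel_measurable borel"
      unfolding ref_normal_def vec_lambda_beta by measurable
    then show ?thesis by (rule measurable_compose[OF Finv])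
  qed
  have inv: "(\<lambda>x. matrix_inv (transpose (Jac (Finv x))) *v axis k 1) \<in> borel_measurable ?R" for k
  proof (rule borel_measurable_continuous_on_restrict)
    show "continuous_on (cell M K) (\<lambda>x. matrix_inv (transpose (Jac (Finv x))) *v axis k 1)"
      unfolding cell_def
      by (rule continuous_on_compose2[OF continuous_matrix_inv_transpose_Jac continuous_Finv]) (use Finv_in in auto)
  qed
  \<comment> \<open>Expansion over the columns separates \<open>ref_normal\<close>, which is only
    measurable, from the inverse Jacobian, which is continuous.\<close>
  have "outward_normal M K x =
      sgn (\<Sum>k\<in>UNIV. (ref_normal (Finv x) $ k) *\<^sub>R (matrix_inv (transpose (Jac (Finv x))) *v axis k 1))" for x
  proof -
    have *: "A *v v = (\<Sum>k\<in>UNIV. (v $ k) *\<^sub>R (A *v axis k 1))" for A :: "real^3^3" and v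
      by (simp add: matrix_vector_mult_basis column_def vec_eq_iff matrix_vector_mult_def[of A v] mult.commute)
    show ?thesis
      unfolding outward_normal_def Let_def Finv_def[symmetric] DF_def by (rule arg_cong[OF *])
  qed
  moreover have "(\<lambda>x. \<Sum>k\<in>UNIV. (ref_normal (Finv x) $ k) *\<^sub>R (matrix_inv (transpose (Jac (Finv x))) *v axis k 1))
      \<in> borel_measurable ?R"
    by (intro borel_measurable_scaleR borel_measurable_sum ref inv)
  from measurable_compose[OF this borel_measurable_sgn]
  have "(\<lambda>x. sgn (\<Sum>k\<in>UNIV. (ref_normal (Finv x) $ k) *\<^sub>R (matrix_inv (transpose (Jac (Finv x))) *v axis k 1)))
      \<in> borel_measurable ?R" .
  ultimately have "outward_normal M K \<in> borel_measurable ?R"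
    by (simp cong: measurable_cong)
  then show ?thesis
    using cell by (subst (asm) borel_measurable_restrict_space_iff) auto
qed

subsection \<open>Faces\<close>

definition faces :: "'e face set" where
  "faces = interior_faces M \<union> boundary_faces \<Omega> M"

lemma faces_props:
  assumes "(S, f) \<in> faces"
  shows "finite S" "S \<subseteq> elems M" "S \<noteq> {}" "closed f" "K \<in> S \<Longrightarrow> f \<subseteq> frontier (cell M K)"
  using assms unfolding faces_def interior_faces_def boundary_faces_def by (auto intro: closed_Int)

lemma average_expansion:
  assumes "(S, f) \<in> faces" "x \<in> f" "\<And>i. i \<in> A \<Longrightarrow> \<Phi> i \<in> Xh M"
    and "\<And>y. y \<in> mesh_interior M \<Longrightarrow> u y = (\<Sum>i\<in>A. c i *\<^sub>R \<Phi> i y)"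
  shows "average M S u x = (\<Sum>i\<in>A. c i *\<^sub>R average M S (\<Phi> i) x)"
proof -
  have "(\<Sum>K\<in>S. trace_on M K u x) = (\<Sum>K\<in>S. \<Sum>i\<in>A. c i *\<^sub>R trace_on M K (\<Phi> i) x)"
    using faces_props[OF assms(1)] assms(2) by (intro sum.cong refl trace_expansion[OF _ _ assms(3,4)]) auto
  also have "\<dots> = (\<Sum>i\<in>A. c i *\<^sub>R (\<Sum>K\<in>S. trace_on M K (\<Phi> i) x))"
    by (subst sum.swap) (simp add: scaleR_sum_right)
  finally show ?thesis
    unfolding average_def by (simp add: scaleR_sum_right mult.commute)
qed

lemma cross3_sum: "cross3 n (\<Sum>i\<in>A. c i *\<^sub>R v i) = (\<Sum>i\<in>A. c i *\<^sub>R cross3 n (v i))"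
  by (induction A rule: infinite_finite_induct) (auto simp: cross_add_right cross_mult_right)

lemma jump_expansion:
  assumes "(S, f) \<in> faces" "x \<in> f" "\<And>i. i \<in> A \<Longrightarrow> \<Phi> i \<in> Xh M"
    and "\<And>y. y \<in> mesh_interior M \<Longrightarrow> u y = (\<Sum>i\<in>A. c i *\<^sub>R \<Phi> i y)"
  shows "jump M S u x = (\<Sum>i\<in>A. c i *\<^sub>R jump M S (\<Phi> i) x)"
proof -
  have "jump M S u x = (\<Sum>K\<in>S. cross3 (outward_normal M K x) (\<Sum>i\<in>A. c i *\<^sub>R trace_on M K (\<Phi> i) x))"
    unfolding jump_def using faces_props[OF assms(1)] assms(2)
    by (intro sum.cong refl arg_cong[of _ _ "cross3 _"] trace_expansion[OF _ _ assms(3,4)]) auto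
  also have "\<dots> = (\<Sum>i\<in>A. c i *\<^sub>R jump M S (\<Phi> i) x)"
    unfolding cross3_sum jump_def scaleR_sum_right by (rule sum.swap)
  finally show ?thesis .
qed

lemma face_measure_finite: "(S, f) \<in> faces \<Longrightarrow> emeasure surface_measure f < \<infinity>"
proof -
  assume f: "(S, f) \<in> faces"
  then obtain K where K: "K \<in> S" "K \<in> elems M" "f \<subseteq> frontier (cell M K)"
    using faces_props[OF f] by blast
  have "emeasure surface_measure f \<le> emeasure surface_measure (frontier (cell M K))"
    using K(3) by (intro emeasure_mono) (auto intro: borel_closed)
  also have "\<dots> \<le> hausdorff2 (frontier (cell M K))"
    by (rule emeasure_surface_measure_le)
  also have "\<dots> < \<infinity>"
    using hexahedron.hausdorff2_frontier_hex[OF hexahedron[OF K(2)]] by (simp add: cell_def)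
  finally show ?thesis .
qed

text \<open>The indicator cuts off the points outside the face, where \<open>trace_on\<close> need
  not be a trace.\<close>

lemma face_integrand_regular:
  assumes "(S, f) \<in> faces" "K \<in> S" "\<Phi> \<in> Xh M"
  shows "(\<lambda>x. indicator f x *\<^sub>R trace_on M K \<Phi> x) \<in> borel_measurable borel" (is ?t)
    and "(\<lambda>x. indicator f x *\<^sub>R outward_normal M K x) \<in> borel_measurable borel" (is ?n)
    and "\<exists>B\<ge>0. \<forall>x\<in>f. norm (trace_on M K \<Phi> x) \<le> B" (is ?B)
proof -
  have K: "K \<in> elems M" and f: "closed f" "f \<subseteq> frontier (cell M K)"
    using faces_props[OF assms(1)] assms(2) by auto
  have c: "continuous_on f (trace_on M K \<Phi>)"
    by (rule continuous_on_subset[OF Xh_trace(1)[OF assms(3) K] f(2)])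
  show ?t
    using f(1) by (intro borel_measurable_continuous_on_indicator c) auto
  have cell: "f \<subseteq> cell M K" using f(2) frontier_cell_filter(1)[OF K] by blast
  have "(\<lambda>x. indicator f x *\<^sub>R (indicator (cell M K) x *\<^sub>R outward_normal M K x)) \<in> borel_measurable borel"
    using f(1) by (intro borel_measurable_scaleR outward_normal_borel[OF K] borel_measurable_indicator) auto
  moreover have "(\<lambda>x. indicator f x *\<^sub>R (indicator (cell M K) x *\<^sub>R outward_normal M K x))
      = (\<lambda>x. indicator f x *\<^sub>R outward_normal M K x)"
    using cell by (auto simp: fun_eq_iff indicator_def)
  ultimately show ?n by simp
  have "compact f"
    using f(1) cell compact_cell[OF K] by (metis compact_Int_closed inf.absorb_iff2)
  then have "bounded (trace_on M K \<Phi> ` f)"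
    using c by (intro compact_imp_bounded compact_continuous_image)
  then obtain B where "\<forall>y\<in>trace_on M K \<Phi> ` f. norm y \<le> B"
    unfolding bounded_iff by blast
  then show ?B
    by (intro exI[of _ "max B 0"]) (auto simp: le_max_iff_disj)
qed

lemma norm_outward_normal_le: "norm (outward_normal M K x) \<le> 1"
  unfolding outward_normal_def Let_def by (simp add: norm_sgn)

lemma norm_cross3_le: "norm (cross3 x y) \<le> norm x * norm y"
proof (rule power2_le_imp_le)
  show "(norm (cross3 x y))\<^sup>2 \<le> (norm x * norm y)\<^sup>2"
    unfolding norm_cross by (simp add: power_mult_distrib)
qed simp

text \<open>A bounded Borel function on a set of finite surface measure: traces are bounded on the
  compact face, and normals have norm at most 1.\<close>

lemma face_integrable:
  assumes "(S, f) \<in> faces" "\<Phi> \<in> Xh M" "\<Psi> \<in> Xh M"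
  shows "set_integrable surface_measure f (\<lambda>x. average M S \<Phi> x \<bullet> jump M S \<Psi> x)"
proof -
  define T where "T K \<Phi> x = indicator f x *\<^sub>R trace_on M K \<Phi> x" for K \<Phi> x
  define n where "n K x = indicator f x *\<^sub>R outward_normal M K x" for K x
  define h where "h x = ((1 / real (card S)) *\<^sub>R (\<Sum>K\<in>S. T K \<Phi> x)) \<bullet> (\<Sum>K\<in>S. cross3 (n K x) (T K \<Psi> x))" for x
  note reg = face_integrand_regular[OF assms(1)]
  have T: "T K \<Theta> \<in> borel_measurable borel" if "K \<in> S" "\<Theta> \<in> Xh M" for K \<Theta>
    using reg(1)[OF that] by (simp add: T_def[abs_def])
  have n: "n K \<in> borel_measurable borel" if "K \<in> S" for K
    using reg(2)[OF that assms(2)] by (simp add: n_def[abs_def])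
  have cr: "(\<lambda>x. cross3 (n K x) (T K \<Psi> x)) \<in> borel_measurable borel" if "K \<in> S" for K
  proof -
    have "continuous_on UNIV (\<lambda>z::(real^3) \<times> (real^3). cross3 (fst z) (snd z))"
      by (intro continuous_on_cross continuous_on_fst continuous_on_snd continuous_on_id)
    then show ?thesis
      by (rule borel_measurable_continuous_Pair[OF n[OF that] T[OF that assms(3)]])
  qed
  have h: "h \<in> borel_measurable borel"
    unfolding h_def[abs_def] using T assms(2) cr
    by (intro borel_measurable_inner borel_measurable_scaleR borel_measurable_sum borel_measurable_const)
  have ex: "\<exists>B. \<forall>K\<in>S. B K \<ge> 0 \<and> (\<forall>x\<in>f. norm (trace_on M K \<Theta> x) \<le> B K)" if "\<Theta> \<in> Xh M" for \<Theta>
    by (rule bchoice) (use reg(3)[OF _ that] in blast)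
  obtain B where B: "\<And>K. K \<in> S \<Longrightarrow> B K \<ge> 0" "\<And>K x. K \<in> S \<Longrightarrow> x \<in> f \<Longrightarrow> norm (trace_on M K \<Phi> x) \<le> B K"
    using ex[OF assms(2)] by blast
  obtain C where C: "\<And>K. K \<in> S \<Longrightarrow> C K \<ge> 0" "\<And>K x. K \<in> S \<Longrightarrow> x \<in> f \<Longrightarrow> norm (trace_on M K \<Psi> x) \<le> C K"
    using ex[OF assms(3)] by blast
  have bound: "norm (h x) \<le> (1 / real (card S) * (\<Sum>K\<in>S. B K)) * (\<Sum>K\<in>S. C K)" if x: "x \<in> f" for x
  proof -
    have "norm ((1 / real (card S)) *\<^sub>R (\<Sum>K\<in>S. T K \<Phi> x)) \<le> 1 / real (card S) * (\<Sum>K\<in>S. B K)"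
      using B x by (auto simp: T_def intro!: divide_right_mono sum_norm_le)
    moreover have "norm (\<Sum>K\<in>S. cross3 (n K x) (T K \<Psi> x)) \<le> (\<Sum>K\<in>S. C K)"
    proof (rule sum_norm_le)
      fix K assume K: "K \<in> S"
      have "norm (cross3 (n K x) (T K \<Psi> x)) \<le> norm (n K x) * norm (T K \<Psi> x)" by (rule norm_cross3_le)
      also have "\<dots> \<le> 1 * C K"
        using C[OF K] x norm_outward_normal_le by (intro mult_mono) (auto simp: T_def n_def)
      finally show "norm (cross3 (n K x) (T K \<Psi> x)) \<le> C K" by simp
    qed
    ultimately show ?thesis
      unfolding h_def using B(1)
      by (intro order.trans[OF Cauchy_Schwarz_ineq2[folded real_norm_def]] mult_mono) (auto intro!: sum_nonneg divide_nonneg_nonneg)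
  qed
  have "integrable surface_measure (\<lambda>x. indicator f x *\<^sub>R h x)"
  proof (rule integrableI_bounded_set_indicator)
    show "f \<in> sets surface_measure" using faces_props(4)[OF assms(1)] by (simp add: borel_closed)
    show "h \<in> borel_measurable surface_measure"
      using h by (simp cong: measurable_cong_sets)
    show "AE x in surface_measure. x \<in> f \<longrightarrow> norm (h x) \<le> (1 / real (card S) * (\<Sum>K\<in>S. B K)) * (\<Sum>K\<in>S. C K)"
      by (rule AE_I2) (use bound in blast)
  qed (rule face_measure_finite[OF assms(1)])
  moreover have "(\<lambda>x. indicator f x *\<^sub>R h x) = (\<lambda>x. indicator f x *\<^sub>R (average M S \<Phi> x \<bullet> jump M S \<Psi> x))"
    by (auto simp: fun_eq_iff indicator_def h_def T_def n_def average_def jump_def)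
  ultimately show ?thesis unfolding set_integrable_def by simp
qed

end

section \<open>Separated space-time fields\<close>

definition sep :: "(nat \<Rightarrow> real) \<Rightarrow> nat \<Rightarrow> 'i set \<Rightarrow> ('i \<Rightarrow> nat \<Rightarrow> real poly) \<Rightarrow> ('i \<Rightarrow> real^3 \<Rightarrow> real^3) \<Rightarrow> field3" where
  "sep \<tau> m A R \<Phi> t x = (\<Sum>i\<in>A. pw \<tau> m (R i) t *\<^sub>R \<Phi> i x)"

lemma gram_swap: "gram \<tau> m A C Q R = gram \<tau> m A (\<lambda>i l. C l i) R Q"
  unfolding gram_def by (subst sum.swap) (simp add: mult.commute)

text \<open>In the applications \<open>h t\<close> is a space integral at time \<open>t\<close>; on
  each open piece it is a polynomial in \<open>t\<close> whose coefficients involve the entries of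
  \<open>C\<close>.\<close>

lemma set_LINT_gram:
  assumes nodes: "\<And>j. j < m \<Longrightarrow> \<tau> j < \<tau> (Suc j)"
    and h: "\<And>j t. j < m \<Longrightarrow> \<tau> j < t \<Longrightarrow> t < \<tau> (Suc j) \<Longrightarrow>
      h t = (\<Sum>i\<in>A. \<Sum>l\<in>A. C i l * (poly (Q i j) t * poly (R l j) t))"
  shows "(LINT t:{\<tau> 0<..\<tau> m}|lebesgue. h t) = gram \<tau> m A C Q R"
    and "h absolutely_integrable_on {\<tau> 0<..\<tau> m}"
proof -
  have eq: "h t = poly (\<Sum>i\<in>A. \<Sum>l\<in>A. smult (C i l) (Q i j * R l j)) t" if "j < m" "\<tau> j < t" "t < \<tau> (Suc j)" for j t
    using h[OF that] by (simp add: poly_sum)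
  note * = absolutely_integrable_on_pieces[of m \<tau> h "\<lambda>j. \<Sum>i\<in>A. \<Sum>l\<in>A. smult (C i l) (Q i j * R l j)", OF nodes eq]
  show "h absolutely_integrable_on {\<tau> 0<..\<tau> m}" using * by blast
  have "(LINT t:{\<tau> 0<..\<tau> m}|lebesgue. h t) = tint \<tau> m (\<lambda>j. \<Sum>i\<in>A. \<Sum>l\<in>A. smult (C i l) (Q i j * R l j))"
    using * by blast
  also have "\<dots> = gram \<tau> m A C Q R"
    unfolding gram_eq_sum_pint tint_def pint_double_sum ..
  finally show "(LINT t:{\<tau> 0<..\<tau> m}|lebesgue. h t) = gram \<tau> m A C Q R" .
qed

text \<open>Both fields share the index set and the time factors \<open>P\<close>, so a single
  matrix carries the whole energy. The assumption \<open>T\<close> is the form in which the common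
  temporal test space enters: piecewise polynomials of degree below \<open>p\<close> are admissible
  time factors on every element.\<close>

locale slab_solution = slab_grid \<Omega> a b M + broken_family \<tau> m p A P
  for \<Omega> :: "(real^3) set" and a b :: real and M :: "'e mesh"
    and \<tau> :: "nat \<Rightarrow> real" and m p :: nat and A :: "'i set" and P :: "'i \<Rightarrow> nat \<Rightarrow> real poly" +
  fixes \<Phi> \<Psi> :: "'i \<Rightarrow> real^3 \<Rightarrow> real^3" and E H :: field3 and \<epsilon> \<mu> :: "real^3 \<Rightarrow> real" and \<epsilon>0 \<mu>0 :: real
  assumes ends: "\<tau> 0 = a" "\<tau> m = b"
    and \<Phi>: "\<And>i. i \<in> A \<Longrightarrow> \<Phi> i \<in> Xh M" and \<Psi>: "\<And>i. i \<in> A \<Longrightarrow> \<Psi> i \<in> Xh M"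
    and E: "\<And>t x. a < t \<Longrightarrow> t \<le> b \<Longrightarrow> x \<in> mesh_interior M \<Longrightarrow> E t x = sep \<tau> m A P \<Phi> t x"
    and H: "\<And>t x. a < t \<Longrightarrow> t \<le> b \<Longrightarrow> x \<in> mesh_interior M \<Longrightarrow> H t x = sep \<tau> m A P \<Psi> t x"
    and \<epsilon>: "pcb \<Omega> \<epsilon>" and \<mu>: "pcb \<Omega> \<mu>"
    and \<epsilon>0: "\<epsilon>0 > 0" "\<And>x. x \<in> \<Omega> \<Longrightarrow> \<epsilon>0 \<le> \<epsilon> x"
    and \<mu>0: "\<mu>0 > 0" "\<And>x. x \<in> \<Omega> \<Longrightarrow> \<mu>0 \<le> \<mu> x"
    and T: "\<And>K R. K \<in> elems M \<Longrightarrow> (\<And>j. j < m \<Longrightarrow> degree (R j) < p) \<Longrightarrow> pw \<tau> m R \<in> T_space {a<..b} M K"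
begin

lemma ab: "a < b"
  using nodes[of 0] nodes_mono[of 1 m] m ends by simp

lemma pw_piece: "j < m \<Longrightarrow> \<tau> j < t \<Longrightarrow> t \<le> \<tau> (Suc j) \<Longrightarrow> pw \<tau> m R t = poly (R j) t"
  by (rule pw_eq) (use nodes in auto)

lemma piece_in: "j < m \<Longrightarrow> \<tau> j < t \<Longrightarrow> t \<le> \<tau> (Suc j) \<Longrightarrow> a < t \<and> t \<le> b"
  using nodes_mono[of 0 j] nodes_mono[of "Suc j" m] ends by auto

section \<open>Volume and face forms of separated fields as Gram sums\<close>

lemma pcb_LINT_mesh:
  fixes g :: "real^3 \<Rightarrow> real"
  shows "pcb \<Omega> g \<Longrightarrow> (\<And>x. x \<in> mesh_interior M \<Longrightarrow> f x = g x) \<Longrightarrow> (LINT x:\<Omega>|lebesgue. f x) = (LINT x:\<Omega>|lebesgue. g x)"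
  by (rule pcb_LINT_cong[OF _ open_\<Omega> bounded_\<Omega> negligible_skeleton])

lemma pcb_combination:
  fixes f :: "'i \<Rightarrow> real^3 \<Rightarrow> real^3"
  shows "(\<And>i. i \<in> A \<Longrightarrow> pcb \<Omega> (f i)) \<Longrightarrow> pcb \<Omega> (\<lambda>x. \<Sum>i\<in>A. c i *\<^sub>R f i x)"
  by (intro pcb_sum open_\<Omega> pcb_scaleR pcb_const)

lemma LINT_separated:
  fixes f g :: "'i \<Rightarrow> real^3 \<Rightarrow> real^3"
  assumes "\<And>i. i \<in> A \<Longrightarrow> pcb \<Omega> (f i)" "\<And>i. i \<in> A \<Longrightarrow> pcb \<Omega> (g i)"
    and "\<And>x. x \<in> mesh_interior M \<Longrightarrow> u x = (\<Sum>i\<in>A. s i *\<^sub>R f i x)"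
    and "\<And>x. x \<in> mesh_interior M \<Longrightarrow> v x = (\<Sum>i\<in>A. r i *\<^sub>R g i x)"
  shows "(LINT x:\<Omega>|lebesgue. u x \<bullet> v x) = (\<Sum>i\<in>A. \<Sum>l\<in>A. (LINT x:\<Omega>|lebesgue. f i x \<bullet> g l x) * (s i * r l))"
proof -
  have "(LINT x:\<Omega>|lebesgue. u x \<bullet> v x) = (LINT x:\<Omega>|lebesgue. (\<Sum>i\<in>A. s i *\<^sub>R f i x) \<bullet> (\<Sum>i\<in>A. r i *\<^sub>R g i x))"
    using assms by (intro pcb_LINT_mesh pcb_inner pcb_combination) auto
  also have "\<dots> = (\<Sum>i\<in>A. \<Sum>l\<in>A. (LINT x:\<Omega>|lebesgue. f i x \<bullet> g l x) * (s i * r l))"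
    by (intro set_integral_separated pcb_absolutely_integrable pcb_inner assms open_\<Omega> bounded_\<Omega>)
  finally show ?thesis .
qed

text \<open>The space integral supplies the matrix, the time integral the rest. The expansions are
  required only between break points and inside elements, so they also cover time derivatives and
  curls.\<close>

lemma vol_form_gram:
  fixes f g :: "'i \<Rightarrow> real^3 \<Rightarrow> real^3"
  assumes "\<And>i. i \<in> A \<Longrightarrow> pcb \<Omega> (f i)" "\<And>i. i \<in> A \<Longrightarrow> pcb \<Omega> (g i)"
    and "\<And>j t x. j < m \<Longrightarrow> \<tau> j < t \<Longrightarrow> t < \<tau> (Suc j) \<Longrightarrow> x \<in> mesh_interior M \<Longrightarrow> u t x = (\<Sum>i\<in>A. poly (Q i j) t *\<^sub>R f i x)"
    and "\<And>j t x. j < m \<Longrightarrow> \<tau> j < t \<Longrightarrow> t < \<tau> (Suc j) \<Longrightarrow> x \<in> mesh_interior M \<Longrightarrow> v t x = (\<Sum>i\<in>A. poly (R i j) t *\<^sub>R g i x)"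
  shows "vol_form {a<..b} \<Omega> u v = gram \<tau> m A (\<lambda>i l. LINT x:\<Omega>|lebesgue. f i x \<bullet> g l x) Q R"
  unfolding vol_form_def ends[symmetric]
  by (intro set_LINT_gram nodes LINT_separated assms)

lemma face_form_gram:
  assumes "\<And>S f j t x. (S, f) \<in> faces \<Longrightarrow> j < m \<Longrightarrow> \<tau> j < t \<Longrightarrow> t < \<tau> (Suc j) \<Longrightarrow> x \<in> f \<Longrightarrow>
      u S t x = (\<Sum>i\<in>A. poly (Q i j) t *\<^sub>R \<alpha> S i x)"
    and "\<And>S f j t x. (S, f) \<in> faces \<Longrightarrow> j < m \<Longrightarrow> \<tau> j < t \<Longrightarrow> t < \<tau> (Suc j) \<Longrightarrow> x \<in> f \<Longrightarrow>
      v S t x = (\<Sum>i\<in>A. poly (R i j) t *\<^sub>R \<beta> S i x)"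
    and "\<And>S f i l. (S, f) \<in> faces \<Longrightarrow> i \<in> A \<Longrightarrow> l \<in> A \<Longrightarrow> set_integrable surface_measure f (\<lambda>x. \<alpha> S i x \<bullet> \<beta> S l x)"
  shows "face_form {a<..b} faces u v
    = gram \<tau> m A (\<lambda>i l. \<Sum>(S, f)\<in>faces. LINT x:f|surface_measure. \<alpha> S i x \<bullet> \<beta> S l x) Q R"
  unfolding face_form_def ends[symmetric]
proof (intro set_LINT_gram nodes)
  fix j t assume jt: "j < m" "\<tau> j < t" "t < \<tau> (Suc j)"
  have "(\<Sum>(S, f)\<in>faces. LINT x:f|surface_measure. u S t x \<bullet> v S t x)
      = (\<Sum>(S, f)\<in>faces. \<Sum>i\<in>A. \<Sum>l\<in>A. (LINT x:f|surface_measure. \<alpha> S i x \<bullet> \<beta> S l x) * (poly (Q i j) t * poly (R l j) t))"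
  proof (intro sum.cong refl, clarify)
    fix S f assume f: "(S, f) \<in> faces"
    have "(LINT x:f|surface_measure. u S t x \<bullet> v S t x)
        = (LINT x:f|surface_measure. (\<Sum>i\<in>A. poly (Q i j) t *\<^sub>R \<alpha> S i x) \<bullet> (\<Sum>i\<in>A. poly (R i j) t *\<^sub>R \<beta> S i x))"
      using assms(1,2)[OF f jt] by (intro set_lebesgue_integral_cong) (auto simp: borel_closed faces_props(4)[OF f])
    also have "\<dots> = (\<Sum>i\<in>A. \<Sum>l\<in>A. (LINT x:f|surface_measure. \<alpha> S i x \<bullet> \<beta> S l x) * (poly (Q i j) t * poly (R l j) t))"
      by (intro set_integral_separated assms(3)[OF f])
    finally show "(LINT x:f|surface_measure. u S t x \<bullet> v S t x)
        = (\<Sum>i\<in>A. \<Sum>l\<in>A. (LINT x:f|surface_measure. \<alpha> S i x \<bullet> \<beta> S l x) * (poly (Q i j) t * poly (R l j) t))" .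
  qed
  also have "\<dots> = (\<Sum>i\<in>A. \<Sum>l\<in>A. (\<Sum>(S, f)\<in>faces. LINT x:f|surface_measure. \<alpha> S i x \<bullet> \<beta> S l x) * (poly (Q i j) t * poly (R l j) t))"
    unfolding case_prod_beta sum_distrib_right
    by (subst sum.swap, intro sum.cong refl, rule sum.swap)
  finally show "(\<Sum>(S, f)\<in>faces. LINT x:f|surface_measure. u S t x \<bullet> v S t x)
    = (\<Sum>i\<in>A. \<Sum>l\<in>A. (\<Sum>(S, f)\<in>faces. LINT x:f|surface_measure. \<alpha> S i x \<bullet> \<beta> S l x) * (poly (Q i j) t * poly (R l j) t))" .
qed

abbreviation mass :: "('i \<Rightarrow> real^3 \<Rightarrow> real^3) \<Rightarrow> 'i \<Rightarrow> 'i \<Rightarrow> real" where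
  "mass f \<equiv> \<lambda>i l. LINT x:\<Omega>|lebesgue. f i x \<bullet> f l x"

abbreviation weighted_mass :: "(real^3 \<Rightarrow> real) \<Rightarrow> ('i \<Rightarrow> real^3 \<Rightarrow> real^3) \<Rightarrow> 'i \<Rightarrow> 'i \<Rightarrow> real" where
  "weighted_mass \<kappa> f \<equiv> \<lambda>i l. LINT x:\<Omega>|lebesgue. (\<kappa> x *\<^sub>R f i x) \<bullet> f l x"

text \<open>\<open>qform A C c\<close> is twice the energy of the pair of fields with coefficients
  \<open>c\<close>.\<close>

definition C where "C i l = weighted_mass \<epsilon> \<Phi> i l + weighted_mass \<mu> \<Psi> i l"

lemma C_sym: "C i l = C l i"
  unfolding C_def by (simp add: inner_commute)

lemma sep_piece: "j < m \<Longrightarrow> \<tau> j < t \<Longrightarrow> t \<le> \<tau> (Suc j) \<Longrightarrow> sep \<tau> m A R f t x = (\<Sum>i\<in>A. poly (R i j) t *\<^sub>R f i x)"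
  unfolding sep_def by (simp add: pw_piece)

text \<open>The derivative at \<open>t\<close> needs the expansion on a neighbourhood of
  \<open>t\<close>, hence the open piece.\<close>

lemma dt_piece:
  assumes u: "\<And>t x. a < t \<Longrightarrow> t \<le> b \<Longrightarrow> x \<in> mesh_interior M \<Longrightarrow> u t x = sep \<tau> m A P f t x"
    and j: "j < m" "\<tau> j < t" "t < \<tau> (Suc j)" and x: "x \<in> mesh_interior M"
  shows "dt_h u t x = (\<Sum>i\<in>A. poly (pderiv (P i j)) t *\<^sub>R f i x)"
  unfolding dt_h_def
proof (rule vector_derivative_at)
  have "((\<lambda>s. \<Sum>i\<in>A. poly (P i j) s *\<^sub>R f i x) has_vector_derivative (\<Sum>i\<in>A. poly (pderiv (P i j)) t *\<^sub>R f i x)) (at t)"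
    by (intro has_vector_derivative_sum has_vector_derivative_scaleR[where g' = 0, simplified] poly_DERIV)
      (auto intro!: derivative_eq_intros)
  then show "((\<lambda>s. u s x) has_vector_derivative (\<Sum>i\<in>A. poly (pderiv (P i j)) t *\<^sub>R f i x)) (at t)"
  proof (rule has_vector_derivative_transform_within_open[where S = "{\<tau> j<..<\<tau> (Suc j)}"])
    fix s assume "s \<in> {\<tau> j<..<\<tau> (Suc j)}"
    then have s: "\<tau> j < s" "s \<le> \<tau> (Suc j)" by auto
    show "(\<Sum>i\<in>A. poly (P i j) s *\<^sub>R f i x) = u s x"
      using u[OF _ _ x, of s] piece_in[OF j(1) s] sep_piece[OF j(1) s] by simp
  qed (use j in auto)
qed

lemma curl_piece:
  assumes f: "\<And>i. i \<in> A \<Longrightarrow> f i \<in> Xh M" and u: "\<And>x. x \<in> mesh_interior M \<Longrightarrow> u t x = (\<Sum>i\<in>A. c i *\<^sub>R f i x)"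
    and x: "x \<in> mesh_interior M"
  shows "curl_h u t x = (\<Sum>i\<in>A. c i *\<^sub>R curl (f i) x)"
proof -
  have "((\<lambda>x. \<Sum>i\<in>A. c i *\<^sub>R f i x) has_derivative (\<lambda>h. \<Sum>i\<in>A. c i *\<^sub>R frechet_derivative (f i) (at x) h)) (at x)"
    by (intro has_derivative_sum has_derivative_scaleR_right frechet_derivative_has_derivative Xh_differentiable f x)
  then have "(u t has_derivative (\<lambda>h. \<Sum>i\<in>A. c i *\<^sub>R frechet_derivative (f i) (at x) h)) (at x)"
    by (rule has_derivative_transform_within_open[OF _ open_mesh_interior x]) (simp add: u)
  from frechet_derivative_at[OF this, symmetric]
  have "jacobian (u t) (at x) $ i $ j = (\<Sum>k\<in>A. c k *\<^sub>R jacobian (f k) (at x) $ i $ j)" for i j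
    by (simp add: jacobian_def matrix_def)
  then show ?thesis
    unfolding curl_h_def curl_def Let_def vector_3_eq
    by (simp add: vec_eq_iff forall_3 axis_def sum_subtractf algebra_simps)
qed

lemma solution_piece:
  assumes "j < m" "\<tau> j < t" "t < \<tau> (Suc j)" "x \<in> mesh_interior M"
  shows "E t x = (\<Sum>i\<in>A. poly (P i j) t *\<^sub>R \<Phi> i x)" "H t x = (\<Sum>i\<in>A. poly (P i j) t *\<^sub>R \<Psi> i x)"
  using assms E H piece_in[of j t] sep_piece[of j t] by auto

text \<open>Only time integration links the two fields, and \<open>test \<theta>\<close> is symmetric in time:
  the curl terms cancel against each other, and so do the face terms.\<close>

lemma C_h_test:
  assumes \<theta>: "degree \<theta> \<le> 1"
  shows "C_h {a<..b} \<Omega> M \<epsilon> \<mu> (E, H) (sep \<tau> m A (test \<theta>) \<Phi>, sep \<tau> m A (test \<theta>) \<Psi>)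
    = gram \<tau> m A C (\<lambda>i j. pderiv (P i j)) (test \<theta>)"
proof -
  let ?R = "test \<theta>"
  let ?v = "sep \<tau> m A ?R \<Phi>" and ?w = "sep \<tau> m A ?R \<Psi>"
  let ?c = "\<lambda>i l. LINT x:\<Omega>|lebesgue. curl (\<Phi> i) x \<bullet> \<Psi> l x"
  let ?d = "\<lambda>i l. \<Sum>(S, f)\<in>faces. LINT x:f|surface_measure. jump M S (\<Phi> i) x \<bullet> average M S (\<Psi> l) x"
  have sym: "gram \<tau> m A c P ?R = gram \<tau> m A c ?R P" for c
    unfolding gram_def by (simp add: tint_test_sym[OF \<theta>] cong: sum.cong)
  note pcbs = Xh_pcb[OF \<Phi>] Xh_pcb[OF \<Psi>] Xh_curl_pcb[OF \<Phi>] Xh_curl_pcb[OF \<Psi>]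
  have 1: "vol_form {a<..b} \<Omega> (\<lambda>t x. \<epsilon> x *\<^sub>R dt_h E t x) ?v = gram \<tau> m A (weighted_mass \<epsilon> \<Phi>) (\<lambda>i j. pderiv (P i j)) ?R"
    by (rule vol_form_gram) (auto intro: pcb_scaleR \<epsilon> pcbs simp: dt_piece[OF E] sep_piece scaleR_sum_right mult.commute)
  have 2: "vol_form {a<..b} \<Omega> (\<lambda>t x. \<mu> x *\<^sub>R dt_h H t x) ?w = gram \<tau> m A (weighted_mass \<mu> \<Psi>) (\<lambda>i j. pderiv (P i j)) ?R"
    by (rule vol_form_gram) (auto intro: pcb_scaleR \<mu> pcbs simp: dt_piece[OF H] sep_piece scaleR_sum_right mult.commute)
  have 3: "vol_form {a<..b} \<Omega> H (curl_h ?v) = gram \<tau> m A (\<lambda>i l. LINT x:\<Omega>|lebesgue. \<Psi> i x \<bullet> curl (\<Phi> l) x) P ?R"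
    by (rule vol_form_gram) (auto intro: pcbs simp: solution_piece intro!: curl_piece \<Phi> sep_piece)
  have 4: "vol_form {a<..b} \<Omega> (curl_h E) ?w = gram \<tau> m A ?c P ?R"
    by (rule vol_form_gram) (auto intro: pcbs simp: sep_piece intro!: curl_piece \<Phi> solution_piece)
  \<comment> \<open>The matrix of the first term is the transpose of \<open>?c\<close>; exchanging
    the time factors by \<open>sym\<close> undoes the transposition.\<close>
  have 34: "vol_form {a<..b} \<Omega> H (curl_h ?v) = vol_form {a<..b} \<Omega> (curl_h E) ?w"
    unfolding 3 4 gram_swap[of \<tau> m A ?c]
    by (simp add: sym inner_commute)
  have 5: "face_form {a<..b} faces (\<lambda>S t. average M S (H t)) (\<lambda>S t. jump M S (?v t))
      = gram \<tau> m A (\<lambda>i l. \<Sum>(S, f)\<in>faces. LINT x:f|surface_measure. average M S (\<Psi> i) x \<bullet> jump M S (\<Phi> l) x) P ?R"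
    by (rule face_form_gram)
      (auto intro!: average_expansion jump_expansion face_integrable \<Phi> \<Psi> sep_piece solution_piece)
  have 6: "face_form {a<..b} faces (\<lambda>S t. jump M S (E t)) (\<lambda>S t. average M S (?w t))
      = gram \<tau> m A ?d P ?R"
    by (rule face_form_gram)
      (auto intro!: average_expansion jump_expansion face_integrable[unfolded inner_commute[of "average _ _ _ _"]] \<Phi> \<Psi> sep_piece solution_piece)
  have 56: "face_form {a<..b} faces (\<lambda>S t. average M S (H t)) (\<lambda>S t. jump M S (?v t))
      = face_form {a<..b} faces (\<lambda>S t. jump M S (E t)) (\<lambda>S t. average M S (?w t))"
    unfolding 5 6 gram_swap[of \<tau> m A ?d]
    by (simp add: sym inner_commute)
  have "gram \<tau> m A C (\<lambda>i j. pderiv (P i j)) ?R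
      = gram \<tau> m A (weighted_mass \<epsilon> \<Phi>) (\<lambda>i j. pderiv (P i j)) ?R + gram \<tau> m A (weighted_mass \<mu> \<Psi>) (\<lambda>i j. pderiv (P i j)) ?R"
    unfolding gram_def C_def by (simp add: distrib_right sum.distrib)
  then show ?thesis
    unfolding C_h_def using 1 2 34 56 by (simp add: faces_def)
qed

end

section \<open>The energy estimate on one slab\<close>

lemma set_nonneg_integral_zero_negligible:
  fixes f :: "'a::euclidean_space \<Rightarrow> real"
  assumes "set_integrable lebesgue S f" "\<And>t. t \<in> S \<Longrightarrow> 0 \<le> f t" "(LINT t:S|lebesgue. f t) = 0"
  shows "negligible {t \<in> S. f t \<noteq> 0}"
proof -
  have "AE t in lebesgue. indicator S t *\<^sub>R f t = 0"
    using assms integral_nonneg_eq_0_iff_AE[of lebesgue "\<lambda>t. indicator S t *\<^sub>R f t"]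
    unfolding set_integrable_def set_lebesgue_integral_def by (auto simp: indicator_def)
  then have "negligible {t. indicator S t *\<^sub>R f t \<noteq> 0}"
    by (simp add: negligible_iff_null_sets completion.AE_iff_null_sets)
  moreover have "{t. indicator S t *\<^sub>R f t \<noteq> 0} = {t \<in> S. f t \<noteq> 0}"
    by (auto simp: indicator_def)
  ultimately show ?thesis by simp
qed

lemma set_integral_zero_AE:
  fixes f :: "'x \<Rightarrow> real"
  shows "(AE t in N. t \<in> S \<longrightarrow> f t = 0) \<Longrightarrow> (LINT t:S|N. f t) = 0"
  unfolding set_lebesgue_integral_def
  by (rule integral_eq_zero_AE) (auto simp: indicator_def)

lemma LINT_nonneg: "(\<And>x. x \<in> S \<Longrightarrow> 0 \<le> f x) \<Longrightarrow> 0 \<le> (LINT x:S|N. f x :: real)"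
  unfolding set_lebesgue_integral_def by (rule integral_nonneg_AE) (auto simp: indicator_def)

context slab_solution
begin

abbreviation L2 :: "field3 \<Rightarrow> real" where
  "L2 \<equiv> L2_norm {a<..b} \<Omega>"

lemma sep_borel: "(\<And>i. i \<in> A \<Longrightarrow> f i \<in> Xh M) \<Longrightarrow> (\<lambda>(t, x). sep \<tau> m A R f t x) \<in> borel_measurable borel"
proof -
  assume f: "\<And>i. i \<in> A \<Longrightarrow> f i \<in> Xh M"
  have "(\<lambda>z. \<Sum>i\<in>A. pw \<tau> m (R i) (fst z) *\<^sub>R f i (snd z)) \<in> borel_measurable (borel :: (real \<times> (real^3)) measure)"
    by (intro borel_measurable_sum borel_measurable_scaleR measurable_compose[OF _ pw_borel]
        measurable_compose[OF _ Xh_borel[OF f]] borel_measurable_continuous_onI continuous_on_fst continuous_on_snd continuous_on_id)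
  then show ?thesis by (simp add: case_prod_beta sep_def)
qed

lemma sep_bounded:
  assumes f: "\<And>i. i \<in> A \<Longrightarrow> f i \<in> Xh M"
  shows "\<exists>B. \<forall>t x. norm (sep \<tau> m A R f t x) \<le> B"
proof -
  have "\<exists>B. \<forall>i\<in>A. (\<forall>x. norm (f i x) \<le> B i)"
    by (rule bchoice) (use Xh_bounded[OF f] in blast)
  then obtain B where B: "\<And>i x. i \<in> A \<Longrightarrow> norm (f i x) \<le> B i" by blast
  have "\<exists>D. \<forall>i. (\<forall>t. \<bar>pw \<tau> m (R i) t\<bar> \<le> D i)"
    by (rule choice) (use pw_bounded in blast)
  then obtain D where D: "\<And>i t. \<bar>pw \<tau> m (R i) t\<bar> \<le> D i" by blast
  have "norm (sep \<tau> m A R f t x) \<le> (\<Sum>i\<in>A. D i * B i)" for t x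
    unfolding sep_def
  proof (rule sum_norm_le)
    fix i assume "i \<in> A"
    then show "norm (pw \<tau> m (R i) t *\<^sub>R f i x) \<le> D i * B i"
      using B[of i x] D[of i t] abs_ge_zero[of "pw \<tau> m (R i) t"]
        norm_ge_zero[of "f i x"]
      unfolding norm_scaleR real_norm_def by (intro mult_mono) auto
  qed
  then show ?thesis by blast
qed

lemma sep_in_W_h:
  assumes f: "\<And>i. i \<in> A \<Longrightarrow> f i \<in> Xh M" and R: "\<And>i j. i \<in> A \<Longrightarrow> j < m \<Longrightarrow> degree (R i j) < p"
  shows "sep \<tau> m A R f \<in> W_h {a<..b} \<Omega> M"
  unfolding W_h_def
proof (intro CollectI conjI ballI)
  let ?u = "\<lambda>(t, x). sep \<tau> m A R f t x"
  let ?D = "{a<..b} \<times> \<Omega>"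
  have D: "?D \<in> sets borel"
    by (intro borel_Times) (auto simp: open_\<Omega> borel_open)
  have u: "?u \<in> borel_measurable borel" by (rule sep_borel[OF f])
  have leb: "g \<in> borel_measurable lebesgue" if "g \<in> borel_measurable borel"
    for g :: "real \<times> (real^3) \<Rightarrow> 'z::euclidean_space"
    using that by (intro measurable_completion) simp
  obtain B where B: "\<And>t x. norm (sep \<tau> m A R f t x) \<le> B" using sep_bounded[of f R] f by blast
  show "L2_L2 {a<..b} \<Omega> (sep \<tau> m A R f)"
    unfolding L2_L2_def L2_on_def
  proof
    show "set_borel_measurable lebesgue ?D ?u"
      unfolding set_borel_measurable_def using D u
      by (intro leb borel_measurable_scaleR borel_measurable_indicator)
    have "bounded ?D" by (intro bounded_Times bounded_\<Omega>) (rule bounded_subset[OF bounded_closed_interval[of a b]], auto)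
    then have "emeasure lebesgue ?D < \<infinity>"
      using emeasure_bounded_finite[of ?D] D by simp
    then show "set_integrable lebesgue ?D (\<lambda>z. (norm (?u z))\<^sup>2)"
      unfolding set_integrable_def
    proof (rule integrableI_bounded_set_indicator[rotated 2])
      show "?D \<in> sets lebesgue" using D by simp
      show "(\<lambda>z. (norm (?u z))\<^sup>2) \<in> borel_measurable lebesgue"
        by (intro leb borel_measurable_power measurable_compose[OF u borel_measurable_norm])
      show "AE z in lebesgue. z \<in> ?D \<longrightarrow> norm ((norm (?u z))\<^sup>2) \<le> B\<^sup>2"
        using B by (intro AE_I2) (auto intro!: power_mono)
    qed
  qed
next
  fix K assume K: "K \<in> elems M"
  have "\<exists>q. \<forall>i\<in>A. q i \<in> Q3_space (xdeg M K) (ydeg M K) (zdeg M K) \<and>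
      (\<forall>\<xi>\<in>interior ref_cube. transpose (DF M K \<xi>) *v f i (emap M K \<xi>) = q i \<xi>)"
    by (rule bchoice) (use f K in \<open>auto simp: Xh_def Bex_def\<close>)
  then obtain q where q: "\<And>i. i \<in> A \<Longrightarrow> q i \<in> Q3_space (xdeg M K) (ydeg M K) (zdeg M K)"
    "\<And>i \<xi>. i \<in> A \<Longrightarrow> \<xi> \<in> interior ref_cube \<Longrightarrow> transpose (DF M K \<xi>) *v f i (emap M K \<xi>) = q i \<xi>"
    by blast
  \<comment> \<open>\<open>tensor\<close> sums over an initial segment of the naturals, so
    \<open>A\<close> is renumbered.\<close>
  obtain e where e: "bij_betw e {..<card A} A"
    using ex_bij_betw_nat_finite[OF finite_A] by (auto simp: atLeast0LessThan)
  then have eA: "e k \<in> A" if "k < card A" for k using that by (auto simp: bij_betw_def)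
  show "pullback_in {a<..b} M K (T_space {a<..b} M K) (sep \<tau> m A R f)"
    unfolding pullback_in_def
  proof (intro bexI ballI)
    show "(\<lambda>t \<xi>. \<Sum>k<card A. pw \<tau> m (R (e k)) t *\<^sub>R q (e k) \<xi>)
        \<in> tensor (T_space {a<..b} M K) (Q3_space (xdeg M K) (ydeg M K) (zdeg M K))"
      unfolding tensor_def using T[OF K R] q(1) eA
      by (intro CollectI exI[of _ "card A"] exI[of _ "\<lambda>k. pw \<tau> m (R (e k))"] exI[of _ "\<lambda>k. q (e k)"]) auto
    fix t \<xi> assume \<xi>: "\<xi> \<in> interior ref_cube"
    have "transpose (DF M K \<xi>) *v sep \<tau> m A R f t (emap M K \<xi>)
        = (\<Sum>i\<in>A. pw \<tau> m (R i) t *\<^sub>R (transpose (DF M K \<xi>) *v f i (emap M K \<xi>)))"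
      unfolding sep_def by (simp add: linear_sum[OF matrix_vector_mul_linear] matrix_vector_mult_scaleR)
    also have "\<dots> = (\<Sum>i\<in>A. pw \<tau> m (R i) t *\<^sub>R q i \<xi>)"
      using q(2) \<xi> by (intro sum.cong) auto
    also have "\<dots> = (\<Sum>k<card A. pw \<tau> m (R (e k)) t *\<^sub>R q (e k) \<xi>)"
      by (rule sum.reindex_bij_betw[OF e, symmetric])
    finally show "transpose (DF M K \<xi>) *v sep \<tau> m A R f t (emap M K \<xi>)
      = (\<Sum>k<card A. pw \<tau> m (R (e k)) t *\<^sub>R q (e k) \<xi>)" .
  qed
qed

section \<open>Mass matrices and the norms they represent\<close>

lemma qform_LINT:
  fixes \<kappa> :: "real^3 \<Rightarrow> real"
  assumes "pcb \<Omega> \<kappa>" and f: "\<And>i. i \<in> A \<Longrightarrow> f i \<in> Xh M"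
  shows "qform A (weighted_mass \<kappa> f) c
    = (LINT x:\<Omega>|lebesgue. \<kappa> x * (norm (\<Sum>i\<in>A. c i *\<^sub>R f i x))\<^sup>2)"
proof -
  have "(LINT x:\<Omega>|lebesgue. (\<Sum>i\<in>A. c i *\<^sub>R (\<kappa> x *\<^sub>R f i x)) \<bullet> (\<Sum>i\<in>A. c i *\<^sub>R f i x))
      = (\<Sum>i\<in>A. \<Sum>l\<in>A. (LINT x:\<Omega>|lebesgue. (\<kappa> x *\<^sub>R f i x) \<bullet> f l x) * (c i * c l))"
    using assms Xh_pcb by (intro LINT_separated pcb_scaleR) auto
  moreover have "(\<Sum>i\<in>A. c i *\<^sub>R (\<kappa> x *\<^sub>R f i x)) \<bullet> (\<Sum>i\<in>A. c i *\<^sub>R f i x)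
      = \<kappa> x * (norm (\<Sum>i\<in>A. c i *\<^sub>R f i x))\<^sup>2" for x
  proof -
    have "(\<Sum>i\<in>A. c i *\<^sub>R (\<kappa> x *\<^sub>R f i x)) = \<kappa> x *\<^sub>R (\<Sum>i\<in>A. c i *\<^sub>R f i x)"
      unfolding scaleR_sum_right by (simp add: mult.commute)
    then show ?thesis by (simp add: power2_norm_eq_inner)
  qed
  ultimately show ?thesis unfolding qform_def by simp
qed

lemma pcb_energy:
  assumes "pcb \<Omega> \<kappa>" "\<And>i. i \<in> A \<Longrightarrow> f i \<in> Xh M"
  shows "pcb \<Omega> (\<lambda>x. \<kappa> x * (norm (\<Sum>i\<in>A. c i *\<^sub>R f i x))\<^sup>2)"
  using pcb_scaleR[OF assms(1) pcb_inner[OF pcb_combination pcb_combination, of f f c c]] Xh_pcb[OF assms(2)]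
  by (simp add: power2_norm_eq_inner)

lemma qform_weight_ge:
  assumes "pcb \<Omega> \<kappa>" "\<And>i. i \<in> A \<Longrightarrow> f i \<in> Xh M" "\<And>x. x \<in> \<Omega> \<Longrightarrow> k \<le> \<kappa> x"
  shows "k * qform A (mass f) c
    \<le> qform A (weighted_mass \<kappa> f) c"
proof -
  have one: "qform A (mass f) c
      = (LINT x:\<Omega>|lebesgue. 1 * (norm (\<Sum>i\<in>A. c i *\<^sub>R f i x))\<^sup>2)"
    using qform_LINT[OF pcb_const[OF open_\<Omega>, of 1], of f c] assms(2) by simp
  have "k * qform A (mass f) c
      = (LINT x:\<Omega>|lebesgue. k * (norm (\<Sum>i\<in>A. c i *\<^sub>R f i x))\<^sup>2)"
    unfolding one by simp
  also have "\<dots> \<le> (LINT x:\<Omega>|lebesgue. \<kappa> x * (norm (\<Sum>i\<in>A. c i *\<^sub>R f i x))\<^sup>2)"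
    using assms by (intro set_integral_mono pcb_absolutely_integrable pcb_energy open_\<Omega> bounded_\<Omega> pcb_const)
      (auto intro: mult_right_mono)
  also have "\<dots> = qform A (weighted_mass \<kappa> f) c"
    by (rule qform_LINT[symmetric]) (use assms in auto)
  finally show ?thesis .
qed

lemma psd_mass:
  assumes "\<And>i. i \<in> A \<Longrightarrow> f i \<in> Xh M"
  shows "psd A (mass f)"
proof -
  have "0 \<le> (LINT x:\<Omega>|lebesgue. 1 * (norm (\<Sum>i\<in>A. c i *\<^sub>R f i x))\<^sup>2)" for c
    by (rule LINT_nonneg) simp
  then show ?thesis
    using qform_LINT[OF pcb_const[OF open_\<Omega>, of 1], of f] assms unfolding psd_def by simp
qed

lemma qform_lower: "\<epsilon>0 * qform A (mass \<Phi>) c + \<mu>0 * qform A (mass \<Psi>) c \<le> qform A C c"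
proof -
  have "qform A C c = qform A (weighted_mass \<epsilon> \<Phi>) c + qform A (weighted_mass \<mu> \<Psi>) c"
    unfolding qform_def C_def by (simp add: distrib_right sum.distrib)
  then show ?thesis
    using qform_weight_ge[OF \<epsilon> \<Phi> \<epsilon>0(2)] qform_weight_ge[OF \<mu> \<Psi> \<mu>0(2)]
    by (simp add: add_mono)
qed

lemma psd_E: "psd A (mass \<Phi>)" and psd_H: "psd A (mass \<Psi>)"
  by (intro psd_mass \<Phi> \<Psi>; assumption)+

lemma psd_C: "psd A C"
  unfolding psd_def
proof
  fix c
  have "0 \<le> \<epsilon>0 * qform A (mass \<Phi>) c + \<mu>0 * qform A (mass \<Psi>) c"
    using psd_E psd_H \<epsilon>0(1) \<mu>0(1) by (simp add: psd_def)
  then show "0 \<le> qform A C c" using qform_lower[of c] by linarith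
qed

text \<open>The difference \<open>D\<close> of the matrices is positive semidefinite by
  \<open>qform_lower\<close>, so its Gram sum is nonnegative for any time factors.\<close>

lemma gram_lower: "\<epsilon>0 * gram \<tau> m A (mass \<Phi>) R R + \<mu>0 * gram \<tau> m A (mass \<Psi>) R R \<le> gram \<tau> m A C R R"
proof -
  define D where "D i l = C i l - (\<epsilon>0 * mass \<Phi> i l + \<mu>0 * mass \<Psi> i l)" for i l
  have "qform A D c = qform A C c - (\<epsilon>0 * qform A (mass \<Phi>) c + \<mu>0 * qform A (mass \<Psi>) c)" for c
    unfolding qform_def D_def by (simp add: algebra_simps sum.distrib sum_subtractf sum_distrib_left)
  then have psd: "psd A D" using qform_lower by (simp add: psd_def)
  have "0 \<le> gram \<tau> m A D R R"
    unfolding gram_eq_sum_pint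
  proof (rule sum_nonneg)
    fix j
    show "0 \<le> (\<Sum>i\<in>A. \<Sum>l\<in>A. D i l * pint (\<tau> j) (\<tau> (Suc j)) (R i j * R l j))"
      \<comment> \<open>Nonnegativity is the comparison of the constant weights 0 and 1.\<close>
      using pint_psd_mono[OF psd, of "\<tau> j" "\<tau> (Suc j)" 0 1 "\<lambda>i. R i j"] by simp
  qed
  moreover have "gram \<tau> m A D R R = gram \<tau> m A C R R - (\<epsilon>0 * gram \<tau> m A (mass \<Phi>) R R + \<mu>0 * gram \<tau> m A (mass \<Psi>) R R)"
    unfolding gram_def D_def by (simp add: algebra_simps sum.distrib sum_subtractf sum_distrib_left)
  ultimately show ?thesis by linarith
qed

lemma L2_norm_sep:
  assumes "\<And>i. i \<in> A \<Longrightarrow> f i \<in> Xh M"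
  shows "(L2 (sep \<tau> m A R f))\<^sup>2 = gram \<tau> m A (mass f) R R"
proof -
  have "(LINT t:{a<..b}|lebesgue. LINT x:\<Omega>|lebesgue. (norm (sep \<tau> m A R f t x))\<^sup>2)
      = gram \<tau> m A (mass f) R R" (is "?L = _")
    using vol_form_gram[of f f "sep \<tau> m A R f" R "sep \<tau> m A R f" R] Xh_pcb[OF assms] sep_piece
    by (simp add: vol_form_def power2_norm_eq_inner)
  moreover have "0 \<le> ?L"
    by (intro LINT_nonneg) simp
  ultimately show ?thesis unfolding L2_norm_def by simp
qed

text \<open>A test field of norm zero vanishes at almost every time on all open elements, by continuity,
  and hence has zero traces.\<close>

lemma sep_norm_zero:
  assumes f: "\<And>i. i \<in> A \<Longrightarrow> f i \<in> Xh M" and 0: "L2 (sep \<tau> m A R f) = 0"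
  shows "AE t in lebesgue. t \<in> {a<..b} \<longrightarrow> (\<forall>x\<in>mesh_interior M. sep \<tau> m A R f t x = 0)"
proof -
  define h where "h t = (LINT x:\<Omega>|lebesgue. (norm (sep \<tau> m A R f t x))\<^sup>2)" for t
  have "h absolutely_integrable_on {\<tau> 0<..\<tau> m}"
  proof (rule set_LINT_gram(2))
    show "\<tau> j < \<tau> (Suc j)" if "j < m" for j using nodes[OF that] .
    fix j t assume "j < m" "\<tau> j < t" "t < \<tau> (Suc j)"
    then show "h t = (\<Sum>i\<in>A. \<Sum>l\<in>A. mass f i l * (poly (R i j) t * poly (R l j) t))"
      unfolding h_def power2_norm_eq_inner using Xh_pcb[OF f] sep_piece by (intro LINT_separated) auto
  qed
  then have int: "set_integrable lebesgue {a<..b} h" by (simp add: ends)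
  have "(LINT t:{a<..b}|lebesgue. h t) = 0"
    using 0 unfolding L2_norm_def h_def by simp
  moreover have "0 \<le> h t" for t
    unfolding h_def by (intro LINT_nonneg) simp
  ultimately have "negligible {t \<in> {a<..b}. h t \<noteq> 0}"
    by (intro set_nonneg_integral_zero_negligible int)
  then have "AE t in lebesgue. t \<notin> {t \<in> {a<..b}. h t \<noteq> 0}"
    by (intro AE_not_in) (simp add: negligible_iff_null_sets)
  moreover have "sep \<tau> m A R f t x = 0" if h: "h t = 0" and x: "x \<in> mesh_interior M" for t x
  proof -
    let ?u = "sep \<tau> m A R f t"
    have u: "continuous_on (mesh_interior M) ?u" "pcb \<Omega> ?u"
      using f Xh_continuous_bounded Xh_pcb unfolding sep_def
      by (auto intro!: continuous_on_sum continuous_on_scaleR continuous_on_const pcb_combination)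
    have "negligible {x \<in> \<Omega>. (norm (?u x))\<^sup>2 \<noteq> 0}"
    proof (rule set_nonneg_integral_zero_negligible)
      show "set_integrable lebesgue \<Omega> (\<lambda>x. (norm (?u x))\<^sup>2)"
        unfolding power2_norm_eq_inner by (intro pcb_absolutely_integrable pcb_inner u open_\<Omega> bounded_\<Omega>)
    qed (use h in \<open>auto simp: h_def\<close>)
    then have "negligible (mesh_interior M \<inter> ?u -` (- {0}))"
      by (rule negligible_subset) (use mesh_interior_subset in auto)
    moreover have "open (mesh_interior M \<inter> ?u -` (- {0}))"
      by (rule continuous_open_preimage[OF u(1) open_mesh_interior]) auto
    ultimately have "mesh_interior M \<inter> ?u -` (- {0}) = {}"
      using open_not_negligible by blast
    then show ?thesis using x by auto
  qed
  ultimately show ?thesis by auto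
qed

text \<open>The supremum in \<open>dual_norm\<close> runs over fields of nonzero norm only; the case
  of norm zero enters through the last hypothesis.\<close>

lemma dual_bound:
  assumes v: "v \<in> W_h {a<..b} \<Omega> M" and D: "dual_norm {a<..b} \<Omega> M l = ennreal D" "0 \<le> D"
    and 0: "L2 v = 0 \<Longrightarrow> l v = 0"
  shows "l v \<le> D * L2 v"
proof (cases "L2 v = 0")
  case False
  have "L2 v \<ge> 0"
    unfolding L2_norm_def by (intro real_sqrt_ge_zero LINT_nonneg) simp
  with False have pos: "L2 v > 0" by simp
  have "ennreal (\<bar>l v\<bar> / L2 v) \<le> ennreal D"
    unfolding D(1)[symmetric] dual_norm_def by (rule SUP_upper) (use v False in auto)
  then have "\<bar>l v\<bar> / L2 v \<le> D" using D(2) by simp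
  then show ?thesis using pos by (simp add: divide_le_eq)
qed (use 0 in simp)

lemma ell_E_bound:
  assumes "\<And>i j. i \<in> A \<Longrightarrow> j < m \<Longrightarrow> degree (R i j) < p"
    and "dual_norm {a<..b} \<Omega> M (ell_E {a<..b} \<Omega> J) = ennreal D" "0 \<le> D"
  shows "ell_E {a<..b} \<Omega> J (sep \<tau> m A R \<Phi>) \<le> D * L2 (sep \<tau> m A R \<Phi>)"
proof (rule dual_bound[OF sep_in_W_h[OF \<Phi> assms(1)] assms(2,3)])
  assume "L2 (sep \<tau> m A R \<Phi>) = 0"
  then have "AE t in lebesgue. t \<in> {a<..b} \<longrightarrow> (\<forall>x\<in>mesh_interior M. sep \<tau> m A R \<Phi> t x = 0)"
    using sep_norm_zero[of \<Phi> R] \<Phi> by blast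
  then have "AE t in lebesgue. t \<in> {a<..b} \<longrightarrow> (LINT x:\<Omega>|lebesgue. J t x \<bullet> sep \<tau> m A R \<Phi> t x) = 0"
  proof (rule AE_mp, intro AE_I2 impI)
    fix t assume "t \<in> {a<..b} \<longrightarrow> (\<forall>x\<in>mesh_interior M. sep \<tau> m A R \<Phi> t x = 0)" "t \<in> {a<..b}"
    then have "(LINT x:\<Omega>|lebesgue. J t x \<bullet> sep \<tau> m A R \<Phi> t x) = (LINT x:\<Omega>|lebesgue. 0)"
      by (intro pcb_LINT_mesh pcb_const open_\<Omega>) simp
    then show "(LINT x:\<Omega>|lebesgue. J t x \<bullet> sep \<tau> m A R \<Phi> t x) = 0" by simp
  qed
  then show "ell_E {a<..b} \<Omega> J (sep \<tau> m A R \<Phi>) = 0"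
    unfolding ell_E_def vol_form_def by (rule set_integral_zero_AE)
qed

lemma ell_H_bound:
  assumes "\<And>i j. i \<in> A \<Longrightarrow> j < m \<Longrightarrow> degree (R i j) < p"
    and "dual_norm {a<..b} \<Omega> M (ell_H {a<..b} \<Omega> M g) = ennreal D" "0 \<le> D"
  shows "ell_H {a<..b} \<Omega> M g (sep \<tau> m A R \<Psi>) \<le> D * L2 (sep \<tau> m A R \<Psi>)"
proof (rule dual_bound[OF sep_in_W_h[OF \<Psi> assms(1)] assms(2,3)])
  assume 0: "L2 (sep \<tau> m A R \<Psi>) = 0"
  let ?w = "sep \<tau> m A R \<Psi>"
  let ?h = "\<lambda>t S f. LINT x:f|surface_measure. (\<Sum>K\<in>S. cross3 (outward_normal M K x) (g t x)) \<bullet> average M S (?w t) x"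
  have "AE t in lebesgue. t \<in> {a<..b} \<longrightarrow> (\<forall>x\<in>mesh_interior M. ?w t x = 0)"
    using sep_norm_zero[of \<Psi> R] \<Psi> 0 by blast
  then have "AE t in lebesgue. t \<in> {a<..b} \<longrightarrow> (\<Sum>(S, f)\<in>boundary_faces \<Omega> M. ?h t S f) = 0"
  proof (rule AE_mp, intro AE_I2 impI)
    fix t assume w: "t \<in> {a<..b} \<longrightarrow> (\<forall>x\<in>mesh_interior M. ?w t x = 0)" "t \<in> {a<..b}"
    have "?h t S f = 0" if f: "(S, f) \<in> boundary_faces \<Omega> M" for S f
    proof (rule set_integral_zero_AE, intro AE_I2 impI)
      fix x assume x: "x \<in> f"
      \<comment> \<open>A field vanishing on the open elements has the expansion over the empty
        index set, so its average is an empty sum.\<close>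
      have "average M S (?w t) x = (\<Sum>i\<in>{}. 0 *\<^sub>R average M S (\<Psi> i) x)"
        using f w x by (intro average_expansion[where f = f]) (auto simp: faces_def)
      then show "(\<Sum>K\<in>S. cross3 (outward_normal M K x) (g t x)) \<bullet> average M S (?w t) x = 0" by simp
    qed
    then show "(\<Sum>(S, f)\<in>boundary_faces \<Omega> M. ?h t S f) = 0" by (intro sum.neutral) auto
  qed
  then show "ell_H {a<..b} \<Omega> M g ?w = 0"
    unfolding ell_H_def face_form_def by (simp add: set_integral_zero_AE)
qed

subsection \<open>Energies\<close>

text \<open>\<open>G\<close> stands for the open elements at the end of the slab, and for the points
  where the inherited value equals the limit from the right at its start.\<close>

lemma energy_integral:
  assumes "\<And>x. x \<in> G \<Longrightarrow> x \<in> \<Omega> \<Longrightarrow> u x = (\<Sum>i\<in>A. c i *\<^sub>R \<Phi> i x)"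
    and "\<And>x. x \<in> G \<Longrightarrow> x \<in> \<Omega> \<Longrightarrow> w x = (\<Sum>i\<in>A. c i *\<^sub>R \<Psi> i x)"
    and "negligible (\<Omega> - G)"
  shows "(LINT x:\<Omega>|lebesgue. \<epsilon> x * (u x \<bullet> u x) + \<mu> x * (w x \<bullet> w x)) = qform A C c"
proof -
  let ?e = "\<lambda>x. \<epsilon> x * (norm (\<Sum>i\<in>A. c i *\<^sub>R \<Phi> i x))\<^sup>2" and ?h = "\<lambda>x. \<mu> x * (norm (\<Sum>i\<in>A. c i *\<^sub>R \<Psi> i x))\<^sup>2"
  have p: "pcb \<Omega> ?e" "pcb \<Omega> ?h"
    using pcb_energy[OF \<epsilon>, of \<Phi> c] pcb_energy[OF \<mu>, of \<Psi> c] \<Phi> \<Psi> by blast+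
  have "(LINT x:\<Omega>|lebesgue. \<epsilon> x * (u x \<bullet> u x) + \<mu> x * (w x \<bullet> w x)) = (LINT x:\<Omega>|lebesgue. ?e x + ?h x)"
    using assms by (intro pcb_LINT_cong[where G = G] pcb_add p open_\<Omega> bounded_\<Omega>) (auto simp: power2_norm_eq_inner)
  also have "\<dots> = (LINT x:\<Omega>|lebesgue. ?e x) + (LINT x:\<Omega>|lebesgue. ?h x)"
    by (intro set_integral_add pcb_absolutely_integrable p open_\<Omega> bounded_\<Omega>)
  also have "\<dots> = qform A (weighted_mass \<epsilon> \<Phi>) c + qform A (weighted_mass \<mu> \<Psi>) c"
    using qform_LINT[OF \<epsilon>, of \<Phi> c] qform_LINT[OF \<mu>, of \<Psi> c] \<Phi> \<Psi>
    by simp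
  also have "\<dots> = qform A C c"
    unfolding qform_def C_def by (simp add: distrib_right sum.distrib)
  finally show ?thesis .
qed

lemma energy_end: "energy \<Omega> \<epsilon> \<mu> E H b = 1 / 2 * qform A C right"
proof -
  have j: "m - 1 < m" "\<tau> (m - 1) < b" "b \<le> \<tau> (Suc (m - 1))" "Suc (m - 1) = m"
    using m nodes[of "m - 1"] ends by auto
  have "sep \<tau> m A P f b x = (\<Sum>i\<in>A. right i *\<^sub>R f i x)" for f :: "'i \<Rightarrow> real^3 \<Rightarrow> real^3" and x
    unfolding sep_piece[OF j(1-3)] right_def ends ..
  then show ?thesis
    unfolding energy_def
    by (subst energy_integral[of "mesh_interior M" _ right]) (use E H ab negligible_skeleton in auto)
qed

text \<open>Supplies the regularity of the initial value on the next slab, whose mesh may be a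
  different one.\<close>

lemma pcb_end: "pcb \<Omega> (E b)" "pcb \<Omega> (H b)"
proof -
  have *: "pcb \<Omega> (sep \<tau> m A P f b)" if "\<And>i. i \<in> A \<Longrightarrow> f i \<in> Xh M" for f
    unfolding sep_def[abs_def] using that by (intro pcb_combination Xh_pcb)
  have "pcb \<Omega> (sep \<tau> m A P \<Phi> b)" by (rule *) (rule \<Phi>)
  then show "pcb \<Omega> (E b)"
    by (rule pcb_cong[OF _ open_mesh_interior negligible_skeleton]) (use E[of b] ab in auto)
  have "pcb \<Omega> (sep \<tau> m A P \<Psi> b)" by (rule *) (rule \<Psi>)
  then show "pcb \<Omega> (H b)"
    by (rule pcb_cong[OF _ open_mesh_interior negligible_skeleton]) (use H[of b] ab in auto)
qed

text \<open>\<open>u a\<close> is the value inherited at the start, while \<open>U\<close> continues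
  the first polynomial piece down to \<open>a\<close>. Their distance is estimated through an
  intermediate time \<open>t\<close>, and both contributions vanish as \<open>t\<close> decreases to
  \<open>a\<close>.\<close>

lemma continues_at_left:
  assumes f: "\<And>i. i \<in> A \<Longrightarrow> f i \<in> Xh M" and u: "\<And>t x. a < t \<Longrightarrow> t \<le> b \<Longrightarrow> x \<in> mesh_interior M \<Longrightarrow> u t x = sep \<tau> m A P f t x"
    and c: "continues_at \<Omega> u a" and e: "pcb \<Omega> (u a)"
  shows "negligible {x \<in> \<Omega>. u a x \<noteq> (\<Sum>i\<in>A. left i *\<^sub>R f i x)}"
proof -
  define s where "s t i = poly (P i 0) t" for t i
  define U where "U t x = (\<Sum>i\<in>A. s t i *\<^sub>R f i x)" for t x
  have U: "pcb \<Omega> (U t)" for t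
    unfolding U_def[abs_def] using f by (intro pcb_combination Xh_pcb)
  have sq: "pcb \<Omega> (\<lambda>x. (norm (g x))\<^sup>2)" if "pcb \<Omega> g" for g :: "real^3 \<Rightarrow> real^3"
    unfolding power2_norm_eq_inner by (intro pcb_inner that)
  define n where "n g = (LINT x:\<Omega>|lebesgue. (norm (g x))\<^sup>2)" for g :: "real^3 \<Rightarrow> real^3"
  have a0: "U a x = (\<Sum>i\<in>A. left i *\<^sub>R f i x)" for x
    unfolding U_def s_def left_def ends ..
  \<comment> \<open>This is the squared norm of \<open>U t - U a\<close>; written as a quadratic
    form it tends to 0 through its coefficients.\<close>
  define q where "q t = qform A (mass f) (\<lambda>i. s t i - s a i)" for t
  have bound: "n (\<lambda>x. U a x - u a x) \<le> 2 * n (\<lambda>x. u t x - u a x) + 2 * q t"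
    if t: "a < t" "t \<le> \<tau> 1" for t
  proof -
    have "n (\<lambda>x. U t x - U a x) = q t"
      using qform_LINT[OF pcb_const[OF open_\<Omega>, of 1], of f "\<lambda>i. s t i - s a i"] f
      by (simp add: q_def n_def U_def scaleR_left_diff_distrib sum_subtractf)
    moreover have "n (\<lambda>x. u t x - u a x) = n (\<lambda>x. U t x - u a x)"
      unfolding n_def
    proof (intro pcb_LINT_mesh sq pcb_diff U e)
      fix x assume x: "x \<in> mesh_interior M"
      have "u t x = U t x"
        using u[OF t(1) _ x] piece_in[of 0 t] sep_piece[of 0 t] t m ends by (simp add: U_def s_def)
      then show "(norm (u t x - u a x))\<^sup>2 = (norm (U t x - u a x))\<^sup>2" by simp
    qed
    moreover have "n (\<lambda>x. U a x - u a x) \<le> 2 * n (\<lambda>x. U t x - u a x) + 2 * n (\<lambda>x. U t x - U a x)"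
    proof -
      have "n (\<lambda>x. U a x - u a x) \<le> (LINT x:\<Omega>|lebesgue. 2 * (norm (U t x - u a x))\<^sup>2 + 2 * (norm (U t x - U a x))\<^sup>2)"
        unfolding n_def
      proof (intro set_integral_mono pcb_absolutely_integrable pcb_add sq pcb_diff U e open_\<Omega> bounded_\<Omega>
          pcb_cmult)
        fix x
        have "norm (U a x - u a x) \<le> norm (U t x - u a x) + norm (U t x - U a x)"
          using norm_triangle_ineq4[of "U t x - u a x" "U t x - U a x"] by simp
        then have "(norm (U a x - u a x))\<^sup>2 \<le> (norm (U t x - u a x) + norm (U t x - U a x))\<^sup>2"
          by (intro power_mono) auto
        also have "\<dots> \<le> 2 * (norm (U t x - u a x))\<^sup>2 + 2 * (norm (U t x - U a x))\<^sup>2"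
          using zero_le_power2[of "norm (U t x - u a x) - norm (U t x - U a x)"]
          by (simp add: power2_eq_square algebra_simps)
        finally show "(norm (U a x - u a x))\<^sup>2 \<le> 2 * (norm (U t x - u a x))\<^sup>2 + 2 * (norm (U t x - U a x))\<^sup>2" .
      qed
      also have "\<dots> = 2 * n (\<lambda>x. U t x - u a x) + 2 * n (\<lambda>x. U t x - U a x)"
        unfolding n_def
        by (subst set_integral_add) (auto intro!: pcb_absolutely_integrable sq pcb_diff U e open_\<Omega> bounded_\<Omega>)
      finally show ?thesis .
    qed
    ultimately show ?thesis by simp
  qed
  have lim: "((\<lambda>t. 2 * n (\<lambda>x. u t x - u a x) + 2 * q t) \<longlongrightarrow> 0) (at_right a)"
  proof -
    have "((\<lambda>t. s t i - s a i) \<longlongrightarrow> s a i - s a i) (at_right a)" for i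
      unfolding s_def by (intro tendsto_diff tendsto_const) (auto intro!: tendsto_poly tendsto_ident_at)
    then have "(q \<longlongrightarrow> q a) (at_right a)"
      unfolding q_def qform_def by (intro tendsto_sum tendsto_mult tendsto_const)
    moreover have "((\<lambda>t. n (\<lambda>x. u t x - u a x)) \<longlongrightarrow> 0) (at_right a)"
      using c unfolding continues_at_def n_def .
    ultimately have "((\<lambda>t. 2 * n (\<lambda>x. u t x - u a x) + 2 * q t)
        \<longlongrightarrow> 2 * 0 + 2 * q a) (at_right a)"
      by (intro tendsto_add tendsto_mult tendsto_const)
    then show ?thesis by (simp add: q_def qform_def)
  qed
  have "n (\<lambda>x. U a x - u a x) \<le> 0"
  proof (rule tendsto_lowerbound[OF lim])
    have "a < \<tau> 1" using nodes[of 0] m ends by simp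
    then have "\<forall>\<^sub>F t in at_right a. t \<in> {a<..<\<tau> 1}"
      by (rule eventually_at_right_real)
    then show "\<forall>\<^sub>F t in at_right a. n (\<lambda>x. U a x - u a x) \<le> 2 * n (\<lambda>x. u t x - u a x)
        + 2 * q t"
      by (rule eventually_mono) (rule bound, auto)
  qed simp
  moreover have "0 \<le> n (\<lambda>x. U a x - u a x)"
    unfolding n_def by (intro LINT_nonneg) simp
  ultimately have "negligible {x \<in> \<Omega>. (norm (U a x - u a x))\<^sup>2 \<noteq> 0}"
    by (intro set_nonneg_integral_zero_negligible pcb_absolutely_integrable sq pcb_diff U e open_\<Omega> bounded_\<Omega>)
      (auto simp: n_def)
  then show ?thesis
    by (rule negligible_subset) (auto simp: a0)
qed

lemma energy_start:
  assumes "continues_at \<Omega> E a" "continues_at \<Omega> H a" "pcb \<Omega> (E a)" "pcb \<Omega> (H a)"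
  shows "energy \<Omega> \<epsilon> \<mu> E H a = 1 / 2 * qform A C left"
proof -
  let ?G = "{x. E a x = (\<Sum>i\<in>A. left i *\<^sub>R \<Phi> i x) \<and> H a x = (\<Sum>i\<in>A. left i *\<^sub>R \<Psi> i x)}"
  have "negligible (\<Omega> - ?G)"
    by (rule negligible_subset[OF negligible_Un[OF continues_at_left[of \<Phi> E] continues_at_left[of \<Psi> H]]])
      (use \<Phi> \<Psi> E H assms in auto)
  then show ?thesis
    unfolding energy_def by (subst energy_integral[of ?G _ left]) auto
qed

text \<open>Cauchy-Schwarz in the plane after scaling by \<open>sqrt k\<close> and
  \<open>sqrt l\<close>. Here the lower bounds of the material coefficients become the denominators
  of the squared dual norms.\<close>

lemma weighted_cauchy_schwarz:
  fixes x y d e k l z :: real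
  assumes "0 < k" "0 < l" "k * x\<^sup>2 + l * y\<^sup>2 \<le> z\<^sup>2" "0 \<le> z"
  shows "d * x + e * y \<le> sqrt (d\<^sup>2 / k + e\<^sup>2 / l) * z"
proof -
  have cs: "p * r + q * s \<le> sqrt (p\<^sup>2 + q\<^sup>2) * sqrt (r\<^sup>2 + s\<^sup>2)" for p q r s :: real
    using Cauchy_Schwarz_ineq2[of "(p, q)" "(r, s)"] by (simp add: norm_Pair)
  have "d * x + e * y = (d / sqrt k) * (sqrt k * x) + (e / sqrt l) * (sqrt l * y)"
    using assms by simp
  also have "\<dots> \<le> sqrt ((d / sqrt k)\<^sup>2 + (e / sqrt l)\<^sup>2) * sqrt ((sqrt k * x)\<^sup>2 + (sqrt l * y)\<^sup>2)"
    by (rule cs)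
  also have "\<dots> \<le> sqrt (d\<^sup>2 / k + e\<^sup>2 / l) * z"
    using assms by (intro mult_mono real_le_lsqrt) (auto simp: power_divide power_mult_distrib)
  finally show ?thesis .
qed

lemma slab_step:
  assumes sol: "\<And>v w. v \<in> W_h {a<..b} \<Omega> M \<Longrightarrow> w \<in> W_h {a<..b} \<Omega> M \<Longrightarrow>
      C_h {a<..b} \<Omega> M \<epsilon> \<mu> (E, H) (v, w) = ell_E {a<..b} \<Omega> J v + ell_H {a<..b} \<Omega> M g w"
    and De: "dual_norm {a<..b} \<Omega> M (ell_E {a<..b} \<Omega> J) = ennreal De" "0 \<le> De"
    and Dm: "dual_norm {a<..b} \<Omega> M (ell_H {a<..b} \<Omega> M g) = ennreal Dm" "0 \<le> Dm"
    and start: "continues_at \<Omega> E a" "continues_at \<Omega> H a" "pcb \<Omega> (E a)" "pcb \<Omega> (H a)"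
  defines "D \<equiv> sqrt (De\<^sup>2 / \<epsilon>0 + Dm\<^sup>2 / \<mu>0)"
  shows "\<exists>X\<ge>0. energy \<Omega> \<epsilon> \<mu> E H b - energy \<Omega> \<epsilon> \<mu> E H a \<le> D * X \<and>
    X\<^sup>2 \<le> 2 * (b - a) * energy \<Omega> \<epsilon> \<mu> E H a + 2 * (b - a) * D * X"
proof -
  have D0: "D \<ge> 0" unfolding D_def using \<epsilon>0(1) \<mu>0(1) by simp
  have gram_nonneg: "0 \<le> gram \<tau> m A C R R" for R
  proof -
    have "0 \<le> \<epsilon>0 * gram \<tau> m A (mass \<Phi>) R R" "0 \<le> \<mu>0 * gram \<tau> m A (mass \<Psi>) R R"
      using L2_norm_sep[of \<Phi> R] L2_norm_sep[of \<Psi> R] \<Phi> \<Psi> \<epsilon>0(1) \<mu>0(1)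
      by (auto simp flip: L2_norm_sep)
    then show ?thesis using gram_lower[of R] by linarith
  qed
  \<comment> \<open>The tested equation, the dual norms and weighted Cauchy-Schwarz, for any weight
    of degree at most 1; the weights used are 1 and \<open>\<rho>\<close>.\<close>
  have key: "gram \<tau> m A C (\<lambda>i j. pderiv (P i j)) (test \<theta>) \<le> D * sqrt (gram \<tau> m A C (test \<theta>) (test \<theta>))"
    if \<theta>: "degree \<theta> \<le> 1" for \<theta>
  proof -
    note deg = degree_test[OF \<theta>]
    let ?v = "sep \<tau> m A (test \<theta>) \<Phi>" and ?w = "sep \<tau> m A (test \<theta>) \<Psi>"
    have "?v \<in> W_h {a<..b} \<Omega> M" "?w \<in> W_h {a<..b} \<Omega> M"
      using sep_in_W_h[of \<Phi> "test \<theta>"] sep_in_W_h[of \<Psi> "test \<theta>"] \<Phi> \<Psi> deg by auto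
    from sol[OF this] have "gram \<tau> m A C (\<lambda>i j. pderiv (P i j)) (test \<theta>) = ell_E {a<..b} \<Omega> J ?v + ell_H {a<..b} \<Omega> M g ?w"
      using C_h_test[OF \<theta>] by simp
    also have "\<dots> \<le> De * L2 ?v + Dm * L2 ?w"
      using ell_E_bound[OF deg De] ell_H_bound[OF deg Dm] by (intro add_mono) auto
    also have "\<dots> \<le> D * sqrt (gram \<tau> m A C (test \<theta>) (test \<theta>))"
      unfolding D_def using gram_lower[of "test \<theta>"] gram_nonneg[of "test \<theta>"]
        L2_norm_sep[of \<Phi> "test \<theta>"] L2_norm_sep[of \<Psi> "test \<theta>"] \<Phi> \<Psi>
      by (intro weighted_cauchy_schwarz \<epsilon>0(1) \<mu>0(1)) auto
    finally show ?thesis .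
  qed
  define X where "X = sqrt (gram \<tau> m A C (test 1) (test 1))"
  have X: "X \<ge> 0" "X\<^sup>2 = gram \<tau> m A C (test 1) (test 1)"
    unfolding X_def using gram_nonneg by auto
  have 1: "1 / 2 * (qform A C right - qform A C left) \<le> D * X"
    using key[of 1] gram_pderiv_test_1[of C] C_sym by (simp add: X_def)
  \<comment> \<open>Brings the norm of the second test function back to \<open>X\<close>, at the
    price of one slab length.\<close>
  have "sqrt (gram \<tau> m A C (test \<rho>) (test \<rho>)) \<le> (b - a) * X"
  proof (rule real_le_lsqrt)
    show "gram \<tau> m A C (test \<rho>) (test \<rho>) \<le> ((b - a) * X)\<^sup>2"
      using gram_test_weight_le[OF psd_C] by (simp add: power_mult_distrib X(2) ends)
  qed (use ab X in auto)
  then have "D * sqrt (gram \<tau> m A C (test \<rho>) (test \<rho>)) \<le> D * ((b - a) * X)"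
    using D0 by (rule mult_left_mono)
  moreover have "1 / 2 * X\<^sup>2 - 1 / 2 * (b - a) * qform A C left \<le> D * sqrt (gram \<tau> m A C (test \<rho>) (test \<rho>))"
    using gram_pderiv_test_weight[OF C_sym psd_C] key[of \<rho>] by (simp add: X(2) ends)
  ultimately have 2: "1 / 2 * X\<^sup>2 - 1 / 2 * (b - a) * qform A C left \<le> D * ((b - a) * X)"
    by linarith
  have "2 * (b - a) * (1 / 2 * qform A C left) + 2 * (b - a) * D * X
      = 2 * (1 / 2 * (b - a) * qform A C left) + 2 * (D * ((b - a) * X))"
    by (simp add: field_simps)
  then have "X\<^sup>2 \<le> 2 * (b - a) * (1 / 2 * qform A C left) + 2 * (b - a) * D * X"
    using 2 by linarith
  then show ?thesis
    unfolding energy_end energy_start[OF start] using X(1) 1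
    by (intro exI[of _ X] conjI) (simp_all add: right_diff_distrib)
qed

end

section \<open>Representation of discrete solutions\<close>

context slab_grid
begin

lemma mesh_time:
  assumes "K \<in> elems M"
  shows "tpart M K 0 = a" "tpart M K (nsub M K) = b"
    and "j < nsub M K \<Longrightarrow> tpart M K j < tpart M K (Suc j)"
    and "j < nsub M K \<Longrightarrow> 1 \<le> tdeg M K j"
  using slab_mesh assms unfolding slab_mesh_def by auto

lemma tpart_mono: "K \<in> elems M \<Longrightarrow> i \<le> j \<Longrightarrow> j \<le> nsub M K \<Longrightarrow> tpart M K i \<le> tpart M K j"
  by (rule increasing_le) (rule mesh_time(3))

text \<open>The right end of the piece is the first node not below \<open>t\<close>; it is not node
  0 because \<open>a < t\<close>.\<close>

lemma subint_cover:
  assumes "K \<in> elems M" "a < t" "t \<le> b"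
  shows "\<exists>j<nsub M K. t \<in> subint M K j"
proof -
  let ?n = "LEAST n. t \<le> tpart M K n"
  have ex: "t \<le> tpart M K (nsub M K)" using assms mesh_time(2) by simp
  have le: "t \<le> tpart M K ?n" by (rule LeastI[of _ "nsub M K"]) (rule ex)
  have n: "?n \<le> nsub M K" by (rule Least_le) (rule ex)
  have "?n \<noteq> 0" using le assms mesh_time(1) by (metis not_less)
  then obtain j where j: "?n = Suc j" using not0_implies_Suc by blast
  then have "\<not> t \<le> tpart M K j" by (intro not_less_Least) simp
  then show ?thesis using le n j by (intro exI[of _ j]) (auto simp: subint_def)
qed

end

lemma L2_on_interval:
  assumes "u \<in> borel_measurable borel" "\<And>t. \<bar>u t\<bar> \<le> B"
  shows "L2_on {a<..b} (u :: real \<Rightarrow> real)"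
  unfolding L2_on_def
proof
  have leb: "g \<in> borel_measurable lebesgue" if "g \<in> borel_measurable borel" for g :: "real \<Rightarrow> real"
    using that by (intro measurable_completion) simp
  show "set_borel_measurable lebesgue {a<..b} u"
    unfolding set_borel_measurable_def
    by (intro borel_measurable_scaleR borel_measurable_indicator leb assms) auto
  show "set_integrable lebesgue {a<..b} (\<lambda>t. (norm (u t))\<^sup>2)"
    unfolding set_integrable_def
  proof (rule integrableI_bounded_set_indicator)
    show "(\<lambda>t. (norm (u t))\<^sup>2) \<in> borel_measurable lebesgue"
      by (intro leb borel_measurable_power measurable_compose[OF assms(1) borel_measurable_norm])
    show "AE t in lebesgue. t \<in> {a<..b} \<longrightarrow> norm ((norm (u t))\<^sup>2) \<le> B\<^sup>2"
    proof (intro AE_I2 impI)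
      fix t
      have "(norm (u t))\<^sup>2 \<le> B\<^sup>2" by (rule power_mono) (use assms(2) in auto)
      then show "norm ((norm (u t))\<^sup>2) \<le> B\<^sup>2" by simp
    qed
    show "emeasure lebesgue {a<..b} < \<infinity>"
      by (cases "a \<le> b") auto
  qed auto
qed

locale uniform_slab = slab_grid +
  fixes p :: nat
  assumes degree: "\<And>K j. K \<in> elems M \<Longrightarrow> j < nsub M K \<Longrightarrow> tdeg M K j = p"
    and T_eq: "\<And>K K'. K \<in> elems M \<Longrightarrow> K' \<in> elems M \<Longrightarrow> T_space {a<..b} M K = T_space {a<..b} M K'"
    and ab: "a < b"
begin

text \<open>The indicator of \<open>(a, tpart M K i]\<close> is a temporal test function of \<open>K\<close>, hence of \<open>K0\<close>,
  so the break points of \<open>K\<close> are break points of \<open>K0\<close>.\<close>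

lemma subint_refines:
  assumes K0: "K0 \<in> elems M" and K: "K \<in> elems M" and j: "j < nsub M K0"
  shows "\<exists>i<nsub M K. subint M K0 j \<subseteq> subint M K i"
proof -
  define c d where "c = tpart M K0 j" and "d = tpart M K0 (Suc j)"
  have cd: "c < d" "a \<le> c" "d \<le> b"
    using mesh_time[OF K0] tpart_mono[OF K0, of 0 j] tpart_mono[OF K0, of "Suc j" "nsub M K0"] j
    by (auto simp: c_def d_def)
  obtain i where i: "i < nsub M K" "d \<in> subint M K i"
    using subint_cover[OF K, of d] cd by auto
  define e where "e = tpart M K i"
  have "e \<le> c"
  proof (rule ccontr)
    assume "\<not> e \<le> c"
    then have e: "c < e" "e < d" using i(2) by (auto simp: subint_def e_def)
    define u where "u t = (if t \<le> e then 1 else 0 :: real)" for t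
    have "u \<in> T_space {a<..b} M K"
      unfolding T_space_def
    proof (intro CollectI conjI allI impI)
      have "u = indicator {..e}" by (auto simp: u_def fun_eq_iff indicator_def)
      then show "L2_on {a<..b} u" by (intro L2_on_interval[where B = 1]) auto
      fix k assume k: "k < nsub M K"
      show "u \<in> P_on (tdeg M K k - 1) (subint M K k)"
      proof (cases "k < i")
        case True
        then have "tpart M K (Suc k) \<le> e" using tpart_mono[OF K, of "Suc k" i] i(1) by (simp add: e_def)
        then show ?thesis unfolding P_on_def by (intro CollectI exI[of _ 1]) (auto simp: u_def subint_def)
      next
        case False
        then have "e \<le> tpart M K k" using tpart_mono[OF K, of i k] k by (simp add: e_def)
        then show ?thesis unfolding P_on_def by (intro CollectI exI[of _ 0]) (auto simp: u_def subint_def)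
      qed
    qed
    then have "u \<in> T_space {a<..b} M K0" using T_eq[OF K K0] by simp
    then obtain q where q: "\<And>t. t \<in> {c<..d} \<Longrightarrow> u t = poly q t"
      using j unfolding T_space_def P_on_def subint_def c_def d_def by blast
    \<comment> \<open>Vanishing on an interval forces \<open>q = 0\<close>, but \<open>e\<close>
      itself still has the value 1.\<close>
    have "{e<..d} \<subseteq> {t. poly q t = 0}"
    proof
      fix t assume "t \<in> {e<..d}"
      then show "t \<in> {t. poly q t = 0}" using q[of t] e by (simp add: u_def)
    qed
    moreover have "infinite {e<..d}" using e by (simp add: infinite_Ioc)
    ultimately have "q = 0" using poly_roots_finite finite_subset by blast
    moreover have "poly q e = 1" using q[of e] e by (simp add: u_def)
    ultimately show False by simp
  qed
  then show ?thesis using i by (intro exI[of _ i]) (auto simp: subint_def c_def d_def e_def)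
qed

lemma nsub_pos: "K \<in> elems M \<Longrightarrow> 1 \<le> nsub M K"
  using mesh_time(1,2)[of K] ab by (cases "nsub M K") auto

lemma degree_pos: "K \<in> elems M \<Longrightarrow> 1 \<le> p"
  using mesh_time(4)[of K 0] degree[of K 0] nsub_pos[of K] by simp

text \<open>Membership is clear for \<open>K0\<close>, whose partition is used, and passes to
  \<open>K\<close> because the temporal test spaces coincide.\<close>

lemma pw_in_T_space:
  assumes K0: "K0 \<in> elems M" and K: "K \<in> elems M" and R: "\<And>j. j < nsub M K0 \<Longrightarrow> degree (R j) < p"
  shows "pw (tpart M K0) (nsub M K0) R \<in> T_space {a<..b} M K"
proof -
  obtain B where "\<And>t. \<bar>pw (tpart M K0) (nsub M K0) R t\<bar> \<le> B" using pw_bounded by blast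
  then have "L2_on {a<..b} (pw (tpart M K0) (nsub M K0) R)"
    by (intro L2_on_interval pw_borel)
  moreover have "pw (tpart M K0) (nsub M K0) R \<in> P_on (tdeg M K0 j - 1) (subint M K0 j)" if j: "j < nsub M K0" for j
    unfolding P_on_def degree[OF K0 j]
  proof (intro CollectI exI[of _ "R j"] conjI ballI)
    show "degree (R j) \<le> p - 1" using R[OF j] by simp
    show "pw (tpart M K0) (nsub M K0) R t = poly (R j) t" if "t \<in> subint M K0 j" for t
      using that j by (intro pw_eq mesh_time(3)[OF K0]) (auto simp: subint_def)
  qed
  ultimately have "pw (tpart M K0) (nsub M K0) R \<in> T_space {a<..b} M K0"
    unfolding T_space_def by blast
  then show ?thesis using T_eq[OF K0 K] by simp
qed

section \<open>Expansion of discrete fields on a common time partition\<close>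

definition continuous_pieces :: "'a \<Rightarrow> (nat \<Rightarrow> real poly) \<Rightarrow> bool" where
  "continuous_pieces K P \<longleftrightarrow> (\<forall>j<nsub M K. degree (P j) \<le> p) \<and>
    (\<forall>j. Suc j < nsub M K \<longrightarrow> poly (P j) (tpart M K (Suc j)) = poly (P (Suc j)) (tpart M K (Suc j)))"

text \<open>Each piece of \<open>K0\<close> lies in a piece of \<open>K\<close>, so the polynomials
  of \<open>s\<close> restrict to the partition of \<open>K0\<close>. They match at the nodes
  because members of \<open>H1_on\<close> are continuous representatives.\<close>

lemma S_space_pieces:
  assumes K0: "K0 \<in> elems M" and K: "K \<in> elems M" and s: "s \<in> S_space {a<..b} M K"
  shows "\<exists>P. continuous_pieces K0 P \<and> (\<forall>t. a < t \<longrightarrow> t \<le> b \<longrightarrow> s t = pw (tpart M K0) (nsub M K0) P t)"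
proof -
  let ?\<tau> = "tpart M K0" and ?m = "nsub M K0"
  have "\<exists>q. degree q \<le> p \<and> (\<forall>t\<in>subint M K0 j. s t = poly q t)" if j: "j < ?m" for j
  proof -
    obtain i where i: "i < nsub M K" "subint M K0 j \<subseteq> subint M K i"
      using subint_refines[OF K0 K j] by blast
    then have "s \<in> P_on p (subint M K i)"
      using s degree[OF K i(1)] unfolding S_space_def by auto
    then show ?thesis using i(2) unfolding P_on_def by blast
  qed
  then have "\<forall>j\<in>{..<?m}. \<exists>q. degree q \<le> p \<and> (\<forall>t\<in>subint M K0 j. s t = poly q t)" by blast
  from bchoice[OF this] obtain P where P: "\<And>j. j < ?m \<Longrightarrow> degree (P j) \<le> p"
    "\<And>j t. j < ?m \<Longrightarrow> t \<in> subint M K0 j \<Longrightarrow> s t = poly (P j) t"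
    by auto
  have "s t = pw ?\<tau> ?m P t" if t: "a < t" "t \<le> b" for t
  proof -
    obtain j where j: "j < ?m" "t \<in> subint M K0 j" using subint_cover[OF K0 t] by blast
    have "pw ?\<tau> ?m P t = poly (P j) t"
      using j by (intro pw_eq mesh_time(3)[OF K0]) (auto simp: subint_def)
    then show ?thesis using P(2)[OF j] by simp
  qed
  moreover have "poly (P j) (?\<tau> (Suc j)) = poly (P (Suc j)) (?\<tau> (Suc j))" if j: "Suc j < ?m" for j
  proof -
    let ?c = "?\<tau> (Suc j)" and ?d = "?\<tau> (Suc (Suc j))"
    have cd: "?\<tau> j < ?c" "?c < ?d" using mesh_time(3)[OF K0] j by auto
    have I: "a \<le> ?\<tau> j" "?d \<le> b"
      using tpart_mono[OF K0, of 0 j] tpart_mono[OF K0, of "Suc (Suc j)" ?m] mesh_time(1,2)[OF K0] j by auto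
    \<comment> \<open>The node belongs to the left piece; the right piece reaches it only as a limit
      from the right.\<close>
    have "continuous_on {a<..b} s" using s unfolding S_space_def H1_on_def by blast
    then have "(s \<longlongrightarrow> s ?c) (at ?c within {a<..b})"
      using cd I unfolding continuous_on_def by auto
    then have "(s \<longlongrightarrow> s ?c) (at ?c within {?c<..?d})"
      by (rule tendsto_within_subset) (use cd I in auto)
    then have 1: "(poly (P (Suc j)) \<longlongrightarrow> s ?c) (at ?c within {?c<..?d})"
      by (rule Lim_transform_within[where d = 1]) (use P(2)[OF j] in \<open>auto simp: subint_def\<close>)
    have 2: "(poly (P (Suc j)) \<longlongrightarrow> poly (P (Suc j)) ?c) (at ?c within {?c<..?d})"
      by (intro tendsto_poly tendsto_ident_at)
    have "?c \<in> closure {?c<..?d}"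
      using cd(2) by simp
    then have "at ?c within {?c<..?d} \<noteq> bot"
      by (simp add: trivial_limit_within closure_def)
    then have "s ?c = poly (P (Suc j)) ?c" using 1 2 tendsto_unique by blast
    moreover have "s ?c = poly (P j) ?c" using P(2)[of j ?c] j cd by (simp add: subint_def)
    ultimately show ?thesis by simp
  qed
  ultimately show ?thesis using P(1) unfolding continuous_pieces_def by blast
qed

lemma zero_in_Q3: "(\<lambda>\<xi>. 0) \<in> Q3_space px py pz"
  unfolding Q3_space_def Q_space_def by (auto intro!: exI[of _ "\<lambda>i j l. 0"])

lemma zero_in_Xh: "(\<lambda>x. 0) \<in> Xh M"
  unfolding Xh_def using zero_in_Q3 by fastforce

text \<open>The inverse of the covariant pullback on one element, extended by 0. Since element
  interiors are disjoint, the pullback to any other element is the zero polynomial.\<close>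

lemma push_forward:
  assumes K: "K \<in> elems M" and q: "q \<in> Q3_space (xdeg M K) (ydeg M K) (zdeg M K)"
  shows "\<exists>\<Phi>\<in>Xh M. (\<forall>\<xi>\<in>box 0 1. \<Phi> (emap M K \<xi>) = matrix_inv (transpose (DF M K \<xi>)) *v q \<xi>) \<and>
    (\<forall>x. x \<notin> interior (cell M K) \<longrightarrow> \<Phi> x = 0)"
proof -
  interpret hexahedron "emap M K" "chart K" by (rule hexahedron[OF K])
  define \<Phi> where "\<Phi> x = (if x \<in> interior (cell M K)
    then matrix_inv (transpose (DF M K (Finv x))) *v q (Finv x) else 0)" for x
  have eq: "\<Phi> (emap M K \<xi>) = matrix_inv (transpose (DF M K \<xi>)) *v q \<xi>" if "\<xi> \<in> box 0 1" for \<xi>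
  proof -
    have "\<xi> \<in> ref_cube" using that box_subset_cbox by blast
    moreover have "emap M K \<xi> \<in> interior (cell M K)" using that interior_cell[OF K] by simp
    ultimately show ?thesis by (simp add: \<Phi>_def)
  qed
  have "\<Phi> \<in> Xh M"
    unfolding Xh_def
  proof (intro CollectI conjI allI impI ballI)
    show "\<Phi> x = 0" if "x \<notin> mesh_interior M" for x
      using that K by (auto simp: \<Phi>_def mesh_interior_def)
    fix K' assume K': "K' \<in> elems M"
    show "\<exists>q\<in>Q3_space (xdeg M K') (ydeg M K') (zdeg M K'). \<forall>\<xi>\<in>interior ref_cube.
        transpose (DF M K' \<xi>) *v \<Phi> (emap M K' \<xi>) = q \<xi>"
    proof (cases "K' = K")
      case True
      have "transpose (DF M K \<xi>) *v \<Phi> (emap M K \<xi>) = q \<xi>" if "\<xi> \<in> box 0 1" for \<xi>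
      proof -
        have "\<xi> \<in> ref_cube" using that box_subset_cbox by blast
        then have "invertible (transpose (DF M K \<xi>))"
          using det_Jac_nz[of \<xi>] by (simp add: DF_def invertible_det_nz det_transpose)
        then show ?thesis
          unfolding eq[OF that] by (simp add: matrix_vector_mul_assoc matrix_inv(1))
      qed
      then show ?thesis using True q by auto
    next
      case False
      have "\<Phi> (emap M K' \<xi>) = 0" if "\<xi> \<in> box 0 1" for \<xi>
      proof -
        have "emap M K' \<xi> \<in> interior (cell M K')" using that interior_cell[OF K'] by simp
        moreover have "interior (cell M K') \<inter> interior (cell M K) = {}"
          using slab_mesh K K' False unfolding slab_mesh_def by blast
        ultimately show ?thesis by (auto simp: \<Phi>_def)
      qed
      then show ?thesis using zero_in_Q3 by (intro bexI[of _ "\<lambda>\<xi>. 0"]) auto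
    qed
  qed
  moreover have "\<Phi> x = 0" if "x \<notin> interior (cell M K)" for x using that by (simp add: \<Phi>_def)
  ultimately show ?thesis using eq by blast
qed

text \<open>Time factors on the partition of \<open>K0\<close> and spatial factors vanishing outside
  \<open>K\<close>: expansions of different elements can then simply be added.\<close>

definition element_expansion ::
  "'a \<Rightarrow> 'a \<Rightarrow> field3 \<Rightarrow> nat \<Rightarrow> (nat \<Rightarrow> nat \<Rightarrow> real poly) \<Rightarrow> (nat \<Rightarrow> real^3 \<Rightarrow> real^3) \<Rightarrow> bool" where
  "element_expansion K0 K u n P \<Phi> \<longleftrightarrow>
    (\<forall>i<n. \<Phi> i \<in> Xh M \<and> (\<forall>x. x \<notin> interior (cell M K) \<longrightarrow> \<Phi> i x = 0) \<and> continuous_pieces K0 (P i)) \<and>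
    (\<forall>t x. a < t \<longrightarrow> t \<le> b \<longrightarrow> x \<in> interior (cell M K) \<longrightarrow>
      u t x = (\<Sum>i<n. pw (tpart M K0) (nsub M K0) (P i) t *\<^sub>R \<Phi> i x))"

lemma V_h_element:
  assumes K0: "K0 \<in> elems M" and K: "K \<in> elems M" and u: "u \<in> V_h {a<..b} \<Omega> M"
  shows "\<exists>n P \<Phi>. element_expansion K0 K u n P \<Phi>"
proof -
  interpret hexahedron "emap M K" "chart K" by (rule hexahedron[OF K])
  have "pullback_in {a<..b} M K (S_space {a<..b} M K) u" using u K unfolding V_h_def by blast
  then obtain n s q where sq: "\<And>i. i < (n::nat) \<Longrightarrow> s i \<in> S_space {a<..b} M K"
      "\<And>i. i < n \<Longrightarrow> q i \<in> Q3_space (xdeg M K) (ydeg M K) (zdeg M K)"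
    and eq: "\<And>t \<xi>. t \<in> {a<..b} \<Longrightarrow> \<xi> \<in> box 0 1 \<Longrightarrow>
      transpose (DF M K \<xi>) *v u t (emap M K \<xi>) = (\<Sum>i<n. s i t *\<^sub>R q i \<xi>)"
    unfolding pullback_in_def tensor_def interior_cbox by blast
  have "\<forall>i\<in>{..<n}. \<exists>P. continuous_pieces K0 P \<and> (\<forall>t. a < t \<longrightarrow> t \<le> b \<longrightarrow> s i t = pw (tpart M K0) (nsub M K0) P t)"
    using S_space_pieces[OF K0 K sq(1)] by blast
  from bchoice[OF this] obtain P where "\<forall>i\<in>{..<n}. continuous_pieces K0 (P i) \<and>
    (\<forall>t. a < t \<longrightarrow> t \<le> b \<longrightarrow> s i t = pw (tpart M K0) (nsub M K0) (P i) t)" ..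
  then have P: "\<And>i. i < n \<Longrightarrow> continuous_pieces K0 (P i)"
    "\<And>i t. i < n \<Longrightarrow> a < t \<Longrightarrow> t \<le> b \<Longrightarrow> s i t = pw (tpart M K0) (nsub M K0) (P i) t"
    by blast+
  have "\<forall>i\<in>{..<n}. \<exists>\<Phi>. \<Phi> \<in> Xh M \<and> (\<forall>\<xi>\<in>box 0 1. \<Phi> (emap M K \<xi>) = matrix_inv (transpose (DF M K \<xi>)) *v q i \<xi>) \<and>
    (\<forall>x. x \<notin> interior (cell M K) \<longrightarrow> \<Phi> x = 0)"
    using push_forward[OF K sq(2)] by blast
  from bchoice[OF this] obtain \<Phi> where "\<forall>i\<in>{..<n}. \<Phi> i \<in> Xh M \<and>
    (\<forall>\<xi>\<in>box 0 1. \<Phi> i (emap M K \<xi>) = matrix_inv (transpose (DF M K \<xi>)) *v q i \<xi>) \<and>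
    (\<forall>x. x \<notin> interior (cell M K) \<longrightarrow> \<Phi> i x = 0)" ..
  then have \<Phi>: "\<And>i. i < n \<Longrightarrow> \<Phi> i \<in> Xh M"
    "\<And>i \<xi>. i < n \<Longrightarrow> \<xi> \<in> box 0 1 \<Longrightarrow> \<Phi> i (emap M K \<xi>) = matrix_inv (transpose (DF M K \<xi>)) *v q i \<xi>"
    "\<And>i x. i < n \<Longrightarrow> x \<notin> interior (cell M K) \<Longrightarrow> \<Phi> i x = 0"
    by blast+
  have "u t x = (\<Sum>i<n. pw (tpart M K0) (nsub M K0) (P i) t *\<^sub>R \<Phi> i x)"
    if t: "a < t" "t \<le> b" and x: "x \<in> interior (cell M K)" for t x
  proof -
    obtain \<xi> where \<xi>: "\<xi> \<in> box 0 1" "x = emap M K \<xi>" using x interior_cell[OF K] by blast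
    then have "\<xi> \<in> ref_cube" using box_subset_cbox by blast
    then have iv: "invertible (transpose (DF M K \<xi>))"
      using det_Jac_nz[of \<xi>] by (simp add: DF_def invertible_det_nz det_transpose)
    have "u t x = matrix_inv (transpose (DF M K \<xi>)) *v (transpose (DF M K \<xi>) *v u t x)"
      by (simp only: matrix_vector_mul_assoc matrix_inv(2)[OF iv] matrix_vector_mul_lid)
    also have "\<dots> = (\<Sum>i<n. s i t *\<^sub>R (matrix_inv (transpose (DF M K \<xi>)) *v q i \<xi>))"
      using eq[of t \<xi>] t \<xi> by (simp add: linear_sum[OF matrix_vector_mul_linear] matrix_vector_mult_scaleR)
    also have "\<dots> = (\<Sum>i<n. pw (tpart M K0) (nsub M K0) (P i) t *\<^sub>R \<Phi> i x)"
      using P(2) \<Phi>(2) t \<xi> by (intro sum.cong) auto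
    finally show ?thesis .
  qed
  then show ?thesis
    using P \<Phi> unfolding element_expansion_def by (intro exI[of _ n] exI[of _ P] exI[of _ \<Phi>]) auto
qed

lemma V_h_representation:
  assumes K0: "K0 \<in> elems M" and u: "u \<in> V_h {a<..b} \<Omega> M"
  shows "\<exists>(A :: ('a \<times> nat) set) P \<Phi>. finite A \<and> (\<forall>i\<in>A. \<Phi> i \<in> Xh M \<and>
      continuous_pieces K0 (P i)) \<and>
    (\<forall>t x. a < t \<longrightarrow> t \<le> b \<longrightarrow> x \<in> mesh_interior M \<longrightarrow>
      u t x = sep (tpart M K0) (nsub M K0) A P \<Phi> t x)"
proof -
  let ?\<tau> = "tpart M K0" and ?m = "nsub M K0"
  \<comment> \<open>Length, time factors and spatial factors are packed into one triple, so that a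
    single choice over the elements yields all three.\<close>
  have "\<forall>K\<in>elems M. \<exists>d. element_expansion K0 K u (fst d) (fst (snd d)) (snd (snd d))"
    unfolding split_paired_Ex fst_conv snd_conv using V_h_element[OF K0 _ u] by blast
  from bchoice[OF this] obtain d where
    d: "\<forall>K\<in>elems M. element_expansion K0 K u (fst (d K)) (fst (snd (d K))) (snd (snd (d K)))" ..
  define n where "n K = fst (d K)" for K
  define P where "P = (\<lambda>(K, i). fst (snd (d K)) i)"
  define \<Phi> where "\<Phi> = (\<lambda>(K, i). snd (snd (d K)) i)"
  define A where "A = Sigma (elems M) (\<lambda>K. {..<n K})"
  have props: "\<Phi> (K, i) \<in> Xh M" "\<And>x. x \<notin> interior (cell M K) \<Longrightarrow> \<Phi> (K, i) x = 0"
    "continuous_pieces K0 (P (K, i))"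
    if "K \<in> elems M" "i < n K" for K i
    using bspec[OF d that(1)] that(2) by (auto simp: element_expansion_def n_def P_def \<Phi>_def case_prod_beta)
  have rep: "u t x = (\<Sum>i<n K. pw ?\<tau> ?m (P (K, i)) t *\<^sub>R \<Phi> (K, i) x)"
    if "K \<in> elems M" "a < t" "t \<le> b" "x \<in> interior (cell M K)" for K t x
    using bspec[OF d that(1)] that(2-) by (auto simp: element_expansion_def n_def P_def \<Phi>_def case_prod_beta)
  have "u t x = sep ?\<tau> ?m A P \<Phi> t x" if t: "a < t" "t \<le> b" and x: "x \<in> mesh_interior M" for t x
  proof -
    obtain K where K: "K \<in> elems M" "x \<in> interior (cell M K)" using x unfolding mesh_interior_def by blast
    have "sep ?\<tau> ?m A P \<Phi> t x = (\<Sum>K'\<in>elems M. \<Sum>i<n K'. pw ?\<tau> ?m (P (K', i)) t *\<^sub>R \<Phi> (K', i) x)"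
      unfolding sep_def A_def using finite_elems by (simp add: sum.Sigma case_prod_beta)
    \<comment> \<open>At a point inside \<open>K\<close> the spatial factors of all other elements
      vanish.\<close>
    also have "\<dots> = (\<Sum>K'\<in>elems M. if K' = K then \<Sum>i<n K. pw ?\<tau> ?m (P (K, i)) t *\<^sub>R \<Phi> (K, i) x else 0)"
    proof (intro sum.cong refl)
      fix K' assume K': "K' \<in> elems M"
      show "(\<Sum>i<n K'. pw ?\<tau> ?m (P (K', i)) t *\<^sub>R \<Phi> (K', i) x)
        = (if K' = K then \<Sum>i<n K. pw ?\<tau> ?m (P (K, i)) t *\<^sub>R \<Phi> (K, i) x else 0)"
      proof (cases "K' = K")
        case False
        have "interior (cell M K') \<inter> interior (cell M K) = {}"
          using slab_mesh K K' False unfolding slab_mesh_def by blast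
        then have "x \<notin> interior (cell M K')" using K(2) by blast
        then show ?thesis using False props(2)[OF K'] by simp
      qed simp
    qed
    also have "\<dots> = u t x"
      using K finite_elems rep[OF K(1) t K(2)] by (simp add: sum.delta)
    finally show ?thesis by simp
  qed
  moreover have "finite A" unfolding A_def using finite_elems by simp
  ultimately show ?thesis
    using props by (intro exI[of _ A] exI[of _ P] exI[of _ \<Phi>]) (auto simp: A_def)
qed

lemma solution_representation:
  assumes K0: "K0 \<in> elems M" and E: "E \<in> V_h {a<..b} \<Omega> M" and H: "H \<in> V_h {a<..b} \<Omega> M"
    and "elementwise_constant M \<epsilon>" "elementwise_constant M \<mu>"
    and "\<epsilon>0 > 0" "\<And>x. x \<in> \<Omega> \<Longrightarrow> \<epsilon>0 \<le> \<epsilon> x" "\<mu>0 > 0" "\<And>x. x \<in> \<Omega> \<Longrightarrow> \<mu>0 \<le> \<mu> x"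
  shows "\<exists>(A :: ('a \<times> nat + 'a \<times> nat) set) P \<Phi> \<Psi>.
    slab_solution \<Omega> a b M (tpart M K0) (nsub M K0) p A P \<Phi> \<Psi> E H \<epsilon> \<mu> \<epsilon>0 \<mu>0"
proof -
  let ?\<tau> = "tpart M K0" and ?m = "nsub M K0"
  obtain A1 :: "('a \<times> nat) set" and P1 \<Phi>1 where 1: "finite A1"
    "\<And>i. i \<in> A1 \<Longrightarrow> \<Phi>1 i \<in> Xh M" "\<And>i. i \<in> A1 \<Longrightarrow> continuous_pieces K0 (P1 i)"
    "\<And>t x. a < t \<Longrightarrow> t \<le> b \<Longrightarrow> x \<in> mesh_interior M \<Longrightarrow> E t x = sep ?\<tau> ?m A1 P1 \<Phi>1 t x"
    using V_h_representation[OF K0 E] by blast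
  obtain A2 :: "('a \<times> nat) set" and P2 \<Phi>2 where 2: "finite A2"
    "\<And>i. i \<in> A2 \<Longrightarrow> \<Phi>2 i \<in> Xh M" "\<And>i. i \<in> A2 \<Longrightarrow> continuous_pieces K0 (P2 i)"
    "\<And>t x. a < t \<Longrightarrow> t \<le> b \<Longrightarrow> x \<in> mesh_interior M \<Longrightarrow> H t x = sep ?\<tau> ?m A2 P2 \<Phi>2 t x"
    using V_h_representation[OF K0 H] by blast
  \<comment> \<open>On the disjoint union each field gets zero spatial factors at the indices of the
    other, which makes the time factors common to both.\<close>
  let ?A = "A1 <+> A2" and ?P = "case_sum P1 P2"
  let ?\<Phi> = "case_sum \<Phi>1 (\<lambda>i x. 0)" and ?\<Psi> = "case_sum (\<lambda>i x. 0) \<Phi>2"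
  have \<Phi>: "sep ?\<tau> ?m ?A ?P ?\<Phi> t x = sep ?\<tau> ?m A1 P1 \<Phi>1 t x" for t x
    unfolding sep_def by (simp add: sum.Plus[OF 1(1) 2(1)])
  have \<Psi>: "sep ?\<tau> ?m ?A ?P ?\<Psi> t x = sep ?\<tau> ?m A2 P2 \<Phi>2 t x" for t x
    unfolding sep_def by (simp add: sum.Plus[OF 1(1) 2(1)])
  have "slab_solution \<Omega> a b M ?\<tau> ?m p ?A ?P ?\<Phi> ?\<Psi> E H \<epsilon> \<mu> \<epsilon>0 \<mu>0"
  proof unfold_locales
    show "pcb \<Omega> \<epsilon>" "pcb \<Omega> \<mu>" using assms elementwise_constant_pcb by auto
    show "pw ?\<tau> ?m R \<in> T_space {a<..b} M K" if "K \<in> elems M" "\<And>j. j < ?m \<Longrightarrow> degree (R j) < p" for K R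
      using pw_in_T_space[OF K0 that(1), of R] that(2) by blast
  qed (use 1 2 assms nsub_pos[OF K0] degree_pos[OF K0] mesh_time[OF K0] zero_in_Xh in \<open>auto simp: \<Phi> \<Psi> continuous_pieces_def\<close>)
  then show ?thesis by blast
qed

end

section \<open>Summation over the slabs\<close>

lemma (in slab_solution) energy_nonneg: "0 \<le> energy \<Omega> \<epsilon> \<mu> E H b"
  unfolding energy_end using psd_C by (simp add: psd_def)

text \<open>Each increment is estimated with the largest energy rather than the previous one, so
  absorption replaces a Gronwall argument and no exponential factor arises. Steps start at
  \<open>k = 2\<close>, since the solution is continued only across the nodes from
  \<open>tk \<Delta> 1\<close> on.\<close>

lemma discrete_energy_bound:
  fixes e D :: "nat \<Rightarrow> real"
  assumes \<Delta>: "\<Delta> > 0" and N: "N \<ge> 1" and T: "T = real N * \<Delta>"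
    and e: "\<And>k. k \<in> {1..N} \<Longrightarrow> 0 \<le> e k" and D: "\<And>k. 0 \<le> D k"
    and step: "\<And>k. k \<in> {2..N} \<Longrightarrow> \<exists>X\<ge>0. e k - e (k - 1) \<le> D k * X \<and>
      X\<^sup>2 \<le> 2 * \<Delta> * e (k - 1) + 2 * \<Delta> * D k * X"
  shows "e N \<le> 2 * e 1 + 2 * (\<Sum>k=1..N. (2 * T + \<Delta>\<^sup>2 / (2 * T)) * (D k)\<^sup>2)"
proof -
  \<comment> \<open>In this lemma \<open>\<mu>\<close> is the largest energy, not the
    permeability.\<close>
  define \<mu> where "\<mu> = Max (e ` {1..N})"
  have \<mu>: "e k \<le> \<mu>" if "k \<in> {1..N}" for k
    unfolding \<mu>_def using that by (intro Max_ge) auto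
  have \<mu>_in: "\<mu> \<in> e ` {1..N}"
    unfolding \<mu>_def using N by (intro Max_in) auto
  define c where "c = 2 * T + \<Delta>\<^sup>2 / (2 * T)"
  \<comment> \<open>Summed over \<open>N\<close> slabs, the second part amounts to
    \<open>\<mu> / 2\<close>, which is absorbed at the end.\<close>
  define r where "r j = c * (D j)\<^sup>2 + \<mu> / (2 * real N)" for j
  have T0: "T > 0" unfolding T using \<Delta> N by simp
  have c0: "c \<ge> 0" unfolding c_def using T0 by simp
  have inc: "e k \<le> e (k - 1) + r k" if k: "k \<in> {2..N}" for k
  proof -
    obtain X where X: "X \<ge> 0" "e k - e (k - 1) \<le> D k * X" "X\<^sup>2 \<le> 2 * \<Delta> * e (k - 1) + 2 * \<Delta> * D k * X"
      using step[OF k] by blast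
    have "k - 1 \<in> {1..N}" using k by auto
    from \<mu>[OF this] have "2 * \<Delta> * e (k - 1) \<le> 2 * \<Delta> * \<mu>"
      using \<Delta> by (intro mult_left_mono) auto
    \<comment> \<open>Young's inequality: half of \<open>X\<^sup>2\<close> goes to the left side,
      which doubles the remaining terms to the factors 4.\<close>
    moreover have "2 * (2 * \<Delta> * D k) * X \<le> (2 * \<Delta> * D k)\<^sup>2 + X\<^sup>2"
      by (rule sum_squares_bound)
    ultimately have "X\<^sup>2 \<le> 4 * \<Delta> * \<mu> + 4 * \<Delta>\<^sup>2 * (D k)\<^sup>2"
      using X(3) by (simp add: power_mult_distrib)
    then have "X\<^sup>2 / (8 * T) \<le> (4 * \<Delta> * \<mu> + 4 * \<Delta>\<^sup>2 * (D k)\<^sup>2) / (8 * T)"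
      using T0 by (intro divide_right_mono) auto
    moreover have "(4 * \<Delta> * \<mu> + 4 * \<Delta>\<^sup>2 * (D k)\<^sup>2) / (8 * T) = \<mu> / (2 * real N) + \<Delta>\<^sup>2 / (2 * T) * (D k)\<^sup>2"
      using \<Delta> N unfolding T by (simp add: field_simps power2_eq_square)
    \<comment> \<open>The weight \<open>8 * T\<close> is chosen so that
      \<open>4 * \<Delta> * \<mu> / (8 * T)\<close> is exactly \<open>\<mu> / (2 * real N)\<close>.
      It leaves \<open>2 * T\<close> in front of \<open>(D k)\<^sup>2\<close>, and the other part of
      the bound on \<open>X\<^sup>2\<close> adds \<open>\<Delta>\<^sup>2 / (2 * T)\<close>.\<close>
    moreover have "D k * X \<le> 2 * T * (D k)\<^sup>2 + X\<^sup>2 / (8 * T)"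
    proof -
      have "0 \<le> (4 * T * D k - X)\<^sup>2 / (8 * T)" using T0 by simp
      also have "\<dots> = 2 * T * (D k)\<^sup>2 + X\<^sup>2 / (8 * T) - D k * X"
        using T0 by (simp add: field_simps power2_eq_square)
      finally show ?thesis by simp
    qed
    ultimately show ?thesis
      using X(2) unfolding r_def c_def by (simp add: distrib_right)
  qed
  have sum: "e k \<le> e 1 + (\<Sum>j\<in>{2..k}. r j)" if "1 \<le> k" "k \<le> N" for k
    using that
  proof (induction k rule: dec_induct)
    case (step k)
    then have "e (Suc k) \<le> e k + r (Suc k)" using inc[of "Suc k"] by simp
    moreover have "{2..Suc k} = insert (Suc k) {2..k}" using step by auto
    ultimately show ?case using step by simp
  qed simp
  have \<mu>0: "0 \<le> \<mu>" using \<mu>_in e by auto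
  let ?S = "\<Sum>k=1..N. c * (D k)\<^sup>2"
  have "e k \<le> e 1 + ?S + \<mu> / 2" if k: "k \<in> {1..N}" for k
  proof -
    have "e k \<le> e 1 + (\<Sum>j\<in>{2..k}. r j)" using sum k by simp
    \<comment> \<open>Extending the range, also by index 1, is allowed because \<open>r\<close> is
      nonnegative.\<close>
    also have "(\<Sum>j\<in>{2..k}. r j) \<le> (\<Sum>j=1..N. r j)"
      using k c0 \<mu>0 by (intro sum_mono2) (auto simp: r_def)
    also have "\<dots> = ?S + \<mu> / 2"
      using N by (simp add: r_def sum.distrib)
    finally show ?thesis by simp
  qed
  then have "\<mu> \<le> e 1 + ?S + \<mu> / 2" using \<mu>_in by auto
  then have "e N \<le> 2 * e 1 + 2 * ?S" using \<mu>[of N] N by simp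
  then show ?thesis unfolding c_def .
qed

theorem theorem3p2:
  fixes \<Omega> :: "(real^3) set"
    and M :: "nat \<Rightarrow> 'e mesh"
    and \<epsilon> \<mu> :: "real^3 \<Rightarrow> real"
    and J g E\<^sub>h H\<^sub>h :: "real \<Rightarrow> real^3 \<Rightarrow> real^3"
    and \<Delta> \<epsilon>\<^sub>m\<^sub>i\<^sub>n \<mu>\<^sub>m\<^sub>i\<^sub>n :: real
    and N p\<^sub>t :: nat
  assumes "open \<Omega>" and "\<Delta> > 0" and "N \<ge> 1"
    and mesh: "\<And>k. k \<in> {1..N} \<Longrightarrow> slab_mesh \<Omega> (tk \<Delta> (k - 1)) (tk \<Delta> k) (M k)"
    and constant_degree: "\<And>k K j. k \<in> {1..N} \<Longrightarrow> K \<in> elems (M k) \<Longrightarrow> j < nsub (M k) K \<Longrightarrow>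
          tdeg (M k) K j = p\<^sub>t"
    and no_local_refinement: "\<And>k K K'. k \<in> {1..N} \<Longrightarrow> K \<in> elems (M k) \<Longrightarrow> K' \<in> elems (M k) \<Longrightarrow>
          T_space (slab \<Delta> k) (M k) K = T_space (slab \<Delta> k) (M k) K'"
    and "\<epsilon>\<^sub>m\<^sub>i\<^sub>n > 0" and "\<And>x. x \<in> \<Omega> \<Longrightarrow> \<epsilon> x \<ge> \<epsilon>\<^sub>m\<^sub>i\<^sub>n"
    and "\<mu>\<^sub>m\<^sub>i\<^sub>n > 0" and "\<And>x. x \<in> \<Omega> \<Longrightarrow> \<mu> x \<ge> \<mu>\<^sub>m\<^sub>i\<^sub>n"
    and "\<And>k. k \<in> {1..N} \<Longrightarrow> elementwise_constant (M k) \<epsilon> \<and> elementwise_constant (M k) \<mu>"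
    and data: "\<And>k. k \<in> {1..N} \<Longrightarrow> admissible_data (slab \<Delta> k) \<Omega> (M k) J g"
    and solution: "discrete_solution \<Delta> N \<Omega> M \<epsilon> \<mu> J g E\<^sub>h H\<^sub>h"
  shows "ennreal (energy \<Omega> \<epsilon> \<mu> E\<^sub>h H\<^sub>h (tk \<Delta> N))
     \<le> 2 * ennreal (energy \<Omega> \<epsilon> \<mu> E\<^sub>h H\<^sub>h (tk \<Delta> 1))
       + 2 * (\<Sum>k=1..N.
           ennreal (2 * tk \<Delta> N / \<epsilon>\<^sub>m\<^sub>i\<^sub>n + \<Delta>\<^sup>2 / (2 * tk \<Delta> N * \<epsilon>\<^sub>m\<^sub>i\<^sub>n))
             * (dual_norm (slab \<Delta> k) \<Omega> (M k) (ell_E (slab \<Delta> k) \<Omega> J))\<^sup>2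
         + ennreal (2 * tk \<Delta> N / \<mu>\<^sub>m\<^sub>i\<^sub>n + \<Delta>\<^sup>2 / (2 * tk \<Delta> N * \<mu>\<^sub>m\<^sub>i\<^sub>n))
             * (dual_norm (slab \<Delta> k) \<Omega> (M k) (ell_H (slab \<Delta> k) \<Omega> (M k) g))\<^sup>2)"
proof (cases "\<Omega> = {}")
  \<comment> \<open>An empty domain may come with an empty mesh, which offers no reference element;
    the energy is then 0.\<close>
  case True
  then show ?thesis by (simp add: energy_def set_lebesgue_integral_def)
next
  case False
  let ?I = "slab \<Delta>"
  define DE where "DE k = dual_norm (?I k) \<Omega> (M k) (ell_E (?I k) \<Omega> J)" for k
  define DH where "DH k = dual_norm (?I k) \<Omega> (M k) (ell_H (?I k) \<Omega> (M k) g)" for k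
  define T where "T = tk \<Delta> N"
  have T0: "T > 0" using assms(2,3) by (simp add: T_def tk_def)
  define cE where "cE = 2 * T / \<epsilon>\<^sub>m\<^sub>i\<^sub>n + \<Delta>\<^sup>2 / (2 * T * \<epsilon>\<^sub>m\<^sub>i\<^sub>n)"
  define cH where "cH = 2 * T / \<mu>\<^sub>m\<^sub>i\<^sub>n + \<Delta>\<^sup>2 / (2 * T * \<mu>\<^sub>m\<^sub>i\<^sub>n)"
  have c: "cE > 0" "cH > 0"
    unfolding cE_def cH_def using T0 assms(7,9) by (auto intro!: add_pos_nonneg)
  define e where "e k = energy \<Omega> \<epsilon> \<mu> E\<^sub>h H\<^sub>h (tk \<Delta> k)" for k
  have goal: "ennreal (e N) \<le> 2 * ennreal (e 1) + 2 * (\<Sum>k=1..N. ennreal cE * (DE k)\<^sup>2 + ennreal cH * (DH k)\<^sup>2)"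
  proof (cases "\<exists>k\<in>{1..N}. DE k = top \<or> DH k = top")
    \<comment> \<open>Both coefficients are positive, so an infinite dual norm makes the right side
      infinite.\<close>
    case True
    then obtain k where k: "k \<in> {1..N}" "DE k = top \<or> DH k = top" by blast
    then have "ennreal cE * (DE k)\<^sup>2 + ennreal cH * (DH k)\<^sup>2 = top"
      using c by (auto simp: ennreal_mult_eq_top_iff power_eq_top_ennreal)
    moreover have "ennreal cE * (DE k)\<^sup>2 + ennreal cH * (DH k)\<^sup>2
        \<le> (\<Sum>k=1..N. ennreal cE * (DE k)\<^sup>2 + ennreal cH * (DH k)\<^sup>2)"
      using k(1) by (intro member_le_sum) auto
    ultimately have *: "(\<Sum>k=1..N. ennreal cE * (DE k)\<^sup>2 + ennreal cH * (DH k)\<^sup>2) = top"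
      by (metis top_unique)
    have "2 * (top :: ennreal) = top"
      by (simp add: ennreal_mult_eq_top_iff)
    then show ?thesis unfolding * by simp
  next
    case False
    define de where "de k = enn2real (DE k)" for k
    define dh where "dh k = enn2real (DH k)" for k
    have d: "DE k = ennreal (de k)" "DH k = ennreal (dh k)" if "k \<in> {1..N}" for k
      using False that unfolding de_def dh_def by (auto simp: less_top)
    have d0: "0 \<le> de k" "0 \<le> dh k" for k
      unfolding de_def dh_def by auto
    \<comment> \<open>With this \<open>D\<close> the product of
      \<open>2 * T + \<Delta>\<^sup>2 / (2 * T)\<close> and \<open>(D k)\<^sup>2\<close> splits
      exactly into the terms with \<open>cE\<close> and \<open>cH\<close>.\<close>
    define D where "D k = sqrt ((de k)\<^sup>2 / \<epsilon>\<^sub>m\<^sub>i\<^sub>n + (dh k)\<^sup>2 / \<mu>\<^sub>m\<^sub>i\<^sub>n)" for k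
    have D0: "0 \<le> (de k)\<^sup>2 / \<epsilon>\<^sub>m\<^sub>i\<^sub>n + (dh k)\<^sup>2 / \<mu>\<^sub>m\<^sub>i\<^sub>n" for k
      using assms(7,9) by simp
    have tk_step: "tk \<Delta> k - tk \<Delta> (k - 1) = \<Delta>" if "k \<ge> 1" for k
      using that by (simp add: tk_def of_nat_diff algebra_simps)
    have slab: "\<exists>\<tau> m p (A :: ('e \<times> nat + 'e \<times> nat) set) P \<Phi> \<Psi>.
        slab_solution \<Omega> (tk \<Delta> (k - 1)) (tk \<Delta> k) (M k) \<tau> m p A P \<Phi> \<Psi> E\<^sub>h H\<^sub>h \<epsilon> \<mu> \<epsilon>\<^sub>m\<^sub>i\<^sub>n \<mu>\<^sub>m\<^sub>i\<^sub>n"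
      if k: "k \<in> {1..N}" for k
    proof -
      interpret slab_grid \<Omega> "tk \<Delta> (k - 1)" "tk \<Delta> k" "M k"
        by unfold_locales (use assms(1) mesh[OF k] in auto)
      interpret uniform_slab \<Omega> "tk \<Delta> (k - 1)" "tk \<Delta> k" "M k" p\<^sub>t
      proof unfold_locales
        show "tdeg (M k) K j = p\<^sub>t" if "K \<in> elems (M k)" "j < nsub (M k) K" for K j
          by (rule constant_degree[OF k that])
        show "T_space {tk \<Delta> (k - 1)<..tk \<Delta> k} (M k) K = T_space {tk \<Delta> (k - 1)<..tk \<Delta> k} (M k) K'"
          if "K \<in> elems (M k)" "K' \<in> elems (M k)" for K K'
          using no_local_refinement[OF k that] unfolding slab_def .
        have "k \<ge> 1" using k by simp
        from tk_step[OF this] show "tk \<Delta> (k - 1) < tk \<Delta> k" using assms(2) by linarith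
      qed
      \<comment> \<open>Any element can provide the common time partition; one exists since the
        elements cover the nonempty \<open>\<Omega>\<close>.\<close>
      obtain K0 where "K0 \<in> elems (M k)"
        using \<open>\<Omega> \<noteq> {}\<close> \<Omega>_subset by blast
      moreover have "E\<^sub>h \<in> V_h (?I k) \<Omega> (M k)" "H\<^sub>h \<in> V_h (?I k) \<Omega> (M k)"
        using solution k unfolding discrete_solution_def by (auto simp: Let_def)
      moreover have "elementwise_constant (M k) \<epsilon>" "elementwise_constant (M k) \<mu>"
        using assms(11)[OF k] by auto
      ultimately show ?thesis
        using solution_representation[of K0 E\<^sub>h H\<^sub>h \<epsilon> \<mu> \<epsilon>\<^sub>m\<^sub>i\<^sub>n \<mu>\<^sub>m\<^sub>i\<^sub>n] assms(7-10) unfolding slab_def by blast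
    qed
    have e0: "0 \<le> e k" and regular: "pcb \<Omega> (E\<^sub>h (tk \<Delta> k))" "pcb \<Omega> (H\<^sub>h (tk \<Delta> k))" if k: "k \<in> {1..N}" for k
    proof -
      obtain \<tau> m p P \<Phi> \<Psi> and A :: "('e \<times> nat + 'e \<times> nat) set" where
        "slab_solution \<Omega> (tk \<Delta> (k - 1)) (tk \<Delta> k) (M k) \<tau> m p A P \<Phi> \<Psi> E\<^sub>h H\<^sub>h \<epsilon> \<mu> \<epsilon>\<^sub>m\<^sub>i\<^sub>n \<mu>\<^sub>m\<^sub>i\<^sub>n"
        using slab[OF k] by blast
      then interpret slab_solution \<Omega> "tk \<Delta> (k - 1)" "tk \<Delta> k" "M k" \<tau> m p A P \<Phi> \<Psi> E\<^sub>h H\<^sub>h \<epsilon> \<mu> \<epsilon>\<^sub>m\<^sub>i\<^sub>n \<mu>\<^sub>m\<^sub>i\<^sub>n .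
      show "0 \<le> e k" unfolding e_def by (rule energy_nonneg)
      show "pcb \<Omega> (E\<^sub>h (tk \<Delta> k))" "pcb \<Omega> (H\<^sub>h (tk \<Delta> k))" by (rule pcb_end)+
    qed
    have step: "\<exists>X\<ge>0. e k - e (k - 1) \<le> D k * X \<and> X\<^sup>2 \<le> 2 * \<Delta> * e (k - 1) + 2 * \<Delta> * D k * X"
      if k: "k \<in> {2..N}" for k
    proof -
      \<comment> \<open>Slab \<open>k - 1\<close> supplies the regularity of the initial value, and
        \<open>k - 1 < N\<close> its continuation across the node.\<close>
      have k1: "k \<in> {1..N}" "k - 1 \<in> {1..N}" "k - 1 \<in> {1..<N}" using k by auto
      obtain \<tau> m p P \<Phi> \<Psi> and A :: "('e \<times> nat + 'e \<times> nat) set" where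
        "slab_solution \<Omega> (tk \<Delta> (k - 1)) (tk \<Delta> k) (M k) \<tau> m p A P \<Phi> \<Psi> E\<^sub>h H\<^sub>h \<epsilon> \<mu> \<epsilon>\<^sub>m\<^sub>i\<^sub>n \<mu>\<^sub>m\<^sub>i\<^sub>n"
        using slab[OF k1(1)] by blast
      then interpret slab_solution \<Omega> "tk \<Delta> (k - 1)" "tk \<Delta> k" "M k" \<tau> m p A P \<Phi> \<Psi> E\<^sub>h H\<^sub>h \<epsilon> \<mu> \<epsilon>\<^sub>m\<^sub>i\<^sub>n \<mu>\<^sub>m\<^sub>i\<^sub>n .
      have I: "{tk \<Delta> (k - 1)<..tk \<Delta> k} = ?I k" by (simp add: slab_def)
      have "\<exists>X\<ge>0. energy \<Omega> \<epsilon> \<mu> E\<^sub>h H\<^sub>h (tk \<Delta> k) - energy \<Omega> \<epsilon> \<mu> E\<^sub>h H\<^sub>h (tk \<Delta> (k - 1)) \<le> D k * X \<and>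
        X\<^sup>2 \<le> 2 * (tk \<Delta> k - tk \<Delta> (k - 1)) * energy \<Omega> \<epsilon> \<mu> E\<^sub>h H\<^sub>h (tk \<Delta> (k - 1))
          + 2 * (tk \<Delta> k - tk \<Delta> (k - 1)) * D k * X"
        unfolding D_def
      proof (rule slab_step[where J = J and g = g, unfolded I])
        show "continues_at \<Omega> E\<^sub>h (tk \<Delta> (k - 1))" "continues_at \<Omega> H\<^sub>h (tk \<Delta> (k - 1))"
          using solution k1(3) unfolding discrete_solution_def by auto
        show "C_h (?I k) \<Omega> (M k) \<epsilon> \<mu> (E\<^sub>h, H\<^sub>h) (v, w) = ell_E (?I k) \<Omega> J v + ell_H (?I k) \<Omega> (M k) g w"
          if "v \<in> W_h (?I k) \<Omega> (M k)" "w \<in> W_h (?I k) \<Omega> (M k)" for v w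
          using solution k1(1) that unfolding discrete_solution_def by (auto simp: Let_def)
      qed (use regular[OF k1(2)] d[OF k1(1)] d0 in \<open>auto simp: DE_def DH_def\<close>)
      moreover have "tk \<Delta> k - tk \<Delta> (k - 1) = \<Delta>"
        using k1(1) by (intro tk_step) simp
      ultimately show ?thesis
        unfolding e_def by (simp only:)
    qed
    have "e N \<le> 2 * e 1 + 2 * (\<Sum>k=1..N. (2 * T + \<Delta>\<^sup>2 / (2 * T)) * (D k)\<^sup>2)"
    proof (rule discrete_energy_bound[OF assms(2,3)])
      show "0 \<le> D k" for k unfolding D_def using D0 by simp
      show "\<exists>X\<ge>0. e k - e (k - 1) \<le> D k * X \<and> X\<^sup>2 \<le> 2 * \<Delta> * e (k - 1) + 2 * \<Delta> * D k * X"
        if "k \<in> {2..N}" for k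
        by (rule step[OF that])
    qed (simp_all add: T_def tk_def e0)
    also have "(\<Sum>k=1..N. (2 * T + \<Delta>\<^sup>2 / (2 * T)) * (D k)\<^sup>2) = (\<Sum>k=1..N. cE * (de k)\<^sup>2 + cH * (dh k)\<^sup>2)"
      using D0 T0 assms(7,9) unfolding D_def cE_def cH_def
      by (intro sum.cong refl) (simp add: field_simps)
    finally have "ennreal (e N) \<le> ennreal (2 * e 1 + 2 * (\<Sum>k=1..N. cE * (de k)\<^sup>2 + cH * (dh k)\<^sup>2))"
      by (rule ennreal_leI)
    also have "\<dots> = 2 * ennreal (e 1) + 2 * ennreal (\<Sum>k=1..N. cE * (de k)\<^sup>2 + cH * (dh k)\<^sup>2)"
      using e0[of 1] assms(3) c by (simp add: ennreal_plus ennreal_mult' sum_nonneg)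
    also have "ennreal (\<Sum>k=1..N. cE * (de k)\<^sup>2 + cH * (dh k)\<^sup>2)
        = (\<Sum>k=1..N. ennreal cE * (DE k)\<^sup>2 + ennreal cH * (DH k)\<^sup>2)"
      using c d d0 by (subst sum_ennreal[symmetric]) (auto simp: ennreal_plus ennreal_mult ennreal_power intro!: sum.cong)
    finally show ?thesis .
  qed
  then show ?thesis
    unfolding e_def DE_def DH_def cE_def cH_def T_def .
qed

end
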